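(* Let $V=(V_1,\ldots,V_k)$ be a $k$-tuple of doubly $\Lambda$-commuting row isometries acting on a Hilbert space $\mathcal K\ne\{0\}$. Then the following statements are equivalent. (i) The $C^*$-algebra $C^*(V_1,\ldots,V_k)$ is irreducible. (ii) There is a subset $A\subset\{1,\ldots,k\}$ (possibly empty) with $A^c=\{j_1,\ldots,j_{k-p}\}$ such that $V$ is unitarily equivalent to a standard $k$-tuple $V^{\mathcal W_A}$ of doubly $\Lambda$-commuting row isometries associated with a wandering data $\mathcal W_A=\{\mathcal L_A,(W_{j_1},\ldots,W_{j_{k-p}})\}$, where the $A$-wandering subspace $\mathcal L_A$ has only trivial subspaces that are invariant under $C^*(W_{j_1},\ldots,W_{j_{k-p}})$. Moreover, two such irreducible $k$-tuples $V$ and $V'$ are unitarily equivalent if and only if the corresponding sets $A$ and $A'$ are equal and the wandering data $\mathcal W_A$ and $\mathcal W_{A'}$ are unitarily equivalent.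
   Context: Fix integers $k\ge1$, $n_1,\ldots,n_k\ge 1$ and, for $i\ne j$ in $\{1,\ldots,k\}$, an $n_i\times n_j$ matrix $\Lambda_{i,j}=[\lambda_{i,j}(s,t)]$ with entries in $\mathbb T=\{z\in\mathbb C:|z|=1\}$, such that $\lambda_{j,i}(t,s)=\overline{\lambda_{i,j}(s,t)}$. A row isometry $V_i=[V_{i,1}\cdots V_{i,n_i}]$ on $\mathcal K$ consists of $V_{i,s}\in B(\mathcal K)$ with $V_{i,s}^*V_{i,t}=\delta_{st}I$; it is Cuntz if $\sum_sV_{i,s}V_{i,s}^*=I$. Row isometries are doubly $\Lambda$-commuting if $V_{i,s}^*V_{j,t}=\overline{\lambda_{i,j}(s,t)}\,V_{j,t}V_{i,s}^*$ for all $i\neq j$ in the index set and all $s,t$. $C^*(V_1,\ldots,V_k)$ is the unital $C^*$-algebra generated by all $V_{i,s}$; it is irreducible if its only closed invariant subspaces are $\{0\}$ and the whole space. $k$-tuples $V$ on $\mathcal K$, $V'$ on $\mathcal K'$ are unitarily equivalent if there is a unitary $U:\mathcal K\to\mathcal K'$ with $UV_{i,s}=V'_{i,s}U$ for all $i,s$. $\mathbb F_{n_i}^+$ is the unital free semigroup with generators $g_1^i,\ldots,g_{n_i}^i$ and neutral element $g_0^i$. An $A$-wandering data ($A\subset\{1,\ldots,k\}$, $A^c=\{j_1<\cdots<j_{k-p}\}$) is $\mathcal W_A=\{\mathcal L,(W_{j_1},\ldots,W_{j_{k-p}})\}$ where $\mathcal L$ is a Hilbert space and $W_j=[W_{j,1}\cdots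 W_{j,n_j}]$, $j\in A^c$, are doubly $\Lambda$-commuting Cuntz row isometries on $\mathcal L$ (for $A=\{1,\ldots,k\}$ the data is just $\mathcal L$ and $C^*(\,)$ of the empty tuple is $\mathbb CI_{\mathcal L}$). Two $A$-wandering data are unitarily equivalent if a unitary between the spaces intertwines the corresponding operators $W_{j,t}$. The standard $k$-tuple $V^{\mathcal W_A}$: let $A=\{i_1<\cdots<i_p\}$, $\boldsymbol\lambda_{i,j}(s,\beta):=\prod_{b=1}^q\lambda_{i,j}(s,j_b)$ for $\beta=g^j_{j_1}\cdots g^j_{j_q}$, $\boldsymbol\lambda_{i,j}(s,g_0^j):=1$. On $\ell^2(\mathbb F_{n_{i_1}}^+\times\cdots\times\mathbb F_{n_{i_p}}^+)\otimes\mathcal L$, with standard basis $\chi_{(\alpha_{i})_{i\in A}}$, put, for $i\in A$, $$V_{i,s}^{\mathcal W_A}(\chi_{(\alpha_l)_{l\in A}}\otimes h)=\Big(\prod_{j\in A,\,j<i}\boldsymbol\lambda_{i,j}(s,\alpha_j)\Big)\chi_{(\alpha_l')_{l\in A}}\otimes h,\quad \alpha'_i=g_s^i\alpha_i,\ \alpha_l'=\alpha_l\ (l\ne i),$$ and, for $i\in A^c$, $$V_{i,s}^{\mathcal W_A}(\chi_{(\alpha_l)_{l\in A}}\otimes h)=\Big(\prod_{j\in A}\boldsymbol\lambda_{i,j}(s,\alpha_j)\Big)\chi_{(\alpha_l)_{l\in A}}\otimes W_{i,s}h.$$ If $A=\emptyset$ the space is $\mathcal L$ and $V_{i,s}^{\mathcal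 W_A}=W_{i,s}$. The $A$-wandering subspace of $V^{\mathcal W_A}$ is identified with $\mathcal L$ (denoted $\mathcal L_A$). *)

theory Defs
  imports "HOL-Analysis.Analysis"
begin

section \<open>Complex Hilbert spaces\<close>

text \<open>
  Complex inner products are linear in the first argument.  The real structure required by
  \<^class>\<open>real_inner\<close> is the underlying one, so that norm, topology and completeness are those of
  the library.
\<close>

class complex_inner = real_inner +
  fixes scaleC :: "complex \<Rightarrow> 'a \<Rightarrow> 'a"  (infixr \<open>*\<^sub>C\<close> 75)
    and cinner :: "'a \<Rightarrow> 'a \<Rightarrow> complex"
  assumes scaleC_add_right: "c *\<^sub>C (x + y) = c *\<^sub>C x + c *\<^sub>C y"
    and scaleC_add_left: "(c + d) *\<^sub>C x = c *\<^sub>C x + d *\<^sub>C x"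
    and scaleC_scaleC: "c *\<^sub>C d *\<^sub>C x = (c * d) *\<^sub>C x"
    and scaleC_of_real: "complex_of_real r *\<^sub>C x = r *\<^sub>R x"
    and cinner_commute: "cinner x y = cnj (cinner y x)"
    and cinner_add_left: "cinner (x + y) z = cinner x z + cinner y z"
    and cinner_scaleC_left: "cinner (c *\<^sub>C x) y = c * cinner x y"
    and Re_cinner: "Re (cinner x y) = inner x y"

class chilbert_space = complex_inner + complete_space

lemma scaleC_zero_right [simp]: "c *\<^sub>C (0::'a::complex_inner) = 0"
  using scaleC_add_right[of c "0::'a" 0] by simp

lemma scaleC_zero_left [simp]: "0 *\<^sub>C (x::'a::complex_inner) = 0"
  using scaleC_add_left[of 0 0 x] by simp

lemma scaleC_one [simp]: "1 *\<^sub>C (x::'a::complex_inner) = x"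
  using scaleC_of_real[of 1 x] by simp

lemma Im_cinner: "Im (cinner (x::'a::complex_inner) y) = - inner (\<i> *\<^sub>C x) y"
  using Re_cinner[of "\<i> *\<^sub>C x" y] by (simp add: cinner_scaleC_left)

lemma norm_scaleC: "norm (c *\<^sub>C (x::'a::complex_inner)) = cmod c * norm x"
proof -
  have "cinner (c *\<^sub>C x) (c *\<^sub>C x) = (c * cnj c) * cinner x x"
    by (metis (no_types, lifting) cinner_commute cinner_scaleC_left complex_cnj_mult mult.assoc)
  then have "Re (cinner (c *\<^sub>C x) (c *\<^sub>C x)) = (cmod c)\<^sup>2 * Re (cinner x x)"
    by (simp add: flip: complex_norm_square of_real_power)
  then show ?thesis
    by (simp add: Re_cinner norm_eq_sqrt_inner real_sqrt_mult)
qed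

lemma norm_cinner_le: "cmod (cinner (x::'a::complex_inner) y) \<le> 2 * (norm x * norm y)"
proof -
  have "\<bar>inner x y\<bar> \<le> norm x * norm y" "\<bar>inner (\<i> *\<^sub>C x) y\<bar> \<le> norm x * norm y"
    using Cauchy_Schwarz_ineq2[of x y] Cauchy_Schwarz_ineq2[of "\<i> *\<^sub>C x" y]
    by (simp_all add: norm_scaleC)
  with cmod_le[of "cinner x y"] show ?thesis
    by (simp add: Re_cinner Im_cinner)
qed

instantiation complex :: chilbert_space
begin

definition scaleC_complex :: "complex \<Rightarrow> complex \<Rightarrow> complex" where
  "scaleC_complex c x = c * x"

definition cinner_complex :: "complex \<Rightarrow> complex \<Rightarrow> complex" where
  "cinner_complex x y = x * cnj y"

instance
  by standard
    (auto simp: scaleC_complex_def cinner_complex_def algebra_simps inner_complex_def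
      scaleR_conv_of_real)

end


section \<open>Square-summable families\<close>

text \<open>
  \<open>('i, 'b) ell2\<close> is the Hilbert space of square-summable families in \<open>'b\<close> indexed by \<open>'i\<close>;
  it is the usual model of the Hilbert space tensor product of the scalar sequence space over
  \<open>'i\<close> with \<open>'b\<close>.
\<close>

typedef (overloaded) ('i, 'b) ell2 =
  "{f :: 'i \<Rightarrow> 'b::chilbert_space. (\<lambda>i. (norm (f i))\<^sup>2) summable_on UNIV}"
  morphisms coord Abs_ell2
  by (rule exI[of _ "\<lambda>_. 0"]) simp

lemma coord_summable: "(\<lambda>i. (norm (coord f i))\<^sup>2) summable_on UNIV"
  using coord[of f] by simp

lemma ell2_eqI: "(\<And>i. coord f i = coord g i) \<Longrightarrow> f = g"
  by (simp add: coord_inject[symmetric] fun_eq_iff)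

lemma square_summable_add:
  fixes f g :: "'i \<Rightarrow> 'b::real_inner"
  assumes "(\<lambda>i. (norm (f i))\<^sup>2) summable_on UNIV" "(\<lambda>i. (norm (g i))\<^sup>2) summable_on UNIV"
  shows "(\<lambda>i. (norm (f i + g i))\<^sup>2) summable_on UNIV"
proof (rule summable_on_comparison_test)
  show "(\<lambda>i. 2 * (norm (f i))\<^sup>2 + 2 * (norm (g i))\<^sup>2) summable_on UNIV"
    by (intro summable_on_add summable_on_cmult_right assms)
  fix i
  have "(norm (f i + g i))\<^sup>2 \<le> (norm (f i) + norm (g i))\<^sup>2"
    by (intro power_mono norm_triangle_ineq) auto
  also have "\<dots> \<le> 2 * (norm (f i))\<^sup>2 + 2 * (norm (g i))\<^sup>2"
    using zero_le_power2[of "norm (f i) - norm (g i)"] by (simp add: power2_eq_square algebra_simps)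
  finally show "(norm (f i + g i))\<^sup>2 \<le> 2 * (norm (f i))\<^sup>2 + 2 * (norm (g i))\<^sup>2" .
qed auto

lemma cinner_summable:
  fixes f g :: "'i \<Rightarrow> 'b::complex_inner"
  assumes "(\<lambda>i. (norm (f i))\<^sup>2) summable_on UNIV" "(\<lambda>i. (norm (g i))\<^sup>2) summable_on UNIV"
  shows "(\<lambda>i. cinner (f i) (g i)) summable_on UNIV"
proof (rule abs_summable_summable)
  show "(\<lambda>i. norm (cinner (f i) (g i))) summable_on UNIV"
  proof (rule summable_on_comparison_test)
    show "(\<lambda>i. (norm (f i))\<^sup>2 + (norm (g i))\<^sup>2) summable_on UNIV"
      by (intro summable_on_add assms)
    show "norm (cinner (f i) (g i)) \<le> (norm (f i))\<^sup>2 + (norm (g i))\<^sup>2" for i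
      using norm_cinner_le[of "f i" "g i"] zero_le_power2[of "norm (f i) - norm (g i)"]
      by (simp add: power2_eq_square algebra_simps)
  qed auto
qed

lemma inner_summable:
  fixes f g :: "'i \<Rightarrow> 'b::complex_inner"
  assumes "(\<lambda>i. (norm (f i))\<^sup>2) summable_on UNIV" "(\<lambda>i. (norm (g i))\<^sup>2) summable_on UNIV"
  shows "(\<lambda>i. inner (f i) (g i)) summable_on UNIV"
  using summable_on_Re[OF cinner_summable[OF assms]] by (simp add: Re_cinner)

instantiation ell2 :: (type, chilbert_space) complex_inner
begin

definition zero_ell2 :: "('a, 'b) ell2" where "0 = Abs_ell2 (\<lambda>_. 0)"
definition plus_ell2 :: "('a, 'b) ell2 \<Rightarrow> ('a, 'b) ell2 \<Rightarrow> ('a, 'b) ell2" where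
  "f + g = Abs_ell2 (\<lambda>i. coord f i + coord g i)"
definition scaleC_ell2 :: "complex \<Rightarrow> ('a, 'b) ell2 \<Rightarrow> ('a, 'b) ell2" where
  "c *\<^sub>C f = Abs_ell2 (\<lambda>i. c *\<^sub>C coord f i)"
definition scaleR_ell2 :: "real \<Rightarrow> ('a, 'b) ell2 \<Rightarrow> ('a, 'b) ell2" where
  "r *\<^sub>R f = Abs_ell2 (\<lambda>i. r *\<^sub>R coord f i)"
definition uminus_ell2 :: "('a, 'b) ell2 \<Rightarrow> ('a, 'b) ell2" where
  "- f = Abs_ell2 (\<lambda>i. - coord f i)"
definition minus_ell2 :: "('a, 'b) ell2 \<Rightarrow> ('a, 'b) ell2 \<Rightarrow> ('a, 'b) ell2" where
  "f - g = Abs_ell2 (\<lambda>i. coord f i - coord g i)"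
definition cinner_ell2 :: "('a, 'b) ell2 \<Rightarrow> ('a, 'b) ell2 \<Rightarrow> complex" where
  "cinner f g = (\<Sum>\<^sub>\<infinity>i. cinner (coord f i) (coord g i))"
definition inner_ell2 :: "('a, 'b) ell2 \<Rightarrow> ('a, 'b) ell2 \<Rightarrow> real" where
  "inner f g = (\<Sum>\<^sub>\<infinity>i. inner (coord f i) (coord g i))"
definition norm_ell2 :: "('a, 'b) ell2 \<Rightarrow> real" where
  "norm_ell2 f = sqrt (inner f f)"
definition sgn_ell2 :: "('a, 'b) ell2 \<Rightarrow> ('a, 'b) ell2" where
  "sgn_ell2 f = inverse (norm f) *\<^sub>R f"
definition dist_ell2 :: "('a, 'b) ell2 \<Rightarrow> ('a, 'b) ell2 \<Rightarrow> real" where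
  "dist_ell2 f g = norm (f - g)"
definition uniformity_ell2 :: "(('a, 'b) ell2 \<times> ('a, 'b) ell2) filter" where
  "uniformity_ell2 = (INF e\<in>{0 <..}. principal {(x, y). dist x y < e})"
definition open_ell2 :: "('a, 'b) ell2 set \<Rightarrow> bool" where
  "open_ell2 S = (\<forall>x\<in>S. \<forall>\<^sub>F (x', y) in uniformity. x' = x \<longrightarrow> y \<in> S)"

lemma coord_zero [simp]: "coord (0 :: ('a, 'b) ell2) i = 0"
  by (simp add: zero_ell2_def Abs_ell2_inverse)

lemma coord_plus [simp]: "coord (f + g :: ('a, 'b) ell2) i = coord f i + coord g i"
  by (simp add: plus_ell2_def Abs_ell2_inverse square_summable_add coord_summable)

lemma coord_scaleC [simp]: "coord (c *\<^sub>C f :: ('a, 'b) ell2) i = c *\<^sub>C coord f i"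
  by (simp add: scaleC_ell2_def Abs_ell2_inverse norm_scaleC power_mult_distrib
      summable_on_cmult_right coord_summable)

lemma coord_scaleR [simp]: "coord (r *\<^sub>R f :: ('a, 'b) ell2) i = r *\<^sub>R coord f i"
  by (simp add: scaleR_ell2_def Abs_ell2_inverse power_mult_distrib
      summable_on_cmult_right coord_summable)

lemma coord_uminus [simp]: "coord (- f :: ('a, 'b) ell2) i = - coord f i"
  by (simp add: uminus_ell2_def Abs_ell2_inverse coord_summable)

lemma coord_minus [simp]: "coord (f - g :: ('a, 'b) ell2) i = coord f i - coord g i"
proof -
  have "(\<lambda>i. (norm (coord f i + coord (- g) i))\<^sup>2) summable_on UNIV"
    by (intro square_summable_add coord_summable)
  then show ?thesis
    by (simp add: minus_ell2_def Abs_ell2_inverse)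
qed

instance
proof
  fix f g h :: "('a, 'b) ell2" and c d :: complex and r s :: real
  show "inner (f + g) h = inner f h + inner g h"
    by (simp add: inner_ell2_def inner_add_left infsum_add inner_summable coord_summable)
  show "cinner (f + g) h = cinner f h + cinner g h"
    by (simp add: cinner_ell2_def cinner_add_left infsum_add cinner_summable coord_summable)
  show "inner (r *\<^sub>R f) g = r * inner f g"
    by (simp add: inner_ell2_def infsum_cmult_right')
  show "cinner (c *\<^sub>C f) g = c * cinner f g"
    by (simp add: cinner_ell2_def cinner_scaleC_left infsum_cmult_right')
  show "inner f g = inner g f"
    by (simp add: inner_ell2_def inner_commute)
  show "cinner f g = cnj (cinner g f)"
    unfolding cinner_ell2_def infsum_cnj[symmetric] by (simp flip: cinner_commute)
  show "Re (cinner f g) = inner f g"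
    by (simp add: cinner_ell2_def inner_ell2_def infsum_Re[symmetric] cinner_summable
        coord_summable Re_cinner)
  show "0 \<le> inner f f"
    by (simp add: inner_ell2_def infsum_nonneg)
  show "inner f f = 0 \<longleftrightarrow> f = 0"
  proof
    assume *: "inner f f = 0"
    have "inner (coord f i) (coord f i) = 0" for i
      using nonneg_infsum_le_0D[of "\<lambda>i. inner (coord f i) (coord f i)" UNIV i] *
      by (simp add: inner_ell2_def inner_summable coord_summable)
    then show "f = 0" by (intro ell2_eqI) simp
  qed (simp add: inner_ell2_def)
qed (rule uniformity_ell2_def open_ell2_def norm_ell2_def sgn_ell2_def dist_ell2_def
      | (rule ell2_eqI, simp add: algebra_simps scaleC_add_right scaleC_add_left scaleC_scaleC
          scaleC_of_real))+

end

lemma norm_ell2_square: "(norm f)\<^sup>2 = (\<Sum>\<^sub>\<infinity>i. (norm (coord f i))\<^sup>2)"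
  for f :: "('i, 'b::chilbert_space) ell2"
  by (simp only: power2_norm_eq_inner inner_ell2_def)

lemma sum_coord_le: "finite F \<Longrightarrow> (\<Sum>i\<in>F. (norm (coord f i))\<^sup>2) \<le> (norm f)\<^sup>2"
  for f :: "('i, 'b::chilbert_space) ell2"
  unfolding norm_ell2_square by (rule finite_sum_le_infsum) (auto simp: coord_summable)

lemma norm_coord_le: "norm (coord f i) \<le> norm f" for f :: "('i, 'b::chilbert_space) ell2"
  using sum_coord_le[of "{i}" f] by (simp add: power2_le_iff_abs_le)

instance ell2 :: (type, chilbert_space) chilbert_space
proof
  fix X :: "nat \<Rightarrow> ('a, 'b) ell2"
  assume X: "Cauchy X"
  have "Cauchy (\<lambda>m. coord (X m) i)" for i
  proof (rule metric_CauchyI)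
    fix e :: real assume "e > 0"
    then obtain M where M: "\<forall>m\<ge>M. \<forall>n\<ge>M. dist (X m) (X n) < e"
      using X unfolding Cauchy_def by blast
    have "dist (coord (X m) i) (coord (X n) i) \<le> dist (X m) (X n)" for m n
      using norm_coord_le[of "X m - X n" i] by (simp add: dist_norm)
    with M show "\<exists>M. \<forall>m\<ge>M. \<forall>n\<ge>M. dist (coord (X m) i) (coord (X n) i) < e"
      by (meson le_less_trans)
  qed
  then have "\<exists>l. (\<lambda>m. coord (X m) i) \<longlonglongrightarrow> l" for i
    using Cauchy_convergent convergent_def by blast
  then obtain g where g: "\<And>i. (\<lambda>m. coord (X m) i) \<longlonglongrightarrow> g i" by metis
  have fin: "(\<Sum>i\<in>F. (norm (coord (X m) i - g i))\<^sup>2) \<le> e\<^sup>2"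
    if "e > 0" "\<forall>n\<ge>m. dist (X m) (X n) < e" "finite F" for m e F
  proof (rule tendsto_upperbound)
    show "(\<lambda>n. \<Sum>i\<in>F. (norm (coord (X m) i - coord (X n) i))\<^sup>2) \<longlonglongrightarrow>
        (\<Sum>i\<in>F. (norm (coord (X m) i - g i))\<^sup>2)"
      by (intro tendsto_intros g)
    have "(\<Sum>i\<in>F. (norm (coord (X m) i - coord (X n) i))\<^sup>2) \<le> e\<^sup>2" if "n \<ge> m" for n
    proof -
      have "(\<Sum>i\<in>F. (norm (coord (X m) i - coord (X n) i))\<^sup>2) \<le> (norm (X m - X n))\<^sup>2"
        using sum_coord_le[OF \<open>finite F\<close>, of "X m - X n"] by simp
      also have "\<dots> \<le> e\<^sup>2"
        using \<open>\<forall>n\<ge>m. dist (X m) (X n) < e\<close> that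
        by (intro power_mono) (auto simp: dist_norm less_imp_le)
      finally show ?thesis .
    qed
    then show "\<forall>\<^sub>F n in sequentially. (\<Sum>i\<in>F. (norm (coord (X m) i - coord (X n) i))\<^sup>2) \<le> e\<^sup>2"
      by (auto simp: eventually_sequentially)
  qed simp
  have summ: "(\<lambda>i. (norm (coord (X m) i - g i))\<^sup>2) summable_on UNIV"
    if "e > 0" "\<forall>n\<ge>m. dist (X m) (X n) < e" for m e
    using fin[OF that] by (intro nonneg_bdd_above_summable_on) (auto intro!: bdd_aboveI)
  obtain M1 where "\<forall>m\<ge>M1. \<forall>n\<ge>M1. dist (X m) (X n) < 1"
    using X unfolding Cauchy_def by (meson zero_less_one)
  then have s1: "(\<lambda>i. (norm (coord (X M1) i - g i))\<^sup>2) summable_on UNIV"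
    using summ[of 1 M1] by simp
  have "(\<lambda>i. (norm (coord (- X M1) i + (coord (X M1) i - g i)))\<^sup>2) summable_on UNIV"
    by (intro square_summable_add s1 coord_summable)
  then have gs: "(\<lambda>i. (norm (g i))\<^sup>2) summable_on UNIV" by simp
  define G where "G = Abs_ell2 g"
  have G: "coord G i = g i" for i
    by (simp add: G_def Abs_ell2_inverse gs)
  have "X \<longlonglongrightarrow> G"
  proof (rule metric_LIMSEQ_I)
    fix e :: real assume "e > 0"
    then obtain M where M: "\<forall>m\<ge>M. \<forall>n\<ge>M. dist (X m) (X n) < e / 2"
      using X unfolding Cauchy_def by (meson half_gt_zero)
    have "dist (X m) G < e" if "m \<ge> M" for m
    proof -
      have *: "\<forall>n\<ge>m. dist (X m) (X n) < e / 2" using M that by auto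
      have "(norm (X m - G))\<^sup>2 \<le> (e / 2)\<^sup>2"
        unfolding norm_ell2_square
        using fin[OF _ *] summ[OF _ *] \<open>e > 0\<close> by (intro infsum_le_finite_sums) (auto simp: G)
      then have "norm (X m - G) \<le> e / 2"
        using \<open>e > 0\<close> by (simp add: power2_le_iff_abs_le)
      then show ?thesis using \<open>e > 0\<close> by (simp add: dist_norm)
    qed
    then show "\<exists>M. \<forall>m\<ge>M. dist (X m) G < e" by blast
  qed
  then show "convergent X" by (auto simp: convergent_def)
qed

text \<open>The elementary tensor of the basis vector at \<open>i\<close> with \<open>h\<close>.\<close>

definition tensor :: "'i \<Rightarrow> 'b \<Rightarrow> ('i, 'b::chilbert_space) ell2" where
  "tensor i h = Abs_ell2 (\<lambda>j. if j = i then h else 0)"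

lemma coord_tensor [simp]: "coord (tensor i h) j = (if j = i then h else 0)"
proof -
  have "(\<lambda>j. (norm (if j = i then h else 0))\<^sup>2) summable_on {i}" by simp
  then have "(\<lambda>j. (norm (if j = i then h else 0))\<^sup>2) summable_on UNIV"
    by (rule summable_on_cong_neutral[THEN iffD1, rotated -1]) auto
  then show ?thesis by (simp add: tensor_def Abs_ell2_inverse)
qed


section \<open>Operators on a Hilbert space\<close>

text \<open>
  A Hilbert space is a closed complex subspace \<open>K\<close> of a type of class \<^class>\<open>chilbert_space\<close>
  (possibly all of it).  An operator on \<open>K\<close> is a function on the ambient type of which only the
  restriction to \<open>K\<close> matters.
\<close>

definition hilbert_space :: "'a::chilbert_space set \<Rightarrow> bool" where
  "hilbert_space K \<longleftrightarrow> closed K \<and> 0 \<in> K \<and> (\<forall>x\<in>K. \<forall>y\<in>K. x + y \<in> K) \<and> (\<forall>c. \<forall>x\<in>K. c *\<^sub>C x \<in> K)"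

definition clinear_on :: "'a::chilbert_space set \<Rightarrow> ('a \<Rightarrow> 'b::chilbert_space) \<Rightarrow> bool" where
  "clinear_on K T \<longleftrightarrow>
    (\<forall>x\<in>K. \<forall>y\<in>K. T (x + y) = T x + T y) \<and> (\<forall>c. \<forall>x\<in>K. T (c *\<^sub>C x) = c *\<^sub>C T x)"

definition bounded_op :: "'a::chilbert_space set \<Rightarrow> ('a \<Rightarrow> 'a) \<Rightarrow> bool" where
  "bounded_op K T \<longleftrightarrow>
    T ` K \<subseteq> K \<and> clinear_on K T \<and> (\<exists>b. \<forall>x\<in>K. norm (T x) \<le> b * norm x)"

definition adj :: "'a::chilbert_space set \<Rightarrow> ('a \<Rightarrow> 'a) \<Rightarrow> 'a \<Rightarrow> 'a" where
  "adj K T y = (THE z. z \<in> K \<and> (\<forall>x\<in>K. cinner (T x) y = cinner x z))"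

text \<open>
  The closure rule is closure in operator norm: norm convergence is uniform convergence on the
  unit ball.  As \<open>S\<close> is unconstrained outside \<open>K\<close>, the set consists of all functions whose
  restriction to \<open>K\<close> lies in the unital C*-algebra generated by \<open>G\<close>.
\<close>

inductive_set cstar :: "'a::chilbert_space set \<Rightarrow> ('a \<Rightarrow> 'a) set \<Rightarrow> ('a \<Rightarrow> 'a) set"
  for K :: "'a set" and G :: "('a \<Rightarrow> 'a) set" where
  cstar_unit: "(\<lambda>x. x) \<in> cstar K G"
| cstar_gen: "T \<in> G \<Longrightarrow> T \<in> cstar K G"
| cstar_add: "S \<in> cstar K G \<Longrightarrow> T \<in> cstar K G \<Longrightarrow> (\<lambda>x. S x + T x) \<in> cstar K G"
| cstar_scale: "T \<in> cstar K G \<Longrightarrow> (\<lambda>x. c *\<^sub>C T x) \<in> cstar K G"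
| cstar_comp: "S \<in> cstar K G \<Longrightarrow> T \<in> cstar K G \<Longrightarrow> (\<lambda>x. S (T x)) \<in> cstar K G"
| cstar_adj: "T \<in> cstar K G \<Longrightarrow> adj K T \<in> cstar K G"
| cstar_lim: "(\<And>m. T m \<in> cstar K G) \<Longrightarrow> bounded_op K S \<Longrightarrow>
    uniform_limit (K \<inter> cball 0 1) T S sequentially \<Longrightarrow> S \<in> cstar K G"

definition irreducible_on :: "'a::chilbert_space set \<Rightarrow> ('a \<Rightarrow> 'a) set \<Rightarrow> bool" where
  "irreducible_on K \<A> \<longleftrightarrow>
    (\<forall>M. hilbert_space M \<and> M \<subseteq> K \<and> (\<forall>T\<in>\<A>. T ` M \<subseteq> M) \<longrightarrow> M = {0} \<or> M = K)"

definition unitary_between ::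
  "'a::chilbert_space set \<Rightarrow> 'b::chilbert_space set \<Rightarrow> ('a \<Rightarrow> 'b) \<Rightarrow> bool" where
  "unitary_between K K' U \<longleftrightarrow>
    clinear_on K U \<and> U ` K = K' \<and> (\<forall>x\<in>K. \<forall>y\<in>K. cinner (U x) (U y) = cinner x y)"


section \<open>Tuples of row isometries\<close>

text \<open>
  A tuple indexed by \<open>I\<close> is a function \<open>V\<close> with \<open>V i s\<close>, for \<open>i \<in> I\<close> and \<open>s \<in> {1..n i}\<close>, the
  \<open>s\<close>-th entry of the \<open>i\<close>-th row; \<open>lam i j s t\<close> is the entry at \<open>(s, t)\<close> of the \<open>(i, j)\<close>-th matrix.
\<close>

definition row_isometry :: "'a::chilbert_space set \<Rightarrow> nat \<Rightarrow> (nat \<Rightarrow> 'a \<Rightarrow> 'a) \<Rightarrow> bool" where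
  "row_isometry K m R \<longleftrightarrow>
    (\<forall>s\<in>{1..m}. bounded_op K (R s)) \<and>
    (\<forall>s\<in>{1..m}. \<forall>t\<in>{1..m}. \<forall>x\<in>K. adj K (R s) (R t x) = (if s = t then x else 0))"

definition cuntz :: "'a::chilbert_space set \<Rightarrow> nat \<Rightarrow> (nat \<Rightarrow> 'a \<Rightarrow> 'a) \<Rightarrow> bool" where
  "cuntz K m R \<longleftrightarrow> row_isometry K m R \<and> (\<forall>x\<in>K. (\<Sum>s\<in>{1..m}. R s (adj K (R s) x)) = x)"

definition doubly_commuting ::
  "(nat \<Rightarrow> nat) \<Rightarrow> (nat \<Rightarrow> nat \<Rightarrow> nat \<Rightarrow> nat \<Rightarrow> complex) \<Rightarrow> nat set
    \<Rightarrow> 'a::chilbert_space set \<Rightarrow> (nat \<Rightarrow> nat \<Rightarrow> 'a \<Rightarrow> 'a) \<Rightarrow> bool" where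
  "doubly_commuting n lam I K V \<longleftrightarrow>
    (\<forall>i\<in>I. \<forall>j\<in>I. i \<noteq> j \<longrightarrow> (\<forall>s\<in>{1..n i}. \<forall>t\<in>{1..n j}. \<forall>x\<in>K.
      adj K (V i s) (V j t x) = cnj (lam i j s t) *\<^sub>C V j t (adj K (V i s) x)))"

definition tuple_ops :: "(nat \<Rightarrow> nat) \<Rightarrow> nat set \<Rightarrow> (nat \<Rightarrow> nat \<Rightarrow> 'a \<Rightarrow> 'a) \<Rightarrow> ('a \<Rightarrow> 'a) set" where
  "tuple_ops n I V = {V i s |i s. i \<in> I \<and> s \<in> {1..n i}}"

definition unitarily_equivalent ::
  "(nat \<Rightarrow> nat) \<Rightarrow> nat set
    \<Rightarrow> 'a::chilbert_space set \<Rightarrow> (nat \<Rightarrow> nat \<Rightarrow> 'a \<Rightarrow> 'a)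
    \<Rightarrow> 'b::chilbert_space set \<Rightarrow> (nat \<Rightarrow> nat \<Rightarrow> 'b \<Rightarrow> 'b) \<Rightarrow> bool" where
  "unitarily_equivalent n I K V K' V' \<longleftrightarrow>
    (\<exists>U. unitary_between K K' U \<and>
      (\<forall>i\<in>I. \<forall>s\<in>{1..n i}. \<forall>x\<in>K. U (V i s x) = V' i s (U x)))"

definition wandering_data ::
  "nat \<Rightarrow> (nat \<Rightarrow> nat) \<Rightarrow> (nat \<Rightarrow> nat \<Rightarrow> nat \<Rightarrow> nat \<Rightarrow> complex) \<Rightarrow> nat set
    \<Rightarrow> 'a::chilbert_space set \<Rightarrow> (nat \<Rightarrow> nat \<Rightarrow> 'a \<Rightarrow> 'a) \<Rightarrow> bool" where
  "wandering_data k n lam A L W \<longleftrightarrow>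
    hilbert_space L \<and> (\<forall>j\<in>{1..k} - A. cuntz L (n j) (W j)) \<and>
    doubly_commuting n lam ({1..k} - A) L W"


section \<open>The standard tuple\<close>

text \<open>
  A word in the generators of the \<open>i\<close>-th free semigroup is a list over \<open>{1..n i}\<close>.  For
  \<open>A = {}\<close> there is exactly one family of words, and \<open>standard_space\<close> is \<open>L\<close> up to the obvious
  identification.
\<close>

definition words :: "(nat \<Rightarrow> nat) \<Rightarrow> nat set \<Rightarrow> (nat \<Rightarrow> nat list) set" where
  "words n A = (\<Pi>\<^sub>E i\<in>A. lists {1..n i})"

definition standard_space ::
  "(nat \<Rightarrow> nat) \<Rightarrow> nat set \<Rightarrow> 'b::chilbert_space set \<Rightarrow> (nat \<Rightarrow> nat list, 'b) ell2 set" where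
  "standard_space n A L =
    {f. (\<forall>\<alpha>\<in>words n A. coord f \<alpha> \<in> L) \<and> (\<forall>\<alpha>. \<alpha> \<notin> words n A \<longrightarrow> coord f \<alpha> = 0)}"

lemma hilbert_space_standard_space:
  assumes "hilbert_space L"
  shows "hilbert_space (standard_space n A L)"
proof -
  have "bounded_linear (\<lambda>f. coord f \<alpha>)" for \<alpha> :: "nat \<Rightarrow> nat list"
    by (rule bounded_linear_intro[where K = 1]) (auto simp: norm_coord_le)
  then have cont: "continuous_on UNIV (\<lambda>f. coord f \<alpha>)" for \<alpha> :: "nat \<Rightarrow> nat list"
    by (rule linear_continuous_on)
  have "standard_space n A L = (\<Inter>\<alpha>\<in>words n A. (\<lambda>f. coord f \<alpha>) -` L) \<inter>
      (\<Inter>\<alpha>\<in>- words n A. (\<lambda>f. coord f \<alpha>) -` {0})"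
    by (auto simp: standard_space_def)
  moreover have "closed L" using assms by (simp add: hilbert_space_def)
  ultimately have "closed (standard_space n A L)"
    by (auto intro!: closed_Int closed_INT closed_vimage[OF _ cont])
  with assms show ?thesis
    by (auto simp: hilbert_space_def standard_space_def)
qed

definition word_phase ::
  "(nat \<Rightarrow> nat \<Rightarrow> nat \<Rightarrow> nat \<Rightarrow> complex) \<Rightarrow> nat \<Rightarrow> nat \<Rightarrow> nat \<Rightarrow> nat list \<Rightarrow> complex" where
  "word_phase lam i j s \<beta> = (\<Prod>t\<leftarrow>\<beta>. lam i j s t)"

text \<open>
  The sums are the linear continuous extension of the values prescribed on elementary tensors
  (see \<open>standard_tuple_tensor\<close> below).
\<close>

definition standard_tuple ::
  "(nat \<Rightarrow> nat) \<Rightarrow> (nat \<Rightarrow> nat \<Rightarrow> nat \<Rightarrow> nat \<Rightarrow> complex) \<Rightarrow> nat set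
    \<Rightarrow> (nat \<Rightarrow> nat \<Rightarrow> 'b \<Rightarrow> 'b) \<Rightarrow> nat \<Rightarrow> nat
    \<Rightarrow> (nat \<Rightarrow> nat list, 'b::chilbert_space) ell2 \<Rightarrow> (nat \<Rightarrow> nat list, 'b) ell2" where
  "standard_tuple n lam A W i s f =
    (if i \<in> A
     then \<Sum>\<^sub>\<infinity>\<alpha>\<in>words n A. (\<Prod>j\<in>{j\<in>A. j < i}. word_phase lam i j s (\<alpha> j)) *\<^sub>C
            tensor (\<alpha>(i := s # \<alpha> i)) (coord f \<alpha>)
     else \<Sum>\<^sub>\<infinity>\<alpha>\<in>words n A. (\<Prod>j\<in>A. word_phase lam i j s (\<alpha> j)) *\<^sub>C
            tensor \<alpha> (W i s (coord f \<alpha>)))"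

lemma tensor_zero [simp]: "tensor i 0 = 0"
  by (rule ell2_eqI) simp

lemma infsum_singleton_support:
  assumes "a \<in> A" "\<And>x. x \<in> A \<Longrightarrow> x \<noteq> a \<Longrightarrow> f x = 0"
  shows "infsum f A = f a"
proof -
  have "infsum f A = infsum f {a}"
    by (rule infsum_cong_neutral) (use assms in auto)
  then show ?thesis by simp
qed

lemma standard_tuple_tensor:
  assumes "\<alpha> \<in> words n A" and W: "i \<notin> A \<Longrightarrow> W i s 0 = 0"
  shows "standard_tuple n lam A W i s (tensor \<alpha> h) =
    (if i \<in> A
     then (\<Prod>j\<in>{j\<in>A. j < i}. word_phase lam i j s (\<alpha> j)) *\<^sub>C tensor (\<alpha>(i := s # \<alpha> i)) h
     else (\<Prod>j\<in>A. word_phase lam i j s (\<alpha> j)) *\<^sub>C tensor \<alpha> (W i s h))"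
  unfolding standard_tuple_def
  by (cases "i \<in> A") (simp_all add: infsum_singleton_support[OF assms(1)] W)

text \<open>
  \<open>V\<close> is a standard tuple whose wandering data \<open>(L, W)\<close> is irreducible.  The wandering space has
  its own ambient type.  Since \<open>L\<close> embeds isometrically into \<open>K\<close>, an existential quantifier over
  all Hilbert spaces \<open>L\<close> may be restricted to closed subspaces of the type of \<open>K\<close>.
\<close>

definition irreducible_model ::
  "nat \<Rightarrow> (nat \<Rightarrow> nat) \<Rightarrow> (nat \<Rightarrow> nat \<Rightarrow> nat \<Rightarrow> nat \<Rightarrow> complex)
    \<Rightarrow> 'a::chilbert_space set \<Rightarrow> (nat \<Rightarrow> nat \<Rightarrow> 'a \<Rightarrow> 'a)
    \<Rightarrow> nat set \<Rightarrow> 'b::chilbert_space set \<Rightarrow> (nat \<Rightarrow> nat \<Rightarrow> 'b \<Rightarrow> 'b) \<Rightarrow> bool" where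
  "irreducible_model k n lam K V A L W \<longleftrightarrow>
    A \<subseteq> {1..k} \<and> wandering_data k n lam A L W \<and>
    unitarily_equivalent n {1..k} K V (standard_space n A L) (standard_tuple n lam A W) \<and>
    irreducible_on L (cstar L (tuple_ops n ({1..k} - A) W))"

definition doubly_commuting_row_isometries ::
  "nat \<Rightarrow> (nat \<Rightarrow> nat) \<Rightarrow> (nat \<Rightarrow> nat \<Rightarrow> nat \<Rightarrow> nat \<Rightarrow> complex)
    \<Rightarrow> 'a::chilbert_space set \<Rightarrow> (nat \<Rightarrow> nat \<Rightarrow> 'a \<Rightarrow> 'a) \<Rightarrow> bool" where
  "doubly_commuting_row_isometries k n lam K V \<longleftrightarrow>
    hilbert_space K \<and> (\<forall>i\<in>{1..k}. row_isometry K (n i) (V i)) \<and>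
    doubly_commuting n lam {1..k} K V"

end

theory Submission
  imports Defs
begin

text \<open>
  The closed span, under the isometries \<open>V i s\<close> with \<open>i \<in> A\<close>, of a subspace annihilated by their
  adjoints and reducing for the other rows is reducing for the whole tuple.  If the tuple is
  irreducible, then for every \<open>i\<close> the subspace of vectors killed by all \<open>(V i s)*\<close> is zero, so
  that row \<open>i\<close> is Cuntz, or generates everything.  Let \<open>A\<close> be the set of rows of the second kind.
  The joint kernel \<open>L\<close> of the adjoints of these rows is nonzero and generates everything, and the
  vectors \<open>V\<^sub>\<alpha> l\<close> have the Gram matrix of the elementary tensors, which yields the unitary onto the
  standard tuple.  Conversely a unitary onto the standard tuple amounts to an isometric embedding
  of \<open>L\<close> onto the joint kernel; irreducibility and uniqueness are read off from this embedding
  because \<open>A\<close> and the joint kernel are determined by the tuple.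
\<close>

text \<open>The obstacle is that rows having nonzero kernels separately need not obviously have a
  nonzero kernel jointly. Rows are added one at a time: if \<open>wand B\<close> is nonzero but
  contains no nonzero vector of \<open>wand {i}\<close>, then row \<open>i\<close> is Cuntz on
  \<open>wand B\<close>, because the defect of each vector would be such a vector. Hence
  \<open>wand B\<close> is orthogonal to \<open>wand {i}\<close>; being invariant under the adjoints
  of row \<open>i\<close>, it is orthogonal to all translates of \<open>wand {i}\<close>, and these
  span \<open>K\<close>. This passage of adjoints to the other side,
  \<open>orbit_eq_imp_orthogonal\<close>, also identifies the range of an embedding, recovers
  \<open>A\<close> and shows the wandering data irreducible. Spans are kept as least closed
  invariant subspaces, so a closed linear property is checked on generators and for one operator at
  a time; explicit words serve only the Gram matrix and the model. Coordinates of the model are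
  needed only to pass between unitaries and \<open>wandering_embedding\<close>.\<close>

lemma cinner_zero_left [simp]: "cinner 0 (y::'a::complex_inner) = 0"
  using cinner_scaleC_left[of 0 0 y] by simp

lemma cinner_zero_right [simp]: "cinner (y::'a::complex_inner) 0 = 0"
  using cinner_commute[of y 0] by simp

lemma cinner_add_right: "cinner (x::'a::complex_inner) (y + z) = cinner x y + cinner x z"
  using cinner_commute[of x] by (metis cinner_add_left cinner_commute complex_cnj_add)

lemma cinner_scaleC_right: "cinner (x::'a::complex_inner) (c *\<^sub>C y) = cnj c * cinner x y"
  by (metis cinner_commute cinner_scaleC_left complex_cnj_mult)

lemma scaleC_minus_one: "(-1) *\<^sub>C (x::'a::complex_inner) = - x"
  using scaleC_of_real[of "-1" x] by simp

lemma scaleC_minus_right: "c *\<^sub>C (- x) = - (c *\<^sub>C (x::'a::complex_inner))"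
  using scaleC_scaleC[of c "-1" x] scaleC_scaleC[of "-1" c x] by (simp add: scaleC_minus_one)

lemma scaleC_diff_right: "c *\<^sub>C (x - y) = c *\<^sub>C x - c *\<^sub>C (y::'a::complex_inner)"
  using scaleC_add_right[of c x "- y"] by (simp add: scaleC_minus_right)

lemma cinner_minus_left [simp]: "cinner (- x) (y::'a::complex_inner) = - cinner x y"
  using cinner_scaleC_left[of "-1" x y] by (simp add: scaleC_minus_one)

lemma cinner_minus_right [simp]: "cinner x (- y::'a::complex_inner) = - cinner x y"
  using cinner_scaleC_right[of x "-1" y] by (simp add: scaleC_minus_one)

lemma cinner_diff_left: "cinner (x - y) (z::'a::complex_inner) = cinner x z - cinner y z"
  using cinner_add_left[of x "- y" z] by simp

lemma cinner_diff_right: "cinner z (x - y::'a::complex_inner) = cinner z x - cinner z y"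
  using cinner_add_right[of z x "- y"] by simp

lemma cinner_sum_left: "cinner (sum f F) (z::'a::complex_inner) = (\<Sum>a\<in>F. cinner (f a) z)"
  by (induction F rule: infinite_finite_induct) (simp_all add: cinner_add_left)

lemma cinner_sum_right: "cinner z (sum f F) = (\<Sum>a\<in>F. cinner z (f a :: 'a::complex_inner))"
  by (induction F rule: infinite_finite_induct) (simp_all add: cinner_add_right)

lemma cinner_self: "cinner x x = complex_of_real ((norm (x::'a::complex_inner))\<^sup>2)"
proof (rule complex_eqI)
  show "Re (cinner x x) = Re (complex_of_real ((norm x)\<^sup>2))"
    by (simp add: Re_cinner power2_norm_eq_inner)
  have "Im (cinner x x) = - Im (cinner x x)"
    by (metis cinner_commute complex_cnj cnj.simps(2))
  then show "Im (cinner x x) = Im (complex_of_real ((norm x)\<^sup>2))" by simp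
qed

lemma cinner_self_eq_0_iff: "cinner x x = 0 \<longleftrightarrow> (x::'a::complex_inner) = 0"
  by (simp add: cinner_self)

lemma cinner_eq_0_commute: "cinner x y = 0 \<longleftrightarrow> cinner y (x::'a::complex_inner) = 0"
  by (metis cinner_commute complex_cnj_zero_iff)

lemma bounded_linear_cinner_left: "bounded_linear (\<lambda>x. cinner x (y::'a::complex_inner))"
\<comment> \<open>The factor 2 is that of \<open>norm_cinner_le\<close>, which bounds real and
  imaginary parts separately.\<close>
proof (rule bounded_linear_intro[where K = "2 * norm y"])
  show "cinner (r *\<^sub>R x) y = r *\<^sub>R cinner x y" for r and x :: 'a
    using cinner_scaleC_left[of "complex_of_real r" x y]
    by (simp add: scaleC_of_real scaleR_conv_of_real)
  show "norm (cinner x y) \<le> norm x * (2 * norm y)" for x :: 'a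
    using norm_cinner_le[of x y] by (simp add: mult_ac)
qed (simp add: cinner_add_left)

lemma cmod_one_mult_cnj: "cmod c = 1 \<Longrightarrow> c * cnj c = 1"
  by (simp flip: complex_norm_square)

section \<open>Closed subspaces\<close>

lemma hilbert_space_closed: "hilbert_space M \<Longrightarrow> closed M"
  and hilbert_space_zero: "hilbert_space M \<Longrightarrow> 0 \<in> M"
  and hilbert_space_add: "hilbert_space M \<Longrightarrow> x \<in> M \<Longrightarrow> y \<in> M \<Longrightarrow> x + y \<in> M"
  and hilbert_space_scaleC: "hilbert_space M \<Longrightarrow> x \<in> M \<Longrightarrow> c *\<^sub>C x \<in> M"
  by (auto simp: hilbert_space_def)

lemma hilbert_space_scaleR: "hilbert_space M \<Longrightarrow> x \<in> M \<Longrightarrow> r *\<^sub>R x \<in> M"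
  by (metis hilbert_space_scaleC scaleC_of_real)

lemma hilbert_space_minus: "hilbert_space M \<Longrightarrow> x \<in> M \<Longrightarrow> - x \<in> M"
  by (metis hilbert_space_scaleC scaleC_minus_one)

lemma hilbert_space_diff: "hilbert_space M \<Longrightarrow> x \<in> M \<Longrightarrow> y \<in> M \<Longrightarrow> x - y \<in> M"
  by (metis hilbert_space_add hilbert_space_minus diff_conv_add_uminus)

lemma hilbert_space_sum: "hilbert_space M \<Longrightarrow> (\<And>a. a \<in> F \<Longrightarrow> f a \<in> M) \<Longrightarrow> sum f F \<in> M"
  by (induction F rule: infinite_finite_induct) (auto intro: hilbert_space_zero hilbert_space_add)

lemma hilbert_space_scaleC_iff:
  "hilbert_space M \<Longrightarrow> c \<noteq> 0 \<Longrightarrow> c *\<^sub>C x \<in> M \<longleftrightarrow> x \<in> M"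
  by (metis hilbert_space_scaleC left_inverse scaleC_one scaleC_scaleC)

lemma hilbert_space_Inter: "(\<And>M. M \<in> S \<Longrightarrow> hilbert_space M) \<Longrightarrow> hilbert_space (\<Inter>S)"
  by (auto simp: hilbert_space_def)

lemma hilbert_space_INT:
  "hilbert_space K \<Longrightarrow> (\<And>a. a \<in> I \<Longrightarrow> hilbert_space {x\<in>K. P a x}) \<Longrightarrow>
    hilbert_space {x\<in>K. \<forall>a\<in>I. P a x}"
proof -
  assume *: "hilbert_space K" "\<And>a. a \<in> I \<Longrightarrow> hilbert_space {x\<in>K. P a x}"
  \<comment> \<open>\<open>K\<close> is inserted so that the intersection is still \<open>K\<close>
    when \<open>I\<close> is empty.\<close>
  have "{x\<in>K. \<forall>a\<in>I. P a x} = \<Inter>(insert K ((\<lambda>a. {x\<in>K. P a x}) ` I))" by auto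
  also have "hilbert_space \<dots>" by (rule hilbert_space_Inter) (use * in auto)
  finally show ?thesis .
qed

lemma hilbert_space_trivial: "hilbert_space {0}"
  by (auto simp: hilbert_space_def)

text \<open>Unlike \<open>bounded_op\<close> this allows a different target type and puts no
  condition on the range, so it covers functionals, coordinates and embeddings as well.\<close>

definition bounded_clinear_on ::
  "'a::chilbert_space set \<Rightarrow> ('a \<Rightarrow> 'b::chilbert_space) \<Rightarrow> bool" where
  "bounded_clinear_on K T \<longleftrightarrow> clinear_on K T \<and> (\<exists>b. \<forall>x\<in>K. norm (T x) \<le> b * norm x)"

lemma bounded_op_iff: "bounded_op K T \<longleftrightarrow> T ` K \<subseteq> K \<and> bounded_clinear_on K T"
  by (auto simp: bounded_op_def bounded_clinear_on_def)

lemma bounded_op_mem: "bounded_op K T \<Longrightarrow> x \<in> K \<Longrightarrow> T x \<in> K"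
  by (auto simp: bounded_op_iff)

lemma bounded_op_bounded_clinear: "bounded_op K T \<Longrightarrow> bounded_clinear_on K T"
  by (auto simp: bounded_op_iff)

lemma clinear_on_add: "clinear_on K T \<Longrightarrow> x \<in> K \<Longrightarrow> y \<in> K \<Longrightarrow> T (x + y) = T x + T y"
  and clinear_on_scaleC: "clinear_on K T \<Longrightarrow> x \<in> K \<Longrightarrow> T (c *\<^sub>C x) = c *\<^sub>C T x"
  by (auto simp: clinear_on_def)

lemma clinear_on_zero: "clinear_on K T \<Longrightarrow> 0 \<in> K \<Longrightarrow> T 0 = 0"
  using clinear_on_scaleC[of K T 0 0] by simp

lemma clinear_on_diff:
  assumes "clinear_on K T" "hilbert_space K" "x \<in> K" "y \<in> K"
  shows "T (x - y) = T x - T y"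
proof -
  have "T (x + (-1) *\<^sub>C y) = T x + (-1) *\<^sub>C T y"
    using assms by (metis clinear_on_add clinear_on_scaleC hilbert_space_scaleC)
  then show ?thesis by (simp add: scaleC_minus_one)
qed

lemma clinear_on_sum:
  assumes "clinear_on K T" "hilbert_space K" "\<And>a. a \<in> F \<Longrightarrow> f a \<in> K"
  shows "T (sum f F) = (\<Sum>a\<in>F. T (f a))"
  using assms(3)
proof (induction F rule: infinite_finite_induct)
  case (insert a F)
  then show ?case
    using assms(1,2) by (simp add: clinear_on_add hilbert_space_sum)
qed (use assms in \<open>auto simp: clinear_on_zero hilbert_space_zero\<close>)

lemma bounded_clinear_onD: "bounded_clinear_on K T \<Longrightarrow> clinear_on K T"
  by (simp add: bounded_clinear_on_def)

text \<open>Linearity and the bound hold on \<open>K\<close> only, so continuity is stated for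
  sequences whose terms and limit lie in \<open>K\<close>.\<close>

lemma bounded_clinear_on_tendsto:
  assumes T: "bounded_clinear_on K T" and K: "hilbert_space K"
    and X: "\<And>m. X m \<in> K" "x \<in> K" "X \<longlonglongrightarrow> x"
  shows "(\<lambda>m. T (X m)) \<longlonglongrightarrow> T x"
proof -
  obtain b where b: "\<And>x. x \<in> K \<Longrightarrow> norm (T x) \<le> b * norm x"
    using T by (auto simp: bounded_clinear_on_def)
  have "(\<lambda>m. T (X m) - T x) \<longlonglongrightarrow> 0"
  proof (rule Lim_null_comparison)
    show "\<forall>\<^sub>F m in sequentially. norm (T (X m) - T x) \<le> b * norm (X m - x)"
      using b X T K
      by (auto intro!: always_eventually simp: hilbert_space_diff
          simp flip: clinear_on_diff[OF bounded_clinear_onD])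
    have "(\<lambda>m. norm (X m - x)) \<longlonglongrightarrow> 0"
      using X(3) by (simp add: tendsto_norm_zero LIM_zero)
    then show "(\<lambda>m. b * norm (X m - x)) \<longlonglongrightarrow> 0"
      by (rule tendsto_mult_right_zero)
  qed
  then show ?thesis by (simp add: LIM_zero_iff)
qed

text \<open>Source of nearly all closedness claims below: kernels, equalizers and the subspaces used
  in inductions over closed spans are preimages of this kind.\<close>

lemma hilbert_space_vimage:
  assumes T: "bounded_clinear_on K T" and K: "hilbert_space K" and M: "hilbert_space M"
  shows "hilbert_space {x\<in>K. T x \<in> M}"
  unfolding hilbert_space_def
proof (intro conjI)
  show "closed {x\<in>K. T x \<in> M}"
  proof (subst closed_sequential_limits, intro allI impI, elim conjE)
    fix X x assume X: "\<forall>m. X m \<in> {x\<in>K. T x \<in> M}" "X \<longlonglongrightarrow> x"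
    then have x: "x \<in> K"
      using closed_sequentially[OF hilbert_space_closed[OF K]] by blast
    have "(\<lambda>m. T (X m)) \<longlonglongrightarrow> T x"
      by (rule bounded_clinear_on_tendsto[OF T K]) (use X x in auto)
    then have "T x \<in> M"
      using closed_sequentially[OF hilbert_space_closed[OF M], of "\<lambda>m. T (X m)"] X by auto
    with x show "x \<in> {x\<in>K. T x \<in> M}" by simp
  qed
qed (use assms in \<open>auto simp: hilbert_space_zero hilbert_space_add hilbert_space_scaleC
    clinear_on_zero clinear_on_add clinear_on_scaleC dest: bounded_clinear_onD\<close>)

section \<open>Closure properties of bounded linear maps on a subspace, and the subspaces they
  define\<close>

lemma bounded_clinear_on_diff:
  assumes "bounded_clinear_on K S" "bounded_clinear_on K T"
  shows "bounded_clinear_on K (\<lambda>x. S x - T x)"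
proof -
  obtain a b where "\<And>x. x \<in> K \<Longrightarrow> norm (S x) \<le> a * norm x" "\<And>x. x \<in> K \<Longrightarrow> norm (T x) \<le> b * norm x"
    using assms by (auto simp: bounded_clinear_on_def)
  then have "norm (S x - T x) \<le> (a + b) * norm x" if "x \<in> K" for x
    using that norm_triangle_ineq4[of "S x" "T x"] by (smt (verit) distrib_right)
  moreover have "clinear_on K (\<lambda>x. S x - T x)"
    using assms by (auto simp: bounded_clinear_on_def clinear_on_def scaleC_diff_right)
  ultimately show ?thesis by (auto simp: bounded_clinear_on_def)
qed

lemma bounded_clinear_on_id: "bounded_clinear_on K (\<lambda>x. x)"
  by (auto simp: bounded_clinear_on_def clinear_on_def intro!: exI[of _ 1])

lemma bounded_clinear_on_scale:
  assumes "bounded_clinear_on K T"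
  shows "bounded_clinear_on K (\<lambda>x. c *\<^sub>C T x)"
proof -
  obtain b where "\<And>x. x \<in> K \<Longrightarrow> norm (T x) \<le> b * norm x"
    using assms by (auto simp: bounded_clinear_on_def)
  then have *: "norm (c *\<^sub>C T x) \<le> (cmod c * b) * norm x" if "x \<in> K" for x
    using that by (simp add: norm_scaleC mult.assoc mult_left_mono)
  have "clinear_on K (\<lambda>x. c *\<^sub>C T x)"
    using assms by (auto simp: bounded_clinear_on_def clinear_on_def scaleC_add_right scaleC_scaleC mult.commute)
  with * show ?thesis unfolding bounded_clinear_on_def by blast
qed

lemma bounded_clinear_on_add:
  assumes "bounded_clinear_on K S" "bounded_clinear_on K T"
  shows "bounded_clinear_on K (\<lambda>x. S x + T x)"
  using bounded_clinear_on_diff[OF assms(1) bounded_clinear_on_scale[OF assms(2), of "-1"]]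
  by (simp add: scaleC_minus_one)

lemma bounded_clinear_on_comp:
  assumes S: "bounded_clinear_on K' S" and T: "bounded_clinear_on K T" and TK: "T ` K \<subseteq> K'"
  shows "bounded_clinear_on K (\<lambda>x. S (T x))"
proof -
  obtain a b where ab: "\<And>x. x \<in> K' \<Longrightarrow> norm (S x) \<le> a * norm x"
      "\<And>x. x \<in> K \<Longrightarrow> norm (T x) \<le> b * norm x"
    using S T by (auto simp: bounded_clinear_on_def)
  \<comment> \<open>A bound \<open>a\<close> may be negative when \<open>K'\<close> is zero, so its
    absolute value is taken before multiplying inequalities.\<close>
  have "norm (S (T x)) \<le> (\<bar>a\<bar> * b) * norm x" if "x \<in> K" for x
  proof -
    have "norm (S (T x)) \<le> \<bar>a\<bar> * norm (T x)"
      using ab(1)[of "T x"] TK that by (smt (verit) imageI mult_right_mono norm_ge_zero subsetD)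
    also have "\<dots> \<le> \<bar>a\<bar> * (b * norm x)" by (intro mult_left_mono ab that) auto
    finally show ?thesis by (simp add: mult.assoc)
  qed
  then show ?thesis
    using S T TK by (auto simp: bounded_clinear_on_def clinear_on_def image_subset_iff)
qed

lemma bounded_clinear_on_subset: "bounded_clinear_on K T \<Longrightarrow> M \<subseteq> K \<Longrightarrow> bounded_clinear_on M T"
  unfolding bounded_clinear_on_def clinear_on_def subset_iff by blast

lemma bounded_linear_bounded_clinear_on:
  "bounded_linear T \<Longrightarrow> (\<And>c x. T (c *\<^sub>C x) = c *\<^sub>C T x) \<Longrightarrow> bounded_clinear_on K T"
  using bounded_linear.bounded[of T]
  by (auto simp: bounded_clinear_on_def clinear_on_def linear_add bounded_linear.linear mult.commute)

lemma bounded_clinear_on_cinner: "bounded_clinear_on K (\<lambda>x. cinner x y)"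
  by (rule bounded_linear_bounded_clinear_on)
    (simp_all add: bounded_linear_cinner_left cinner_scaleC_left scaleC_complex_def)

lemma bounded_clinear_on_coord: "bounded_clinear_on K (\<lambda>f. coord f \<alpha>)"
  by (auto simp: bounded_clinear_on_def clinear_on_def norm_coord_le intro!: exI[of _ 1])

lemma hilbert_space_kernel:
  "bounded_clinear_on K T \<Longrightarrow> hilbert_space K \<Longrightarrow> hilbert_space {x\<in>K. T x = 0}"
  by (drule (1) hilbert_space_vimage[OF _ _ hilbert_space_trivial]) simp

lemma hilbert_space_equalizer:
  "bounded_clinear_on K S \<Longrightarrow> bounded_clinear_on K T \<Longrightarrow> hilbert_space K \<Longrightarrow>
    hilbert_space {x\<in>K. S x = T x}"
  using hilbert_space_kernel[OF bounded_clinear_on_diff, of K S T] by simp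

text \<open>The varying vector stands in the linear slot, so each condition is the kernel of a
  bounded linear functional. The set \<open>S\<close> need not be a subspace.\<close>

definition ocompl :: "'a::chilbert_space set \<Rightarrow> 'a set \<Rightarrow> 'a set" where
  "ocompl K S = {x\<in>K. \<forall>y\<in>S. cinner x y = 0}"

lemma hilbert_space_ocompl: "hilbert_space K \<Longrightarrow> hilbert_space (ocompl K S)"
  unfolding ocompl_def
  by (intro hilbert_space_INT hilbert_space_kernel bounded_clinear_on_cinner)

lemma cinner_ocompl_sym: "x \<in> ocompl K S \<Longrightarrow> y \<in> S \<Longrightarrow> cinner y x = 0"
  using cinner_eq_0_commute[of x y] by (auto simp: ocompl_def)

lemma cinner_eqI:
  assumes "hilbert_space K" "x \<in> K" "y \<in> K" "\<And>z. z \<in> K \<Longrightarrow> cinner z x = cinner z y"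
  shows "x = y"
  using assms(4)[of "x - y"] assms(1-3)
  by (metis cinner_diff_right cinner_self_eq_0_iff eq_iff_diff_eq_0 hilbert_space_diff)

section \<open>Orthogonal projections, the Riesz representation and adjoints\<close>

text \<open>A minimizing sequence for the distance from \<open>x\<close> to \<open>M\<close> is
  Cauchy by the parallelogram law, and its limit is the projection: any correlation of
  \<open>x - p\<close> with a vector of \<open>M\<close> would allow a shorter distance.\<close>

lemma projection_exists:
  fixes M :: "'a::chilbert_space set"
  assumes M: "hilbert_space M"
  shows "\<exists>p\<in>M. \<forall>y\<in>M. cinner (x - p) y = 0"
proof -
  define d where "d = infdist x M"
  have Mne: "M \<noteq> {}" using hilbert_space_zero[OF M] by auto
  have d_le: "d \<le> dist x y" if "y \<in> M" for y unfolding d_def by (rule infdist_le[OF that])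
  have "\<exists>y\<in>M. dist x y < d + 1 / real (Suc m)" for m
  proof -
    have "(INF y\<in>M. dist x y) < d + 1 / real (Suc m)"
      using Mne by (simp add: d_def infdist_notempty)
    then show ?thesis using Mne by (subst (asm) cINF_less_iff) auto
  qed
  then obtain Y where Y: "\<And>m. Y m \<in> M" "\<And>m. dist x (Y m) < d + 1 / real (Suc m)" by metis
  have d0: "0 \<le> d" unfolding d_def by (rule infdist_nonneg)
  have lim: "(\<lambda>m. dist x (Y m)) \<longlonglongrightarrow> d"
  proof (rule tendsto_sandwich)
    show "\<forall>\<^sub>F m in sequentially. d \<le> dist x (Y m)" using d_le Y by simp
    show "\<forall>\<^sub>F m in sequentially. dist x (Y m) \<le> d + 1 / real (Suc m)"
      using Y by (simp add: less_imp_le)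
    have "(\<lambda>m. 1 / real (Suc m)) \<longlonglongrightarrow> 0"
      using LIMSEQ_inverse_real_of_nat by (simp add: inverse_eq_divide)
    from tendsto_add[OF tendsto_const[of d] this] show "(\<lambda>m. d + 1 / real (Suc m)) \<longlonglongrightarrow> d" by simp
  qed simp
  have par: "(norm (Y i - Y j))\<^sup>2 \<le> 2 * ((dist x (Y i))\<^sup>2 - d\<^sup>2) + 2 * ((dist x (Y j))\<^sup>2 - d\<^sup>2)" for i j
  proof -
    \<comment> \<open>The midpoint lies in \<open>M\<close>, so its distance to \<open>x\<close> is
      at least \<open>d\<close>; this bounds the sum term of the parallelogram law from
      below.\<close>
    have "(1/2) *\<^sub>R (Y i + Y j) \<in> M"
      by (intro hilbert_space_scaleR[OF M] hilbert_space_add[OF M] Y)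
    then have "d \<le> norm (x - (1/2) *\<^sub>R (Y i + Y j))" using d_le by (simp add: dist_norm)
    then have "4 * d\<^sup>2 \<le> 4 * (norm (x - (1/2) *\<^sub>R (Y i + Y j)))\<^sup>2"
      using d0 by (simp add: power_mono)
    also have "\<dots> = (norm ((x - Y i) + (x - Y j)))\<^sup>2"
    proof -
      have "(x - Y i) + (x - Y j) = 2 *\<^sub>R (x - (1/2) *\<^sub>R (Y i + Y j))"
        by (simp add: algebra_simps flip: scaleR_2)
      then show ?thesis by (simp add: power_mult_distrib)
    qed
    finally have "4 * d\<^sup>2 \<le> (norm ((x - Y i) + (x - Y j)))\<^sup>2" .
    moreover have "(norm ((x - Y i) + (x - Y j)))\<^sup>2 + (norm ((x - Y i) - (x - Y j)))\<^sup>2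
        = 2 * (norm (x - Y i))\<^sup>2 + 2 * (norm (x - Y j))\<^sup>2"
      unfolding power2_norm_eq_inner by (simp add: inner_simps inner_commute)
    moreover have "norm ((x - Y i) - (x - Y j)) = norm (Y i - Y j)"
      by (simp add: norm_minus_commute)
    ultimately show ?thesis by (simp add: dist_norm)
  qed
  have "Cauchy Y"
  proof (rule metric_CauchyI)
    fix e :: real assume e: "e > 0"
    have "(\<lambda>m. (dist x (Y m))\<^sup>2 - d\<^sup>2) \<longlonglongrightarrow> d\<^sup>2 - d\<^sup>2" by (intro tendsto_intros lim)
    then have "\<forall>\<^sub>F m in sequentially. (dist x (Y m))\<^sup>2 - d\<^sup>2 < e\<^sup>2 / 4"
      by (rule order_tendstoD(2)) (use e in auto)
    then obtain N where N: "\<And>m. m \<ge> N \<Longrightarrow> (dist x (Y m))\<^sup>2 - d\<^sup>2 < e\<^sup>2 / 4"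
      by (auto simp: eventually_sequentially)
    have "dist (Y i) (Y j) < e" if "i \<ge> N" "j \<ge> N" for i j
    proof -
      have "(norm (Y i - Y j))\<^sup>2 < e\<^sup>2" using par[of i j] N[OF that(1)] N[OF that(2)] by simp
      then show ?thesis using e by (simp add: dist_norm power2_less_imp_less)
    qed
    then show "\<exists>N. \<forall>i\<ge>N. \<forall>j\<ge>N. dist (Y i) (Y j) < e" by blast
  qed
  then obtain p where p: "Y \<longlonglongrightarrow> p" using Cauchy_convergent convergent_def by blast
  then have pM: "p \<in> M"
    using closed_sequentially[OF hilbert_space_closed[OF M]] Y by blast
  have "(\<lambda>m. dist x (Y m)) \<longlonglongrightarrow> dist x p" by (intro tendsto_intros p)
  with lim have dp: "dist x p = d" using LIMSEQ_unique by blast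
  have re0: "inner (x - p) y = 0" if y: "y \<in> M" for y
  proof (cases "y = 0")
    case False
    \<comment> \<open>The minimizer of the quadratic polynomial giving the squared norm of
      \<open>x - p - t *\<^sub>R y\<close>.\<close>
    define t where "t = inner (x - p) y / inner y y"
    have yy: "inner y y > 0" using False by simp
    have "p + t *\<^sub>R y \<in> M" by (intro hilbert_space_add hilbert_space_scaleR M pM y)
    then have "d \<le> norm (x - p - t *\<^sub>R y)" using d_le by (metis dist_norm diff_diff_add)
    then have "(norm (x - p))\<^sup>2 \<le> (norm (x - p - t *\<^sub>R y))\<^sup>2"
      using d0 dp by (simp add: power_mono dist_norm)
    also have "\<dots> = (norm (x - p))\<^sup>2 - 2 * t * inner (x - p) y + t * (t * inner y y)"
      unfolding power2_norm_eq_inner by (simp add: inner_simps inner_commute algebra_simps)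
    also have "t * inner y y = inner (x - p) y" using yy by (simp add: t_def)
    finally have "t * inner (x - p) y \<le> 0" by simp
    then have "(inner (x - p) y)\<^sup>2 \<le> 0"
      using yy by (simp add: t_def power2_eq_square divide_le_0_iff)
    then show ?thesis by simp
  qed simp
  have "cinner (x - p) y = 0" if "y \<in> M" for y
  proof (rule complex_eqI)
    show "Re (cinner (x - p) y) = Re 0" using re0[OF that] by (simp add: Re_cinner)
    \<comment> \<open>Multiplying \<open>y\<close> by the imaginary unit turns the missing imaginary
      part into a real part.\<close>
    have "Re (cinner (x - p) (\<i> *\<^sub>C y)) = 0"
      using re0[OF hilbert_space_scaleC[OF M that]] by (simp add: Re_cinner)
    then show "Im (cinner (x - p) y) = Im 0" by (simp add: cinner_scaleC_right)
  qed
  with pM show ?thesis by blast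
qed

lemma ocompl_decompose:
  assumes "hilbert_space K" "hilbert_space M" "M \<subseteq> K" "x \<in> K"
  obtains p q where "p \<in> M" "q \<in> ocompl K M" "x = p + q"
proof -
  obtain p where "p \<in> M" "\<forall>y\<in>M. cinner (x - p) y = 0"
    using projection_exists[OF assms(2)] by blast
  then have "x - p \<in> ocompl K M" using assms by (auto simp: ocompl_def hilbert_space_diff)
  with \<open>p \<in> M\<close> show ?thesis using that[of p "x - p"] by simp
qed

text \<open>In the decomposition \<open>x = p + q\<close> the hypothesis applied to \<open>q\<close>
  itself gives \<open>cinner q q = 0\<close>. This is the double complement theorem for closed
  subspaces.\<close>

lemma ocompl_ocompl_mem:
  assumes "hilbert_space K" "hilbert_space M" "M \<subseteq> K" "x \<in> K"
    and "\<And>q. q \<in> ocompl K M \<Longrightarrow> cinner x q = 0"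
  shows "x \<in> M"
proof -
  obtain p q where *: "p \<in> M" "q \<in> ocompl K M" "x = p + q"
    using ocompl_decompose assms(1-4) by blast
  have "cinner p q = 0" using * cinner_ocompl_sym by blast
  then have "cinner q q = 0" using * assms(5)[of q] by (simp add: cinner_add_left)
  then show ?thesis using * by (simp add: cinner_self_eq_0_iff)
qed

lemma subspace_eqI:
  assumes "hilbert_space K" "hilbert_space M" "M \<subseteq> K" "ocompl K M \<subseteq> {0}"
  shows "M = K"
  using assms(3,4) by (auto intro!: ocompl_ocompl_mem[OF assms(1-3)])

lemma riesz_representation:
  fixes \<phi> :: "'a::chilbert_space \<Rightarrow> complex"
  assumes K: "hilbert_space K" and \<phi>: "bounded_clinear_on K \<phi>"
  shows "\<exists>z\<in>K. \<forall>x\<in>K. \<phi> x = cinner x z"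
proof (cases "\<forall>x\<in>K. \<phi> x = 0")
  case True
  then show ?thesis using hilbert_space_zero[OF K] by (intro bexI[of _ 0]) auto
next
  case False
  define M where "M = {x\<in>K. \<phi> x = 0}"
  have M: "hilbert_space M" "M \<subseteq> K"
    using hilbert_space_kernel[OF \<phi> K] by (auto simp: M_def)
  have "M \<noteq> K" using False by (auto simp: M_def)
  then obtain w where w: "w \<in> ocompl K M" "w \<noteq> 0" using subspace_eqI[OF K M] by auto
  then have wK: "w \<in> K" by (simp add: ocompl_def)
  have lin: "clinear_on K \<phi>" using \<phi> by (rule bounded_clinear_onD)
  \<comment> \<open>The scalar is fixed by the requirement \<open>cinner w z = \<phi> w\<close>; it
    is conjugated because the second slot is conjugate linear.\<close>
  define z where "z = (cnj (\<phi> w) / complex_of_real ((norm w)\<^sup>2)) *\<^sub>C w"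
  have "\<phi> x = cinner x z" if x: "x \<in> K" for x
  proof -
    \<comment> \<open>This combination lies in the kernel, hence is orthogonal to \<open>w\<close>;
      solving for \<open>\<phi> x\<close> gives the representation.\<close>
    have "\<phi> (\<phi> w *\<^sub>C x - \<phi> x *\<^sub>C w) = 0"
      using clinear_on_diff[OF lin K hilbert_space_scaleC[OF K x] hilbert_space_scaleC[OF K wK]]
      by (simp add: clinear_on_scaleC[OF lin] x wK scaleC_complex_def)
    then have "\<phi> w *\<^sub>C x - \<phi> x *\<^sub>C w \<in> M"
      using x wK K by (auto simp: M_def intro!: hilbert_space_diff hilbert_space_scaleC)
    then have "cinner (\<phi> w *\<^sub>C x - \<phi> x *\<^sub>C w) w = 0" using w cinner_ocompl_sym by blast
    then have "\<phi> w * cinner x w = \<phi> x * complex_of_real ((norm w)\<^sup>2)"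
      by (simp add: cinner_diff_left cinner_scaleC_left cinner_self)
    then show ?thesis using w(2)
      by (simp add: z_def cinner_scaleC_right field_simps)
  qed
  moreover have "z \<in> K" unfolding z_def by (intro hilbert_space_scaleC K wK)
  ultimately show ?thesis by blast
qed

text \<open>Justifies the definite description in \<open>adj\<close>. The vector \<open>y\<close> is
  unrestricted, so adjoints take values in \<open>K\<close> at every argument.\<close>

lemma adj_ex1:
  assumes K: "hilbert_space K" and T: "bounded_op K T"
  shows "\<exists>!z. z \<in> K \<and> (\<forall>x\<in>K. cinner (T x) y = cinner x z)"
proof -
  have "bounded_clinear_on K (\<lambda>x. cinner (T x) y)"
    using bounded_clinear_on_comp[OF bounded_clinear_on_cinner[of UNIV y] bounded_op_bounded_clinear[OF T]]
    by simp
  from riesz_representation[OF K this] show ?thesis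
    by (metis K cinner_eqI)
qed

lemma adj_mem: "hilbert_space K \<Longrightarrow> bounded_op K T \<Longrightarrow> adj K T y \<in> K"
  and cinner_adj_right: "hilbert_space K \<Longrightarrow> bounded_op K T \<Longrightarrow> x \<in> K \<Longrightarrow>
    cinner x (adj K T y) = cinner (T x) y"
  unfolding adj_def using theI'[OF adj_ex1, of K T y] by auto

lemma cinner_adj_left:
  "hilbert_space K \<Longrightarrow> bounded_op K T \<Longrightarrow> x \<in> K \<Longrightarrow> cinner (adj K T y) x = cinner y (T x)"
  by (metis cinner_adj_right cinner_commute)

lemma adj_eqI:
  "hilbert_space K \<Longrightarrow> bounded_op K T \<Longrightarrow> z \<in> K \<Longrightarrow> (\<And>x. x \<in> K \<Longrightarrow> cinner (T x) y = cinner x z) \<Longrightarrow>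
    adj K T y = z"
  by (metis adj_mem cinner_adj_right cinner_eqI)

lemma bounded_op_adj:
  assumes K: "hilbert_space K" and T: "bounded_op K T"
  shows "bounded_op K (adj K T)"
proof -
  obtain b where b: "\<And>x. x \<in> K \<Longrightarrow> norm (T x) \<le> b * norm x"
    using T by (auto simp: bounded_op_def)
  have "norm (adj K T y) \<le> \<bar>b\<bar> * norm y" if "y \<in> K" for y
  proof (cases "adj K T y = 0")
    case False
    have z: "adj K T y \<in> K" by (rule adj_mem[OF K T])
    \<comment> \<open>The squared norm of the adjoint vector is an inner product against
      \<open>y\<close> after moving \<open>T\<close> across; Cauchy-Schwarz then allows one factor
      to be cancelled.\<close>
    have "(norm (adj K T y))\<^sup>2 = Re (cinner (T (adj K T y)) y)"
      by (simp add: cinner_adj_right[OF K T z, symmetric] cinner_self)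
    also have "\<dots> \<le> norm (T (adj K T y)) * norm y"
      by (simp add: Re_cinner norm_cauchy_schwarz)
    also have "\<dots> \<le> (\<bar>b\<bar> * norm (adj K T y)) * norm y"
      using b[OF z] by (smt (verit) mult_right_mono norm_ge_zero)
    finally have "norm (adj K T y) * norm (adj K T y) \<le> norm (adj K T y) * (\<bar>b\<bar> * norm y)"
      by (simp add: power2_eq_square mult_ac)
    then show ?thesis using False by simp
  qed simp
  moreover have "clinear_on K (adj K T)"
    unfolding clinear_on_def using K T
    by (auto intro!: adj_eqI[OF K T] hilbert_space_add hilbert_space_scaleC
        simp: adj_mem cinner_add_right cinner_scaleC_right cinner_adj_right)
  ultimately show ?thesis
    using adj_mem[OF K T] unfolding bounded_op_def by blast
qed

lemma bounded_op_subset: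
  "bounded_op K T \<Longrightarrow> M \<subseteq> K \<Longrightarrow> T ` M \<subseteq> M \<Longrightarrow> bounded_op M T"
  by (auto simp: bounded_op_iff bounded_clinear_on_subset)

text \<open>\<open>adj\<close> depends on the carrier. On a subspace invariant under both operators
  the two readings agree, which lets wandering data on \<open>wand A\<close> be computed with
  adjoints taken in \<open>K\<close>.\<close>

lemma adj_subset:
  assumes "hilbert_space K" "bounded_op K T" "hilbert_space M" "M \<subseteq> K" "T ` M \<subseteq> M"
    "adj K T ` M \<subseteq> M" "x \<in> M"
  shows "adj M T x = adj K T x"
proof (rule adj_eqI[OF assms(3) bounded_op_subset[OF assms(2,4,5)]])
  show "adj K T x \<in> M" using assms(6,7) by blast
  show "cinner (T y) x = cinner y (adj K T x)" if "y \<in> M" for y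
    using cinner_adj_right[OF assms(1,2)] assms(4) that by (simp add: subset_iff)
qed

section \<open>Irreducibility and reducing subspaces\<close>

text \<open>Tests generators only, whereas \<open>irreducible_on\<close> quantifies over the whole
  algebra; \<open>irreducible_on_cstar_iff\<close> reconciles the two.\<close>

definition reducing :: "'a::chilbert_space set \<Rightarrow> ('a \<Rightarrow> 'a) set \<Rightarrow> 'a set \<Rightarrow> bool" where
  "reducing K G M \<longleftrightarrow> hilbert_space M \<and> M \<subseteq> K \<and> (\<forall>T\<in>G. T ` M \<subseteq> M \<and> adj K T ` M \<subseteq> M)"

lemma ocompl_invariant:
  assumes "hilbert_space K" "bounded_op K T" "M \<subseteq> K" "adj K T ` M \<subseteq> M"
  shows "T ` ocompl K M \<subseteq> ocompl K M"
  using assms by (auto simp: ocompl_def bounded_op_mem simp flip: cinner_adj_right)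

text \<open>By duality an image under the adjoint is orthogonal to the complement of
  \<open>M\<close>, and the double complement of \<open>M\<close> is \<open>M\<close>. This is the
  adjoint case in the induction over \<open>cstar\<close>.\<close>

lemma adj_invariant:
  assumes K: "hilbert_space K" and M: "hilbert_space M" "M \<subseteq> K"
    and T: "bounded_op K T" "T ` ocompl K M \<subseteq> ocompl K M"
  shows "adj K T ` M \<subseteq> M"
proof clarify
  fix x assume x: "x \<in> M"
  show "adj K T x \<in> M"
  proof (rule ocompl_ocompl_mem[OF K M adj_mem[OF K T(1)]])
    fix q assume q: "q \<in> ocompl K M"
    then have "q \<in> K" "T q \<in> ocompl K M" using T by (auto simp: ocompl_def)
    then show "cinner (adj K T x) q = 0"
      using x by (simp add: cinner_adj_left[OF K T(1)] cinner_ocompl_sym)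
  qed
qed

lemma ocompl_adj_invariant:
  assumes "hilbert_space K" "bounded_op K T" "M \<subseteq> K" "T ` M \<subseteq> M"
  shows "adj K T ` ocompl K M \<subseteq> ocompl K M"
  using assms by (auto simp: ocompl_def adj_mem cinner_adj_left subset_iff)

lemma reducing_ocompl:
  assumes "hilbert_space K" "\<And>T. T \<in> G \<Longrightarrow> bounded_op K T" "reducing K G M"
  shows "reducing K G (ocompl K M)"
  using assms ocompl_invariant[of K _ M] ocompl_adj_invariant[of K _ M]
  by (simp add: reducing_def hilbert_space_ocompl) (auto simp: ocompl_def)

lemma uniform_limit_invariant:
  assumes K: "hilbert_space K" and N: "hilbert_space N" "N \<subseteq> K"
    and T: "\<And>m. bounded_op K (T m)" "\<And>m. T m ` N \<subseteq> N" and S: "bounded_op K S"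
    and lim: "uniform_limit (K \<inter> cball 0 1) T S sequentially"
  shows "S ` N \<subseteq> N"
proof clarify
  fix x assume x: "x \<in> N"
  \<comment> \<open>Convergence is given on the unit ball only, so \<open>x\<close> is scaled into
    it; adding 1 keeps the divisor positive at \<open>x = 0\<close>.\<close>
  define c where "c = complex_of_real (inverse (norm x + 1))"
  have pos: "norm x + 1 > 0" using norm_ge_zero[of x] by linarith
  then have c: "c \<noteq> 0" unfolding c_def by (metis inverse_nonzero_iff_nonzero less_irrefl of_real_eq_0_iff)
  have cN: "c *\<^sub>C x \<in> N" using x by (rule hilbert_space_scaleC[OF N(1)])
  have "cmod c = inverse (norm x + 1)" using pos by (simp add: c_def del: of_real_inverse of_real_add)
  then have "norm (c *\<^sub>C x) = norm x / (norm x + 1)" by (simp add: norm_scaleC divide_inverse mult.commute)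
  also have "\<dots> \<le> 1" using pos by simp
  finally have "norm (c *\<^sub>C x) \<le> 1" .
  then have "(\<lambda>m. T m (c *\<^sub>C x)) \<longlonglongrightarrow> S (c *\<^sub>C x)"
    using N cN by (intro tendsto_uniform_limitI[OF lim]) auto
  then have "S (c *\<^sub>C x) \<in> N"
    using closed_sequentially[OF hilbert_space_closed[OF N(1)], of "\<lambda>m. T m (c *\<^sub>C x)"] T(2) cN by blast
  moreover have "S (c *\<^sub>C x) = c *\<^sub>C S x"
    using S x N(2) by (auto simp: bounded_op_def clinear_on_def)
  ultimately show "S x \<in> N" using hilbert_space_scaleC_iff[OF N(1) c] by simp
qed

text \<open>Invariance of \<open>M\<close> alone is not stable under adjoints, so it is propagated together with
  invariance of the complement.\<close>

lemma cstar_reducing: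
  assumes K: "hilbert_space K" and G: "\<And>T. T \<in> G \<Longrightarrow> bounded_op K T"
    and M: "reducing K G M" and T: "T \<in> cstar K G"
  shows "bounded_op K T \<and> T ` M \<subseteq> M \<and> T ` ocompl K M \<subseteq> ocompl K M"
proof -
  have hM: "hilbert_space M" "M \<subseteq> K" using M by (auto simp: reducing_def)
  have hC: "hilbert_space (ocompl K M)" "ocompl K M \<subseteq> K"
    using hilbert_space_ocompl[OF K] by (auto simp: ocompl_def)
  from T show ?thesis
  proof induction
    case cstar_unit
    then show ?case by (auto simp: bounded_op_iff bounded_clinear_on_id)
  next
    case (cstar_gen T)
    then show ?case using G M K by (auto simp: reducing_def ocompl_invariant)
  next
    case (cstar_add S T)
    then show ?case
      by (auto simp: bounded_op_iff bounded_clinear_on_add image_subset_iff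
          intro!: hilbert_space_add K hM hC)
  next
    case (cstar_scale T c)
    then show ?case
      by (auto simp: bounded_op_iff bounded_clinear_on_scale image_subset_iff
          intro!: hilbert_space_scaleC K hM hC)
  next
    case (cstar_comp S T)
    then have "bounded_clinear_on K (\<lambda>x. S (T x))"
      by (intro bounded_clinear_on_comp[of K S K T]) (auto simp: bounded_op_iff)
    with cstar_comp show ?case by (simp add: bounded_op_iff image_subset_iff)
  next
    case (cstar_adj T)
    then show ?case
      using K hM by (simp add: bounded_op_adj adj_invariant ocompl_adj_invariant)
  next
    case (cstar_lim T S)
    then show ?case
      using uniform_limit_invariant[OF K hM _ _ cstar_lim(2,3)] uniform_limit_invariant[OF K hC _ _ cstar_lim(2,3)]
      by simp
  qed
qed

text \<open>A subspace invariant under the algebra reduces the generators because the algebra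
  contains their adjoints; the converse is \<open>cstar_reducing\<close>. From here on only reducing
  subspaces are used.\<close>

lemma irreducible_on_cstar_iff:
  assumes "hilbert_space K" "\<And>T. T \<in> G \<Longrightarrow> bounded_op K T"
  shows "irreducible_on K (cstar K G) \<longleftrightarrow> (\<forall>M. reducing K G M \<longrightarrow> M = {0} \<or> M = K)"
proof -
  have "reducing K G M \<longleftrightarrow> hilbert_space M \<and> M \<subseteq> K \<and> (\<forall>T\<in>cstar K G. T ` M \<subseteq> M)" for M
  proof
    assume M: "reducing K G M"
    then have "hilbert_space M" "M \<subseteq> K" by (simp_all add: reducing_def)
    with cstar_reducing[OF assms M]
    show "hilbert_space M \<and> M \<subseteq> K \<and> (\<forall>T\<in>cstar K G. T ` M \<subseteq> M)" by blast
  next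
    assume "hilbert_space M \<and> M \<subseteq> K \<and> (\<forall>T\<in>cstar K G. T ` M \<subseteq> M)"
    then show "reducing K G M"
      unfolding reducing_def using cstar_gen[of _ G K] cstar_adj[OF cstar_gen, of _ G K] by blast
  qed
  then show ?thesis by (simp only: irreducible_on_def)
qed

declare One_nat_def [simp del]

section \<open>Isometries\<close>

definition isometry_on :: "'a::chilbert_space set \<Rightarrow> ('a \<Rightarrow> 'b::chilbert_space) \<Rightarrow> bool" where
  "isometry_on L e \<longleftrightarrow> clinear_on L e \<and> (\<forall>x\<in>L. \<forall>y\<in>L. cinner (e x) (e y) = cinner x y)"

lemma unitary_between_iff: "unitary_between K K' U \<longleftrightarrow> isometry_on K U \<and> U ` K = K'"
  by (auto simp: unitary_between_def isometry_on_def)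

lemma isometry_on_cinner: "isometry_on L e \<Longrightarrow> x \<in> L \<Longrightarrow> y \<in> L \<Longrightarrow> cinner (e x) (e y) = cinner x y"
  and isometry_on_clinear: "isometry_on L e \<Longrightarrow> clinear_on L e"
  by (auto simp: isometry_on_def)

lemma isometry_on_norm:
  assumes "isometry_on L e" "x \<in> L"
  shows "norm (e x) = norm x"
proof -
  have "complex_of_real ((norm (e x))\<^sup>2) = complex_of_real ((norm x)\<^sup>2)"
    using isometry_on_cinner[OF assms(1,2,2)] by (simp only: cinner_self)
  then show ?thesis by (simp only: of_real_eq_iff power2_eq_iff_nonneg norm_ge_zero)
qed

lemma isometry_on_bounded: "isometry_on L e \<Longrightarrow> bounded_clinear_on L e"
  by (auto simp: bounded_clinear_on_def isometry_on_clinear isometry_on_norm intro!: exI[of _ 1])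

lemma isometry_on_inj:
  assumes e: "isometry_on L e" and L: "hilbert_space L"
  shows "inj_on e L"
proof (rule inj_onI)
  fix x y assume *: "x \<in> L" "y \<in> L" "e x = e y"
  then have "e (x - y) = 0"
    by (simp add: clinear_on_diff[OF isometry_on_clinear[OF e] L])
  then show "x = y"
    using isometry_on_norm[OF e hilbert_space_diff[OF L *(1,2)]] by simp
qed

text \<open>Closedness holds because preimages of a convergent sequence are again Cauchy and their
  limit lies in the closed set \<open>L\<close>.\<close>

lemma hilbert_space_isometry_image:
  assumes e: "isometry_on L e" and L: "hilbert_space L"
  shows "hilbert_space (e ` L)"
  unfolding hilbert_space_def
proof (intro conjI)
  have lin: "clinear_on L e" by (rule isometry_on_clinear[OF e])
  show "closed (e ` L)"
  proof (subst closed_sequential_limits, intro allI impI, elim conjE)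
    fix X y assume "\<forall>m. X m \<in> e ` L" and lim: "X \<longlonglongrightarrow> y"
    then have "\<forall>m. \<exists>z\<in>L. X m = e z" by auto
    then obtain Z where Z: "\<And>m. Z m \<in> L" "\<And>m. X m = e (Z m)" by metis
    have "dist (Z i) (Z j) = dist (X i) (X j)" for i j
      using isometry_on_norm[OF e, of "Z i - Z j"]
      by (simp add: dist_norm Z clinear_on_diff[OF lin L] hilbert_space_diff[OF L])
    then have "Cauchy Z" using LIMSEQ_imp_Cauchy[OF lim] by (simp add: Cauchy_def)
    then obtain z where z: "Z \<longlonglongrightarrow> z" using Cauchy_convergent convergent_def by blast
    then have "z \<in> L" using closed_sequentially[OF hilbert_space_closed[OF L]] Z by blast
    then have "(\<lambda>m. e (Z m)) \<longlonglongrightarrow> e z"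
      by (intro bounded_clinear_on_tendsto[OF isometry_on_bounded[OF e] L] Z z)
    then have "y = e z" using lim Z LIMSEQ_unique by (metis (no_types, lifting) ext)
    then show "y \<in> e ` L" using \<open>z \<in> L\<close> by blast
  qed
  show "0 \<in> e ` L" using clinear_on_zero[OF lin] hilbert_space_zero[OF L] by force
  show "\<forall>x\<in>e ` L. \<forall>y\<in>e ` L. x + y \<in> e ` L"
    using clinear_on_add[OF lin, symmetric] hilbert_space_add[OF L] by auto
  show "\<forall>c. \<forall>x\<in>e ` L. c *\<^sub>C x \<in> e ` L"
    using clinear_on_scaleC[OF lin, symmetric] hilbert_space_scaleC[OF L] by auto
qed

lemma isometry_on_inv:
  assumes e: "isometry_on L e" and L: "hilbert_space L"
  shows "isometry_on (e ` L) (inv_into L e)"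
proof -
  note inj = isometry_on_inj[OF e L]
  have lin: "clinear_on L e" by (rule isometry_on_clinear[OF e])
  have "inv_into L e (e x + e y) = x + y" if "x \<in> L" "y \<in> L" for x y
    using that inv_into_f_f[OF inj, of "x + y"] by (simp add: clinear_on_add[OF lin] hilbert_space_add[OF L])
  moreover have "inv_into L e (c *\<^sub>C e x) = c *\<^sub>C x" if "x \<in> L" for x c
    using that inv_into_f_f[OF inj, of "c *\<^sub>C x"]
    by (simp add: clinear_on_scaleC[OF lin] hilbert_space_scaleC[OF L])
  ultimately show ?thesis
    by (auto simp: isometry_on_def clinear_on_def inv_into_f_f[OF inj] isometry_on_cinner[OF e])
qed

lemma isometry_on_comp:
  "isometry_on L e \<Longrightarrow> isometry_on K f \<Longrightarrow> e ` L \<subseteq> K \<Longrightarrow> isometry_on L (\<lambda>x. f (e x))"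
  by (auto simp: isometry_on_def clinear_on_def image_subset_iff)

section \<open>Doubly commuting row isometries\<close>

locale lambda_tuple =
  fixes k :: nat and n :: "nat \<Rightarrow> nat" and lam :: "nat \<Rightarrow> nat \<Rightarrow> nat \<Rightarrow> nat \<Rightarrow> complex"
    and K :: "'a::chilbert_space set" and V :: "nat \<Rightarrow> nat \<Rightarrow> 'a \<Rightarrow> 'a"
  assumes lam: "\<And>i j s t. i \<in> {1..k} \<Longrightarrow> j \<in> {1..k} \<Longrightarrow> i \<noteq> j \<Longrightarrow> s \<in> {1..n i} \<Longrightarrow> t \<in> {1..n j} \<Longrightarrow>
      cmod (lam i j s t) = 1 \<and> lam j i t s = cnj (lam i j s t)"
    and tuple: "doubly_commuting_row_isometries k n lam K V"
begin

definition entry :: "nat \<Rightarrow> nat \<Rightarrow> bool" where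
  "entry i s \<longleftrightarrow> i \<in> {1..k} \<and> s \<in> {1..n i}"

abbreviation Va :: "nat \<Rightarrow> nat \<Rightarrow> 'a \<Rightarrow> 'a" where
  "Va i s \<equiv> adj K (V i s)"

lemma lam_unit: "entry i s \<Longrightarrow> entry j t \<Longrightarrow> i \<noteq> j \<Longrightarrow> cmod (lam i j s t) = 1"
  and lam_swap: "entry i s \<Longrightarrow> entry j t \<Longrightarrow> i \<noteq> j \<Longrightarrow> lam j i t s = cnj (lam i j s t)"
  using lam[of i j s t] by (simp_all add: entry_def)

lemma lam_mult_cnj: "entry i s \<Longrightarrow> entry j t \<Longrightarrow> i \<noteq> j \<Longrightarrow> lam i j s t * cnj (lam i j s t) = 1"
  by (simp add: cmod_one_mult_cnj lam_unit)

lemma hilbert_K: "hilbert_space K"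
  using tuple by (simp add: doubly_commuting_row_isometries_def)

lemma V_op: "entry i s \<Longrightarrow> bounded_op K (V i s)"
  using tuple by (auto simp: doubly_commuting_row_isometries_def row_isometry_def entry_def)

lemma V_mem: "entry i s \<Longrightarrow> x \<in> K \<Longrightarrow> V i s x \<in> K"
  using V_op by (rule bounded_op_mem)

lemma Va_op: "entry i s \<Longrightarrow> bounded_op K (Va i s)"
  by (intro bounded_op_adj hilbert_K V_op)

lemma Va_mem: "entry i s \<Longrightarrow> Va i s x \<in> K"
  by (intro adj_mem hilbert_K V_op)

lemmas V_bdd = bounded_op_bounded_clinear[OF V_op]
lemmas Va_bdd = bounded_op_bounded_clinear[OF Va_op]
lemmas V_lin = bounded_clinear_onD[OF V_bdd]
lemmas Va_lin = bounded_clinear_onD[OF Va_bdd]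
lemmas V_scaleC = clinear_on_scaleC[OF V_lin]
lemma V_zero: "entry i s \<Longrightarrow> V i s 0 = 0"
  and Va_zero: "entry i s \<Longrightarrow> Va i s 0 = 0"
  by (auto intro: clinear_on_zero V_lin Va_lin hilbert_space_zero hilbert_K)

lemma cinner_Va_right: "entry i s \<Longrightarrow> x \<in> K \<Longrightarrow> cinner x (Va i s y) = cinner (V i s x) y"
  by (intro cinner_adj_right hilbert_K V_op)

lemma cinner_Va_left: "entry i s \<Longrightarrow> x \<in> K \<Longrightarrow> cinner (Va i s y) x = cinner y (V i s x)"
  by (intro cinner_adj_left hilbert_K V_op)

lemma Va_V: "entry i s \<Longrightarrow> entry i t \<Longrightarrow> x \<in> K \<Longrightarrow> Va i s (V i t x) = (if s = t then x else 0)"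
  using tuple by (auto simp: doubly_commuting_row_isometries_def row_isometry_def entry_def)

lemma Va_V_comm:
  "entry i s \<Longrightarrow> entry j t \<Longrightarrow> i \<noteq> j \<Longrightarrow> x \<in> K \<Longrightarrow>
    Va i s (V j t x) = cnj (lam i j s t) *\<^sub>C V j t (Va i s x)"
  using tuple by (auto simp: doubly_commuting_row_isometries_def doubly_commuting_def entry_def)

text \<open>The double commutation relation implies the plain one because the square norm of the
  difference expands into four terms that cancel.\<close>

lemma V_comm:
  assumes i: "entry i s" and j: "entry j t" and ij: "i \<noteq> j" and x: "x \<in> K"
  shows "V i s (V j t x) = lam i j s t *\<^sub>C V j t (V i s x)"
proof -
  define c where "c = lam i j s t"
  have c: "c * cnj c = 1" using lam_mult_cnj[OF i j ij] by (simp add: c_def)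
  note mem = V_mem[OF i] V_mem[OF j] x
  have iso: "cinner (V i s y) (V i s z) = cinner y z" "cinner (V j t y) (V j t z) = cinner y z"
    if "y \<in> K" "z \<in> K" for y z
    using that i j by (simp_all add: Va_V V_mem flip: cinner_Va_right)
  have ST: "cinner (V i s (V j t x)) (V j t (V i s x)) = c * cinner x x"
  proof -
    have "cinner (V i s (V j t x)) (V j t (V i s x)) = cinner (V j t x) (Va i s (V j t (V i s x)))"
      by (simp add: cinner_Va_right[OF i] mem)
    also have "Va i s (V j t (V i s x)) = cnj c *\<^sub>C V j t x"
      by (simp add: Va_V_comm[OF i j ij] mem Va_V[OF i i] c_def)
    finally show ?thesis by (simp add: cinner_scaleC_right iso mem)
  qed
  have TS: "cinner (V j t (V i s x)) (V i s (V j t x)) = cnj c * cinner x x"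
    using ST by (metis cinner_commute complex_cnj_mult)
  have "cinner (V i s (V j t x) - c *\<^sub>C V j t (V i s x)) (V i s (V j t x) - c *\<^sub>C V j t (V i s x)) = 0"
    using c by (simp add: cinner_diff_left cinner_diff_right cinner_scaleC_left cinner_scaleC_right
        iso ST TS mem algebra_simps)
  then show ?thesis by (simp add: cinner_self_eq_0_iff c_def)
qed

text \<open>Obtained by testing against \<open>z\<close> and using \<open>V_comm\<close> with the
  rows exchanged. The phase is not conjugated: exchanging the rows conjugates it once, moving it to
  the second slot once more.\<close>

lemma Va_comm:
  assumes i: "entry i s" and j: "entry j t" and ij: "i \<noteq> j" and x: "x \<in> K"
  shows "Va i s (Va j t x) = lam i j s t *\<^sub>C Va j t (Va i s x)"
proof (rule cinner_eqI[OF hilbert_K])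
  fix z assume z: "z \<in> K"
  have "cinner z (Va i s (Va j t x)) = cinner (V j t (V i s z)) x"
    using z i j by (simp add: cinner_Va_right V_mem)
  also have "V j t (V i s z) = cnj (lam i j s t) *\<^sub>C V i s (V j t z)"
    using V_comm[OF j i _ z] ij lam_swap[OF i j ij] by simp
  also have "cinner \<dots> x = cinner z (lam i j s t *\<^sub>C Va j t (Va i s x))"
    using z i j by (simp add: cinner_Va_right V_mem cinner_scaleC_left cinner_scaleC_right)
  finally show "cinner z (Va i s (Va j t x)) = cinner z (lam i j s t *\<^sub>C Va j t (Va i s x))" .
qed (use i j in \<open>auto intro: Va_mem hilbert_space_scaleC hilbert_K\<close>)

subsection \<open>Wandering subspaces\<close>

text \<open>The orthogonal complement in \<open>K\<close> of the ranges of all \<open>V i s\<close>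
  with \<open>i\<close> in \<open>A\<close>; in particular \<open>wand {}\<close> is
  \<open>K\<close>.\<close>

definition wand :: "nat set \<Rightarrow> 'a set" where
  "wand A = {x\<in>K. \<forall>i\<in>A. \<forall>s\<in>{1..n i}. Va i s x = 0}"

text \<open>The closed span of all translates of \<open>E\<close> by words in the rows of
  \<open>A\<close>, described from above so that no words have to be manipulated.\<close>

definition orbit :: "nat set \<Rightarrow> 'a set \<Rightarrow> 'a set" where
  "orbit A E = \<Inter>{M. hilbert_space M \<and> M \<subseteq> K \<and> E \<subseteq> M \<and> (\<forall>i\<in>A. \<forall>s\<in>{1..n i}. V i s ` M \<subseteq> M)}"

lemma entryI: "A \<subseteq> {1..k} \<Longrightarrow> i \<in> A \<Longrightarrow> s \<in> {1..n i} \<Longrightarrow> entry i s"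
  by (auto simp: entry_def)

lemma wand_subset: "wand A \<subseteq> K"
  by (auto simp: wand_def)

lemma hilbert_wand: "A \<subseteq> {1..k} \<Longrightarrow> hilbert_space (wand A)"
  unfolding wand_def by (intro hilbert_space_INT hilbert_space_kernel hilbert_K Va_bdd entryI)

text \<open>An adjoint from row \<open>i\<close> passes both \<open>V j t\<close> and its adjoint up
  to a phase when \<open>i\<close> and \<open>j\<close> differ, and then meets a vector that it
  kills.\<close>

lemma wand_invariant:
  assumes A: "A \<subseteq> {1..k}" and j: "entry j t" "j \<notin> A" and x: "x \<in> wand A"
  shows "V j t x \<in> wand A" "Va j t x \<in> wand A"
proof -
  have "Va i s (V j t x) = 0" "Va i s (Va j t x) = 0" if i: "i \<in> A" "s \<in> {1..n i}" for i s
  proof -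
    have "i \<noteq> j" "Va i s x = 0" "x \<in> K" using i j x by (auto simp: wand_def)
    then show "Va i s (V j t x) = 0" "Va i s (Va j t x) = 0"
      using entryI[OF A i] j by (simp_all add: Va_V_comm Va_comm V_zero Va_zero)
  qed
  then show "V j t x \<in> wand A" "Va j t x \<in> wand A"
    using x j by (auto simp: wand_def V_mem Va_mem)
qed

context
  fixes A E assumes A: "A \<subseteq> {1..k}" and E: "E \<subseteq> K"
begin

lemma hilbert_orbit: "hilbert_space (orbit A E)"
  unfolding orbit_def by (rule hilbert_space_Inter) auto

lemma orbit_subset: "orbit A E \<subseteq> K"
  unfolding orbit_def using hilbert_K E V_mem[OF entryI[OF A]] by (intro Inter_lower) auto

lemma orbit_base: "E \<subseteq> orbit A E"
  by (auto simp: orbit_def)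

lemma orbit_step: "i \<in> A \<Longrightarrow> s \<in> {1..n i} \<Longrightarrow> x \<in> orbit A E \<Longrightarrow> V i s x \<in> orbit A E"
  unfolding orbit_def by blast

end

text \<open>The part of the orbit where \<open>P\<close> holds is itself one of the subspaces
  intersected in \<open>orbit\<close>, provided that \<open>P\<close> cuts out a closed
  subspace.\<close>

lemma orbit_induct [consumes 3, case_names hilbert base step]:
  assumes A: "A \<subseteq> {1..k}" and E: "E \<subseteq> K" and x: "x \<in> orbit A E" and P: "hilbert_space {y\<in>orbit A E. P y}"
    and base: "\<And>y. y \<in> E \<Longrightarrow> P y"
    and step: "\<And>i s y. i \<in> A \<Longrightarrow> entry i s \<Longrightarrow> y \<in> orbit A E \<Longrightarrow> P y \<Longrightarrow> P (V i s y)"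
  shows "P x"
proof -
  have "{y\<in>orbit A E. P y} \<in>
      {M. hilbert_space M \<and> M \<subseteq> K \<and> E \<subseteq> M \<and> (\<forall>i\<in>A. \<forall>s\<in>{1..n i}. V i s ` M \<subseteq> M)}"
  proof (intro CollectI conjI ballI P)
    show "{y\<in>orbit A E. P y} \<subseteq> K" using orbit_subset[OF A E] by blast
    show "E \<subseteq> {y\<in>orbit A E. P y}" using orbit_base[OF A E] base by blast
    show "V i s ` {y\<in>orbit A E. P y} \<subseteq> {y\<in>orbit A E. P y}" if "i \<in> A" "s \<in> {1..n i}" for i s
      using orbit_step[OF A E that] step[OF that(1) entryI[OF A that]] by blast
  qed
  then have "orbit A E \<subseteq> {y\<in>orbit A E. P y}" unfolding orbit_def by (rule Inter_lower)
  with x show ?thesis by blast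
qed

lemma orbit_trivial: "A \<subseteq> {1..k} \<Longrightarrow> orbit A {0} = {0}"
  using hilbert_orbit[of A "{0}"] orbit_base[of A "{0}"]
  unfolding orbit_def
  by (intro equalityI Inter_lower)
    (auto simp: hilbert_space_trivial hilbert_space_zero[OF hilbert_K] V_zero entryI hilbert_space_zero)

lemma tuple_ops_iff: "T \<in> tuple_ops n {1..k} V \<longleftrightarrow> (\<exists>i s. entry i s \<and> T = V i s)"
  by (auto simp: tuple_ops_def entry_def)

lemma reducing_iff:
  "reducing K (tuple_ops n {1..k} V) M \<longleftrightarrow> hilbert_space M \<and> M \<subseteq> K \<and>
    (\<forall>i s. entry i s \<longrightarrow> V i s ` M \<subseteq> M \<and> Va i s ` M \<subseteq> M)"
  unfolding reducing_def Ball_def tuple_ops_iff by blast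

lemma reducing_mem:
  assumes "reducing K (tuple_ops n {1..k} V) M" "entry i s" "x \<in> M"
  shows "V i s x \<in> M" "Va i s x \<in> M"
  using assms by (auto simp: reducing_iff image_subset_iff)

lemma irreducible_iff:
  "irreducible_on K (cstar K (tuple_ops n {1..k} V)) \<longleftrightarrow>
    (\<forall>M. reducing K (tuple_ops n {1..k} V) M \<longrightarrow> M = {0} \<or> M = K)"
  by (rule irreducible_on_cstar_iff[OF hilbert_K]) (auto simp: tuple_ops_iff V_op)

text \<open>On a translate, an adjoint of the same row strips the leading operator or gives 0, and
  an operator of another row moves inward up to a phase until it reaches \<open>E\<close>.
  Invariance under \<open>V\<close> comes first because the argument for adjoints uses it.\<close>

lemma orbit_reducing:
  assumes A: "A \<subseteq> {1..k}" and E: "E \<subseteq> wand A"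
    and inv: "\<And>j t x. entry j t \<Longrightarrow> j \<notin> A \<Longrightarrow> x \<in> E \<Longrightarrow> V j t x \<in> E \<and> Va j t x \<in> E"
  shows "reducing K (tuple_ops n {1..k} V) (orbit A E)"
proof -
  have EK: "E \<subseteq> K" using E wand_subset by blast
  note H = hilbert_orbit[OF A EK] and sub = orbit_subset[OF A EK] and base = subsetD[OF orbit_base[OF A EK]]
    and step = orbit_step[OF A EK]
  have V: "V j t x \<in> orbit A E" if j: "entry j t" and x: "x \<in> orbit A E" for j t x
  proof (cases "j \<in> A")
    case True
    then show ?thesis using x j by (auto simp: entry_def intro!: step)
  next
    case False
    from A EK x show ?thesis
    proof (induction x rule: orbit_induct)
      case hilbert
      show ?case by (rule hilbert_space_vimage[OF bounded_clinear_on_subset[OF V_bdd[OF j] sub] H H])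
    next
      case (base y)
      then show ?case using inv[OF j False] \<open>\<And>c. c \<in> E \<Longrightarrow> c \<in> orbit A E\<close> by blast
    next
      case (step i s y)
      then have "V j t (V i s y) = lam j i t s *\<^sub>C V i s (V j t y)"
        using V_comm[OF j, of i s y] sub False by blast
      then show ?case
        using step orbit_step[OF A EK, of i s] by (auto simp: entry_def intro!: hilbert_space_scaleC[OF H])
    qed
  qed
  have Va: "Va j t x \<in> orbit A E" if j: "entry j t" and x: "x \<in> orbit A E" for j t x
    using A EK x
  proof (induction x rule: orbit_induct)
    case hilbert
    show ?case by (rule hilbert_space_vimage[OF bounded_clinear_on_subset[OF Va_bdd[OF j] sub] H H])
  next
    case (base y)
    show ?case
    proof (cases "j \<in> A")
      case True
      then have "Va j t y = 0" using E base j by (auto simp: wand_def entry_def)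
      then show ?thesis using hilbert_space_zero[OF H] by simp
    next
      case False
      then show ?thesis using inv[OF j False] base orbit_base[OF A EK] by blast
    qed
  next
    case (step i s y)
    then have y: "y \<in> K" using sub by blast
    show ?case
    proof (cases "i = j")
      case True
      then show ?thesis
        using step y j Va_V[of j t s y] hilbert_space_zero[OF H] by auto
    next
      case False
      then have "Va j t (V i s y) = cnj (lam j i t s) *\<^sub>C V i s (Va j t y)"
        using Va_V_comm[OF j \<open>entry i s\<close> _ y] by blast
      then show ?thesis using step V by (auto intro!: hilbert_space_scaleC[OF H])
    qed
  qed
  show ?thesis unfolding reducing_iff using H sub V Va by blast
qed

text \<open>Moving a leading \<open>V i s\<close> to the other side replaces \<open>y\<close> in
  \<open>S\<close> by its image under an adjoint, which is again in \<open>S\<close>. So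
  \<open>S\<close> is orthogonal to every translate of \<open>E\<close>, hence to all of
  \<open>K\<close> and to itself.\<close>

lemma orbit_eq_imp_orthogonal:
  assumes A: "A \<subseteq> {1..k}" and E: "E \<subseteq> K" and orbit: "orbit A E = K"
    and S: "S \<subseteq> K" "\<And>i s y. i \<in> A \<Longrightarrow> entry i s \<Longrightarrow> y \<in> S \<Longrightarrow> Va i s y \<in> S"
    and orth: "\<And>y z. y \<in> S \<Longrightarrow> z \<in> E \<Longrightarrow> cinner z y = 0"
  shows "S \<subseteq> {0}"
proof -
  have "\<forall>y\<in>S. cinner x y = 0" if "x \<in> orbit A E" for x
    using A E that
  proof (induction x rule: orbit_induct)
    case hilbert
    then show ?case using hilbert_space_ocompl[OF hilbert_K, of S] by (simp add: ocompl_def orbit)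
  next
    case (base y)
    then show ?case using orth by blast
  next
    case (step i s z)
    then show ?case using S(2) by (auto simp: orbit simp flip: cinner_Va_right)
  qed
  then show ?thesis using S(1) cinner_self_eq_0_iff by (auto simp: orbit)
qed

text \<open>The defect \<open>y\<close> of \<open>x\<close> is killed by all adjoints of row
  \<open>i\<close> and stays in \<open>M\<close>, so it lies in the trivial intersection. This is
  how the Cuntz relation arises both on \<open>K\<close> and on \<open>wand B\<close>.\<close>

lemma wand_singleton_trivial:
  assumes i: "i \<in> {1..k}" and M: "hilbert_space M" "M \<subseteq> K" "M \<inter> wand {i} \<subseteq> {0}"
    and inv: "\<And>s. entry i s \<Longrightarrow> V i s ` M \<subseteq> M \<and> Va i s ` M \<subseteq> M" and x: "x \<in> M"
  shows "(\<Sum>s\<in>{1..n i}. V i s (Va i s x)) = x"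
proof -
  define y where "y = x - (\<Sum>s\<in>{1..n i}. V i s (Va i s x))"
  have e: "entry i s" if "s \<in> {1..n i}" for s using i that by (simp add: entry_def)
  have VM: "V i s (Va i s x) \<in> M" if "s \<in> {1..n i}" for s using inv[OF e[OF that]] x by blast
  then have yM: "y \<in> M" unfolding y_def by (intro hilbert_space_diff hilbert_space_sum M x)
  have "Va i t y = 0" if t: "t \<in> {1..n i}" for t
  proof -
    have sK: "(\<Sum>s\<in>{1..n i}. V i s (Va i s x)) \<in> K"
      using VM M by (intro hilbert_space_sum hilbert_K) auto
    have "Va i t y = Va i t x - Va i t (\<Sum>s\<in>{1..n i}. V i s (Va i s x))"
      unfolding y_def using x M sK by (intro clinear_on_diff[OF Va_lin[OF e[OF t]] hilbert_K]) auto
    also have "Va i t (\<Sum>s\<in>{1..n i}. V i s (Va i s x)) = (\<Sum>s\<in>{1..n i}. Va i t (V i s (Va i s x)))"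
      using VM M by (intro clinear_on_sum[OF Va_lin[OF e[OF t]] hilbert_K]) auto
    also have "\<dots> = (\<Sum>s\<in>{1..n i}. if t = s then Va i t x else 0)"
      by (intro sum.cong refl) (simp add: Va_V e e[OF t] Va_mem)
    also have "\<dots> = Va i t x" using t by simp
    finally show ?thesis by simp
  qed
  then have "y \<in> wand {i}" using yM M by (auto simp: wand_def)
  then show ?thesis using yM M(3) by (auto simp: y_def)
qed

subsection \<open>Embedded wandering data\<close>

text \<open>What remains of a unitary onto the standard tuple after restricting its inverse to the
  vectors at the empty words. It allows the wandering data to be studied inside
  \<open>K\<close>.\<close>

definition wandering_embedding ::
  "nat set \<Rightarrow> 'b::chilbert_space set \<Rightarrow> (nat \<Rightarrow> nat \<Rightarrow> 'b \<Rightarrow> 'b) \<Rightarrow> ('b \<Rightarrow> 'a) \<Rightarrow> bool" where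
  "wandering_embedding A L W e \<longleftrightarrow> isometry_on L e \<and> e ` L \<subseteq> wand A \<and> orbit A (e ` L) = K \<and>
    (\<forall>j t. entry j t \<and> j \<notin> A \<longrightarrow> (\<forall>l\<in>L. V j t (e l) = e (W j t l)))"

context
  fixes A and L :: "'b::chilbert_space set" and W and e
  assumes A: "A \<subseteq> {1..k}" and data: "wandering_data k n lam A L W"
    and emb: "wandering_embedding A L W e"
begin

lemma embedding_isometry: "isometry_on L e"
  and embedding_orbit: "orbit A (e ` L) = K"
  and embedding_subset: "e ` L \<subseteq> K"
  and embedding_V: "entry j t \<Longrightarrow> j \<notin> A \<Longrightarrow> l \<in> L \<Longrightarrow> V j t (e l) = e (W j t l)"
  using emb wand_subset by (auto simp: wandering_embedding_def)

lemma hilbert_L: "hilbert_space L"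
  using data by (simp add: wandering_data_def)

lemma W_op: "entry j t \<Longrightarrow> j \<notin> A \<Longrightarrow> bounded_op L (W j t)"
  using data by (auto simp: wandering_data_def cuntz_def row_isometry_def entry_def)

text \<open>Only one inclusion is assumed in \<open>wandering_embedding\<close>. What is left over
  in \<open>wand A\<close> is killed by the adjoints of the rows in \<open>A\<close> and orthogonal
  to the generating set, so it vanishes.\<close>

lemma embedding_range: "e ` L = wand A"
proof (rule subspace_eqI[OF hilbert_wand[OF A]])
  show "hilbert_space (e ` L)"
    by (rule hilbert_space_isometry_image[OF embedding_isometry hilbert_L])
  show "e ` L \<subseteq> wand A" using emb by (simp add: wandering_embedding_def)
  show "ocompl (wand A) (e ` L) \<subseteq> {0}"
  proof -
    \<comment> \<open>Adjoints of the rows in \<open>A\<close> send every vector of this set to 0,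
      so including 0 makes the set visibly invariant.\<close>
    have "insert 0 (ocompl (wand A) (e ` L)) \<subseteq> {0}"
    proof (rule orbit_eq_imp_orthogonal[OF A embedding_subset embedding_orbit])
      show "insert 0 (ocompl (wand A) (e ` L)) \<subseteq> K"
        using hilbert_space_zero[OF hilbert_K] by (auto simp: ocompl_def wand_def)
      show "Va i s y \<in> insert 0 (ocompl (wand A) (e ` L))"
        if "i \<in> A" "entry i s" "y \<in> insert 0 (ocompl (wand A) (e ` L))" for i s y
        using that by (auto simp: Va_zero ocompl_def wand_def entry_def)
      show "cinner z y = 0" if "y \<in> insert 0 (ocompl (wand A) (e ` L))" "z \<in> e ` L" for y z
        using that by (auto simp: ocompl_def cinner_eq_0_commute[of z])
    qed
    then show ?thesis by blast
  qed
qed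

lemma embedding_adj:
  assumes j: "entry j t" "j \<notin> A" and l: "l \<in> L"
  shows "Va j t (e l) = e (adj L (W j t) l)"
proof (rule cinner_eqI[OF hilbert_wand[OF A]])
  note L = hilbert_L
  show "Va j t (e l) \<in> wand A"
    using wand_invariant(2)[OF A j] embedding_range l by blast
  show "e (adj L (W j t) l) \<in> wand A"
    using adj_mem[OF L W_op[OF j]] embedding_range by blast
  fix z assume "z \<in> wand A"
  then obtain m where m: "m \<in> L" "z = e m" using embedding_range by blast
  have "cinner z (Va j t (e l)) = cinner (e (W j t m)) (e l)"
    using m embedding_subset by (simp add: cinner_Va_right[OF j(1)] embedding_V[OF j] image_subset_iff)
  also have "\<dots> = cinner m (adj L (W j t) l)"
    using m l by (simp add: isometry_on_cinner[OF embedding_isometry] bounded_op_mem[OF W_op[OF j]]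
        cinner_adj_right[OF L W_op[OF j]])
  also have "\<dots> = cinner z (e (adj L (W j t) l))"
    using m by (simp add: isometry_on_cinner[OF embedding_isometry] adj_mem[OF L W_op[OF j]])
  finally show "cinner z (Va j t (e l)) = cinner z (e (adj L (W j t) l))" .
qed

text \<open>For a reducing subspace \<open>M\<close> the wandering space splits along \<open>M\<close> and its complement, so it
  lies in one of them, which must then be everything.\<close>

lemma embedding_irreducible:
  assumes irr: "irreducible_on L (cstar L (tuple_ops n ({1..k} - A) W))"
  shows "irreducible_on K (cstar K (tuple_ops n {1..k} V))"
  unfolding irreducible_iff
proof (intro allI impI)
  note L = hilbert_L and iso = embedding_isometry
  have irrL: "M = {0} \<or> M = L" if "reducing L (tuple_ops n ({1..k} - A) W) M" for M
  proof -
    have "bounded_op L T" if "T \<in> tuple_ops n ({1..k} - A) W" for T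
      using that W_op by (auto simp: tuple_ops_def entry_def)
    from irreducible_on_cstar_iff[OF L this] irr that show ?thesis by blast
  qed
  have all: "M = K" if M: "reducing K (tuple_ops n {1..k} V) M" and sub: "wand A \<subseteq> M" for M
  proof -
    have "orbit A (e ` L) \<subseteq> M"
      unfolding orbit_def using M sub entryI[OF A]
      by (intro Inter_lower) (auto simp: reducing_iff embedding_range)
    then show ?thesis using M by (auto simp: embedding_orbit reducing_iff)
  qed
  fix M assume M: "reducing K (tuple_ops n {1..k} V) M"
  \<comment> \<open>The pullback of \<open>M\<close> reduces the wandering data because the
    embedding intertwines both the operators and their adjoints.\<close>
  define N where "N = {l\<in>L. e l \<in> M}"
  have hM: "hilbert_space M" "M \<subseteq> K" using M by (auto simp: reducing_iff)
  have "reducing L (tuple_ops n ({1..k} - A) W) N"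
    unfolding reducing_def
  proof (intro conjI ballI)
    show "hilbert_space N"
      unfolding N_def by (rule hilbert_space_vimage[OF isometry_on_bounded[OF iso] L hM(1)])
    show "N \<subseteq> L" by (auto simp: N_def)
    fix T assume "T \<in> tuple_ops n ({1..k} - A) W"
    then obtain j t where j: "entry j t" "j \<notin> A" and T: "T = W j t"
      by (auto simp: tuple_ops_def entry_def)
    have "V j t ` M \<subseteq> M" "Va j t ` M \<subseteq> M" using M j by (auto simp: reducing_iff)
    then show "T ` N \<subseteq> N" "adj L T ` N \<subseteq> N"
      by (auto simp: N_def T bounded_op_mem[OF W_op[OF j]] adj_mem[OF L W_op[OF j]]
          simp flip: embedding_V[OF j] embedding_adj[OF j])
  qed
  then consider "N = {0}" | "N = L" using irrL by blast
  then show "M = {0} \<or> M = K"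
  proof cases
    case 2
    then have "wand A \<subseteq> M" by (auto simp: N_def simp flip: embedding_range)
    then show ?thesis using all[OF M] by blast
  next
    case 1
    have 0: "M \<inter> wand A \<subseteq> {0}"
    proof
      fix x assume "x \<in> M \<inter> wand A"
      then obtain l where "l \<in> L" "x = e l" "e l \<in> M" by (auto simp flip: embedding_range)
      with 1 have "l = 0" by (auto simp: N_def)
      then show "x \<in> {0}"
        using \<open>x = e l\<close> clinear_on_zero[OF isometry_on_clinear[OF iso] hilbert_space_zero[OF L]] by simp
    qed
    have red: "reducing K (tuple_ops n {1..k} V) (ocompl K M)"
      using M by (intro reducing_ocompl hilbert_K) (auto simp: tuple_ops_iff V_op)
    have "wand A \<subseteq> ocompl K M"
    proof
      fix x assume x: "x \<in> wand A"
      then have "x \<in> K" using wand_subset by blast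
      then obtain p q where pq: "p \<in> M" "q \<in> ocompl K M" "x = p + q"
        using ocompl_decompose[OF hilbert_K hM] by blast
      have qK: "q \<in> K" using pq by (simp add: ocompl_def)
      \<comment> \<open>The adjoint preserves \<open>M\<close> and its complement, so the images of
        \<open>p\<close> and \<open>q\<close> are orthogonal; as they add up to 0, both
        vanish.\<close>
      have "Va i s p = 0" if "i \<in> A" "s \<in> {1..n i}" for i s
      proof -
        have i: "entry i s" using entryI[OF A that] .
        have "Va i s p \<in> M" "Va i s q \<in> ocompl K M"
          using reducing_mem(2)[OF M i pq(1)] reducing_mem(2)[OF red i pq(2)] by auto
        moreover have "Va i s p + Va i s q = 0"
          using x that pq hM qK clinear_on_add[OF Va_lin[OF i], of p q] by (auto simp: wand_def)
        ultimately have "cinner (Va i s p) (Va i s p) = 0"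
          using cinner_ocompl_sym[of "Va i s q" K M "Va i s p"]
          by (metis add_eq_0_iff cinner_minus_right neg_equal_0_iff_equal)
        then show ?thesis by (simp add: cinner_self_eq_0_iff)
      qed
      then have "p \<in> wand A" using pq hM by (auto simp: wand_def)
      then have "p = 0" using 0 pq by blast
      then show "x \<in> ocompl K M" using pq by simp
    qed
    then have "ocompl K M = K" by (rule all[OF red])
    then have "M \<subseteq> ocompl K M" using hM by blast
    then have "M \<subseteq> {0}" using cinner_self_eq_0_iff by (auto simp: ocompl_def)
    then show ?thesis using hilbert_space_zero[OF hM(1)] by blast
  qed
qed

text \<open>For \<open>i\<close> in \<open>A\<close> a trivial \<open>wand {i}\<close> would force
  \<open>wand A\<close>, and with it its orbit \<open>K\<close>, to be zero. For other
  \<open>i\<close> the Cuntz relation carries over to \<open>e\<close> L\<open>, so\<close>wand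
  {i}\<open>is orthogonal to\<close>e \<open>L\<close> and hence to its orbit.\<close>

lemma embedding_set:
  assumes "K \<noteq> {0}"
  shows "A = {i\<in>{1..k}. wand {i} \<noteq> {0}}"
proof -
  have ne: "wand {i} \<noteq> {0}" if i: "i \<in> A" for i
  proof
    assume "wand {i} = {0}"
    then have "wand A = {0}"
      using i hilbert_space_zero[OF hilbert_wand[OF A]] by (auto simp: wand_def)
    then show False
      using embedding_orbit orbit_trivial[OF A] assms by (simp add: embedding_range)
  qed
  have le: "wand {i} \<subseteq> {0}" if i: "i \<in> {1..k}" "i \<notin> A" for i
  proof (rule orbit_eq_imp_orthogonal[OF A embedding_subset embedding_orbit wand_subset])
    show "Va j s y \<in> wand {i}" if "j \<in> A" "entry j s" "y \<in> wand {i}" for j s y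
      using that i by (intro wand_invariant) auto
    fix y z assume y: "y \<in> wand {i}" and "z \<in> e ` L"
    then obtain l where l: "l \<in> L" "z = e l" by blast
    have ent: "entry i s" if "s \<in> {1..n i}" for s using that i by (simp add: entry_def)
    have "l = (\<Sum>s\<in>{1..n i}. W i s (adj L (W i s) l))"
      using data i l by (simp add: wandering_data_def cuntz_def)
    then have "z = (\<Sum>s\<in>{1..n i}. e (W i s (adj L (W i s) l)))"
      unfolding l using adj_mem[OF hilbert_L W_op] bounded_op_mem[OF W_op] ent i
      by (subst clinear_on_sum[OF isometry_on_clinear[OF embedding_isometry] hilbert_L, symmetric]) auto
    also have "\<dots> = (\<Sum>s\<in>{1..n i}. V i s (Va i s z))"
      using adj_mem[OF hilbert_L W_op] ent i l
      by (intro sum.cong refl) (simp add: embedding_adj embedding_V)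
    finally have "cinner z y = cinner (\<Sum>s\<in>{1..n i}. V i s (Va i s z)) y" by (rule arg_cong)
    also have "\<dots> = (\<Sum>s\<in>{1..n i}. cinner (V i s (Va i s z)) y)" by (rule cinner_sum_left)
    also have "\<dots> = 0"
    proof (intro sum.neutral ballI)
      fix s assume s: "s \<in> {1..n i}"
      then have "Va i s y = 0" using y by (auto simp: wand_def)
      then show "cinner (V i s (Va i s z)) y = 0"
        using cinner_Va_right[OF ent[OF s] Va_mem[OF ent[OF s]], of z y] by simp
    qed
    finally show "cinner z y = 0" .
  qed
  show ?thesis
  proof (intro set_eqI iffI)
    fix i assume "i \<in> {i\<in>{1..k}. wand {i} \<noteq> {0}}"
    then have i: "i \<in> {1..k}" "wand {i} \<noteq> {0}" by auto
    then have "0 \<in> wand {i}" by (intro hilbert_space_zero hilbert_wand) auto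
    then show "i \<in> A" using le i by fastforce
  qed (use A ne in auto)
qed

end

text \<open>Each row is either Cuntz or pure, since the span of the translates of its wandering space
  reduces the tuple.\<close>

lemma irreducible_imp_embedding:
  assumes irr: "irreducible_on K (cstar K (tuple_ops n {1..k} V))" and K0: "K \<noteq> {0}"
  defines "A \<equiv> {i\<in>{1..k}. wand {i} \<noteq> {0}}"
  shows "wandering_data k n lam A (wand A) V"
    and "wandering_embedding A (wand A) V (\<lambda>x. x)"
    and "irreducible_on (wand A) (cstar (wand A) (tuple_ops n ({1..k} - A) V))"
proof -
  have A: "A \<subseteq> {1..k}" by (auto simp: A_def)
  have red0: "M = {0} \<or> M = K" if "reducing K (tuple_ops n {1..k} V) M" for M
    using irr that by (simp add: irreducible_iff)
  have orbit_K: "orbit B E = K"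
    if "B \<subseteq> {1..k}" "E \<subseteq> wand B" "\<not> E \<subseteq> {0}"
      "\<And>j t x. entry j t \<Longrightarrow> j \<notin> B \<Longrightarrow> x \<in> E \<Longrightarrow> V j t x \<in> E \<and> Va j t x \<in> E" for B E
  proof -
    have "E \<subseteq> orbit B E" using that(1,2) wand_subset[of B] by (intro orbit_base) auto
    then show ?thesis using red0[OF orbit_reducing[OF that(1,2,4)]] that(3) by blast
  qed
  have wand_ne: "\<not> wand B \<subseteq> {0}" if "finite B" "B \<subseteq> A" for B
    using that
  proof (induction B)
    case empty
    then show ?case using K0 hilbert_space_zero[OF hilbert_K] by (auto simp: wand_def)
  next
    case (insert i B)
    then have i: "i \<in> {1..k}" and B: "B \<subseteq> {1..k}" using A by auto
    show ?case
    proof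
      assume triv: "wand (insert i B) \<subseteq> {0}"
      have "wand {i} \<noteq> {0}" using insert by (auto simp: A_def)
      moreover have "0 \<in> wand {i}" using i by (intro hilbert_space_zero hilbert_wand) auto
      ultimately have orbit_i: "orbit {i} (wand {i}) = K"
        using i by (intro orbit_K) (auto simp: wand_invariant)
      have "wand B \<subseteq> {0}"
      proof (rule orbit_eq_imp_orthogonal[OF _ wand_subset orbit_i wand_subset])
        show "{i} \<subseteq> {1..k}" using i by simp
        show "Va j s y \<in> wand B" if "j \<in> {i}" "entry j s" "y \<in> wand B" for j s y
          using that insert B by (intro wand_invariant) auto
        fix y z assume y: "y \<in> wand B" and z: "z \<in> wand {i}"
        \<comment> \<open>Row \<open>i\<close> is Cuntz on \<open>wand B\<close>, so
          \<open>y\<close> lies in the span of its ranges, to which \<open>z\<close> is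
          orthogonal.\<close>
        have "(\<Sum>s\<in>{1..n i}. V i s (Va i s y)) = y"
        proof (rule wand_singleton_trivial[OF i hilbert_wand[OF B] wand_subset _ _ y])
          show "wand B \<inter> wand {i} \<subseteq> {0}" using triv by (auto simp: wand_def)
          show "V i s ` wand B \<subseteq> wand B \<and> Va i s ` wand B \<subseteq> wand B" if "entry i s" for s
            using wand_invariant[OF B that] insert by auto
        qed
        then have "cinner z y = cinner z (\<Sum>s\<in>{1..n i}. V i s (Va i s y))" by simp
        also have "\<dots> = (\<Sum>s\<in>{1..n i}. cinner z (V i s (Va i s y)))" by (rule cinner_sum_right)
        also have "\<dots> = 0"
        proof (intro sum.neutral ballI)
          fix s assume s: "s \<in> {1..n i}"
          then have "entry i s" "Va i s z = 0" using z i by (auto simp: entry_def wand_def)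
          then show "cinner z (V i s (Va i s y)) = 0"
            using cinner_Va_left[of i s "Va i s y" z] Va_mem[of i s y] by simp
        qed
        finally show "cinner z y = 0" .
      qed
      then show False using insert.IH insert.prems by simp
    qed
  qed
  have Ane: "\<not> wand A \<subseteq> {0}" using wand_ne[of A] finite_subset[OF A] by simp
  have inv: "V j t x \<in> wand A" "Va j t x \<in> wand A" if "entry j t" "j \<notin> A" "x \<in> wand A" for j t x
    using wand_invariant[OF A that] by auto
  note H = hilbert_wand[OF A]
  have op: "bounded_op (wand A) (V j t)" if "entry j t" "j \<notin> A" for j t
    using that inv(1) by (intro bounded_op_subset[OF V_op wand_subset]) auto
  have adj_eq: "adj (wand A) (V j t) x = Va j t x" if "entry j t" "j \<notin> A" "x \<in> wand A" for j t x
    using that inv by (intro adj_subset[OF hilbert_K V_op H wand_subset]) auto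
  show "wandering_embedding A (wand A) V (\<lambda>x. x)"
    using orbit_K[OF A order_refl Ane] inv
    by (auto simp: wandering_embedding_def isometry_on_def clinear_on_def)
  show "wandering_data k n lam A (wand A) V"
    unfolding wandering_data_def
  proof (intro conjI ballI H)
    fix j assume j: "j \<in> {1..k} - A"
    then have ent: "entry j t" if "t \<in> {1..n j}" for t using that by (simp add: entry_def)
    \<comment> \<open>A row outside \<open>A\<close> has trivial \<open>wand {j}\<close> by the
      choice of \<open>A\<close>, so the defect argument applies on all of \<open>K\<close>.\<close>
    have "(\<Sum>s\<in>{1..n j}. V j s (Va j s x)) = x" if "x \<in> wand A" for x
    proof (rule wand_singleton_trivial[OF _ hilbert_K])
      show "K \<inter> wand {j} \<subseteq> {0}" using j by (auto simp: A_def)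
    qed (use j that wand_subset in \<open>auto simp: V_mem Va_mem\<close>)
    then show "cuntz (wand A) (n j) (V j)"
      using j ent op inv wand_subset by (auto simp: cuntz_def row_isometry_def adj_eq Va_V subset_iff)
  next
    show "doubly_commuting n lam ({1..k} - A) (wand A) V"
      using inv wand_subset by (auto simp: doubly_commuting_def adj_eq entry_def Va_V_comm subset_iff)
  qed
  show "irreducible_on (wand A) (cstar (wand A) (tuple_ops n ({1..k} - A) V))"
  proof (subst irreducible_on_cstar_iff[OF H])
    show "bounded_op (wand A) T" if "T \<in> tuple_ops n ({1..k} - A) V" for T
      using that op by (auto simp: tuple_ops_def entry_def)
    show "\<forall>M. reducing (wand A) (tuple_ops n ({1..k} - A) V) M \<longrightarrow> M = {0} \<or> M = wand A"
    proof (intro allI impI)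
      fix M assume M: "reducing (wand A) (tuple_ops n ({1..k} - A) V) M"
      then have hM: "hilbert_space M" "M \<subseteq> wand A" by (auto simp: reducing_def)
      have MK: "M \<subseteq> K" using hM wand_subset by blast
      have invM: "V j t x \<in> M \<and> Va j t x \<in> M" if "entry j t" "j \<notin> A" "x \<in> M" for j t x
      proof -
        have "V j t \<in> tuple_ops n ({1..k} - A) V" using that by (auto simp: tuple_ops_def entry_def)
        then show ?thesis using M that hM adj_eq[OF that(1,2), of x] by (force simp: reducing_def)
      qed
      show "M = {0} \<or> M = wand A"
      proof (cases "M \<subseteq> {0}")
        case True
        then show ?thesis using hilbert_space_zero[OF hM(1)] by blast
      next
        case False
        \<comment> \<open>A nonzero \<open>M\<close> already generates \<open>K\<close>. Its
          complement in \<open>wand A\<close> is killed by the adjoints of the rows in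
          \<open>A\<close> and orthogonal to \<open>M\<close>, hence zero.\<close>
        have "insert 0 (ocompl (wand A) M) \<subseteq> {0}"
        proof (rule orbit_eq_imp_orthogonal[OF A MK orbit_K[OF A hM(2) False invM]])
          show "insert 0 (ocompl (wand A) M) \<subseteq> K"
            using hilbert_space_zero[OF hilbert_K] by (auto simp: ocompl_def wand_def)
          show "Va i s y \<in> insert 0 (ocompl (wand A) M)"
            if "i \<in> A" "entry i s" "y \<in> insert 0 (ocompl (wand A) M)" for i s y
            using that by (auto simp: Va_zero ocompl_def wand_def entry_def)
          show "cinner z y = 0" if "y \<in> insert 0 (ocompl (wand A) M)" "z \<in> M" for y z
            using that by (auto simp: ocompl_def cinner_eq_0_commute[of z])
        qed
        then have "M = wand A" by (intro subspace_eqI[OF H hM]) auto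
        then show ?thesis by blast
      qed
    qed
  qed
qed

end

section \<open>Coordinates of the standard tuple\<close>

lemma cinner_tensor_left: "cinner (tensor \<alpha> x) f = cinner x (coord f \<alpha>)"
  unfolding cinner_ell2_def by (subst infsum_singleton_support[of \<alpha>]) auto

lemma cinner_tensor_right: "cinner f (tensor \<alpha> x) = cinner (coord f \<alpha>) x"
  unfolding cinner_ell2_def by (subst infsum_singleton_support[of \<alpha>]) auto

lemma tensor_add: "tensor \<alpha> (x + y) = tensor \<alpha> x + tensor \<alpha> y"
  by (rule ell2_eqI) simp

lemma tensor_scaleC: "tensor \<alpha> (c *\<^sub>C x) = c *\<^sub>C tensor \<alpha> x"
  by (rule ell2_eqI) simp

lemma isometry_on_tensor: "isometry_on L (tensor \<alpha>)"
  by (auto simp: isometry_on_def clinear_on_def tensor_add tensor_scaleC cinner_tensor_left)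

lemma coord_sum: "coord (sum f F) i = (\<Sum>a\<in>F. coord (f a) i)"
  by (induction F rule: infinite_finite_induct) simp_all

text \<open>The squared distance from a finite partial sum to \<open>f\<close> is the tail of the
  scalar series for \<open>(norm f)\<^sup>2\<close>, which converges unconditionally.\<close>

lemma has_sum_tensor: "((\<lambda>\<alpha>. tensor \<alpha> (coord f \<alpha>)) has_sum f) UNIV"
proof -
  let ?S = "\<lambda>F. \<Sum>\<alpha>\<in>F. tensor \<alpha> (coord f \<alpha>)"
  have norm_eq: "(norm (?S F - f))\<^sup>2 = (norm f)\<^sup>2 - (\<Sum>\<alpha>\<in>F. (norm (coord f \<alpha>))\<^sup>2)" if "finite F" for F
  proof -
    have c: "coord (?S F - f) i = (if i \<in> F then 0 else - coord f i)" for i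
      using that by (simp add: coord_sum)
    have "(norm f)\<^sup>2 = (\<Sum>\<^sub>\<infinity>i\<in>F \<union> - F. (norm (coord f i))\<^sup>2)"
      by (simp add: norm_ell2_square)
    also have "\<dots> = (\<Sum>\<alpha>\<in>F. (norm (coord f \<alpha>))\<^sup>2) + (\<Sum>\<^sub>\<infinity>i\<in>- F. (norm (coord f i))\<^sup>2)"
      using that by (subst infsum_Un_disjoint)
        (auto intro: summable_on_subset_banach[OF coord_summable])
    also have "(\<Sum>\<^sub>\<infinity>i\<in>- F. (norm (coord f i))\<^sup>2) = (\<Sum>\<^sub>\<infinity>i. (norm (coord (?S F - f) i))\<^sup>2)"
      by (rule infsum_cong_neutral) (simp_all add: c del: coord_minus)
    finally show ?thesis by (simp add: norm_ell2_square[of "?S F - f"])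
  qed
  have "((\<lambda>\<alpha>. (norm (coord f \<alpha>))\<^sup>2) has_sum (norm f)\<^sup>2) UNIV"
    by (simp add: norm_ell2_square coord_summable has_sum_infsum)
  then have "((\<lambda>F. \<Sum>\<alpha>\<in>F. (norm (coord f \<alpha>))\<^sup>2) \<longlongrightarrow> (norm f)\<^sup>2) (finite_subsets_at_top UNIV)"
    by (simp add: has_sum_def)
  from tendsto_diff[OF tendsto_const[of "(norm f)\<^sup>2"] this]
  have "((\<lambda>F. (norm f)\<^sup>2 - (\<Sum>\<alpha>\<in>F. (norm (coord f \<alpha>))\<^sup>2)) \<longlongrightarrow> 0) (finite_subsets_at_top UNIV)"
    by simp
  then have "((\<lambda>F. (norm (?S F - f))\<^sup>2) \<longlongrightarrow> 0) (finite_subsets_at_top UNIV)"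
    by (rule Lim_transform_eventually)
      (auto simp: norm_eq intro!: eventually_finite_subsets_at_top_weakI)
  from tendsto_real_sqrt[OF this]
  have "((\<lambda>F. norm (?S F - f)) \<longlongrightarrow> 0) (finite_subsets_at_top UNIV)" by simp
  then have "(?S \<longlongrightarrow> f) (finite_subsets_at_top UNIV)"
    by (simp add: tendsto_norm_zero_iff LIM_zero_iff)
  then show ?thesis by (simp add: has_sum_def)
qed

text \<open>Ensures that the infinite sums in \<open>standard_tuple\<close> converge, rather than
  take the default value 0, and computes them: the limit is the family \<open>g\<close> relabelled
  by \<pi>.\<close>

lemma coord_infsum_tensor:
  fixes g :: "'j \<Rightarrow> 'b::chilbert_space"
  assumes inj: "inj_on \<pi> S" and g: "(\<lambda>\<alpha>. (norm (g \<alpha>))\<^sup>2) summable_on S"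
  shows "coord (\<Sum>\<^sub>\<infinity>\<alpha>\<in>S. tensor (\<pi> \<alpha>) (g \<alpha>)) \<beta> =
    (if \<beta> \<in> \<pi> ` S then g (inv_into S \<pi> \<beta>) else 0)"
proof -
  define h where "h \<beta> = (if \<beta> \<in> \<pi> ` S then g (inv_into S \<pi> \<beta>) else 0)" for \<beta>
  have h: "h (\<pi> \<alpha>) = g \<alpha>" if "\<alpha> \<in> S" for \<alpha> using that inj by (simp add: h_def)
  have "(\<lambda>\<beta>. (norm (h \<beta>))\<^sup>2) summable_on \<pi> ` S"
    unfolding summable_on_reindex[OF inj] o_def
    using g by (rule summable_on_cong[THEN iffD1, rotated]) (simp add: h)
  then have "(\<lambda>\<beta>. (norm (h \<beta>))\<^sup>2) summable_on UNIV"
    by (rule summable_on_cong_neutral[THEN iffD1, rotated -1]) (auto simp: h_def)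
  then have coord: "coord (Abs_ell2 h) \<beta> = h \<beta>" for \<beta> by (simp add: Abs_ell2_inverse)
  have "((\<lambda>\<beta>. tensor \<beta> (h \<beta>)) has_sum Abs_ell2 h) UNIV"
    using has_sum_tensor[of "Abs_ell2 h"] by (simp add: coord)
  then have "((\<lambda>\<beta>. tensor \<beta> (h \<beta>)) has_sum Abs_ell2 h) (\<pi> ` S)"
    by (rule has_sum_cong_neutral[THEN iffD1, rotated -1]) (auto simp: h_def)
  then have "((\<lambda>\<alpha>. tensor (\<pi> \<alpha>) (h (\<pi> \<alpha>))) has_sum Abs_ell2 h) S"
    by (simp add: has_sum_reindex[OF inj] o_def)
  then have "((\<lambda>\<alpha>. tensor (\<pi> \<alpha>) (g \<alpha>)) has_sum Abs_ell2 h) S"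
    by (rule has_sum_cong[THEN iffD1, rotated]) (simp add: h)
  then show ?thesis by (simp add: infsumI coord h_def)
qed

lemma standard_space_subset:
  assumes L: "hilbert_space L" and M: "hilbert_space M"
    and tensor: "\<And>\<alpha> l. \<alpha> \<in> words n A \<Longrightarrow> l \<in> L \<Longrightarrow> tensor \<alpha> l \<in> M"
  shows "standard_space n A L \<subseteq> M"
proof
  fix f assume f: "f \<in> standard_space n A L"
  have "tensor \<alpha> (coord f \<alpha>) \<in> M" for \<alpha>
    using f tensor hilbert_space_zero[OF M] by (cases "\<alpha> \<in> words n A") (auto simp: standard_space_def)
  then have "\<forall>\<^sub>F F in finite_subsets_at_top UNIV. (\<Sum>\<alpha>\<in>F. tensor \<alpha> (coord f \<alpha>)) \<in> M"
    by (intro always_eventually allI hilbert_space_sum[OF M])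
  then show "f \<in> M"
    by (rule Lim_in_closed_set[OF hilbert_space_closed[OF M]])
      (use has_sum_tensor[of f] in \<open>simp_all add: has_sum_def\<close>)
qed

section \<open>Families of words and their phases\<close>

lemma words_push:
  "\<alpha> \<in> words n A \<Longrightarrow> i \<in> A \<Longrightarrow> s \<in> {1..n i} \<Longrightarrow> \<alpha>(i := s # \<alpha> i) \<in> words n A"
  by (auto simp: words_def PiE_iff extensional_def)

lemma words_pop: "\<beta> \<in> words n A \<Longrightarrow> i \<in> A \<Longrightarrow> \<beta> i = s # \<gamma> \<Longrightarrow> \<beta>(i := \<gamma>) \<in> words n A"
  by (fastforce simp: words_def PiE_iff extensional_def)

lemma words_lists: "\<alpha> \<in> words n A \<Longrightarrow> i \<in> A \<Longrightarrow> \<alpha> i \<in> lists {1..n i}"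
  by (auto simp: words_def)

lemma words_eqI: "\<alpha> \<in> words n A \<Longrightarrow> \<beta> \<in> words n A \<Longrightarrow> (\<And>i. i \<in> A \<Longrightarrow> \<alpha> i = \<beta> i) \<Longrightarrow> \<alpha> = \<beta>"
  unfolding words_def by (rule PiE_ext)

text \<open>The restriction makes the family \<open>undefined\<close> outside \<open>A\<close>, as
  membership in the extensional product \<open>words\<close> demands.\<close>

definition empty_words :: "nat set \<Rightarrow> nat \<Rightarrow> nat list" where
  "empty_words A = (\<lambda>i\<in>A. [])"

lemma empty_words [simp]: "empty_words A \<in> words n A" "i \<in> A \<Longrightarrow> empty_words A i = []"
  by (auto simp: empty_words_def words_def)

lemma word_phase_simps [simp]:
  "word_phase lam i j s [] = 1"
  "word_phase lam i j s (t # \<beta>) = lam i j s t * word_phase lam i j s \<beta>"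
  by (simp_all add: word_phase_def)

lemma standard_space_mem: "f \<in> standard_space n A L \<Longrightarrow> \<alpha> \<in> words n A \<Longrightarrow> coord f \<alpha> \<in> L"
  by (auto simp: standard_space_def)

lemma tensor_mem_standard:
  "hilbert_space L \<Longrightarrow> \<alpha> \<in> words n A \<Longrightarrow> l \<in> L \<Longrightarrow> tensor \<alpha> l \<in> standard_space n A L"
  by (auto simp: standard_space_def hilbert_space_zero)

context lambda_tuple
begin

lemma cmod_word_phase:
  "entry i s \<Longrightarrow> j \<in> {1..k} \<Longrightarrow> i \<noteq> j \<Longrightarrow> \<beta> \<in> lists {1..n j} \<Longrightarrow> cmod (word_phase lam i j s \<beta>) = 1"
  by (induction \<beta>) (auto simp: norm_mult lam_unit entry_def)

lemma cmod_phase_prod: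
  assumes A: "A \<subseteq> {1..k}" and i: "entry i s" and "B \<subseteq> A - {i}" and \<alpha>: "\<alpha> \<in> words n A"
  shows "cmod (\<Prod>j\<in>B. word_phase lam i j s (\<alpha> j)) = 1"
proof -
  have "cmod (word_phase lam i j s (\<alpha> j)) = 1" if "j \<in> B" for j
    using that assms by (intro cmod_word_phase words_lists[of \<alpha> n A]) auto
  then show ?thesis by (simp flip: prod_norm)
qed

text \<open>Rows in \<open>A\<close> shift coordinates with phases. The first fact records only a
  scalar and an index independent of \<open>f\<close>, which suffices for continuity; exact phases
  come from \<open>standard_tuple_tensor\<close>. The second, that a prefixed word is never empty,
  makes the vectors at \<open>empty_words A\<close> wandering.\<close>

lemma coord_standard_tuple_in:
  fixes W :: "nat \<Rightarrow> nat \<Rightarrow> 'b::chilbert_space \<Rightarrow> 'b"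
  assumes A: "A \<subseteq> {1..k}" and i: "i \<in> A" and s: "s \<in> {1..n i}"
  shows "\<exists>c \<gamma>. \<forall>f\<in>standard_space n A L. coord (standard_tuple n lam A W i s f) \<beta> = c *\<^sub>C coord f \<gamma>"
    and "\<beta> i = [] \<Longrightarrow> coord (standard_tuple n lam A W i s f) \<beta> = 0"
proof -
  define \<pi> where "\<pi> \<alpha> = \<alpha>(i := s # \<alpha> i)" for \<alpha> :: "nat \<Rightarrow> nat list"
  define c where "c \<alpha> = (\<Prod>j\<in>{j\<in>A. j < i}. word_phase lam i j s (\<alpha> j))" for \<alpha>
  have inj: "inj_on \<pi> (words n A)"
  proof (rule inj_onI)
    fix \<alpha> \<beta> assume eq: "\<pi> \<alpha> = \<pi> \<beta>"
    have "\<alpha> x = \<beta> x" for x using fun_cong[OF eq, of x] by (cases "x = i") (auto simp: \<pi>_def)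
    then show "\<alpha> = \<beta>" by blast
  qed
  have c: "cmod (c \<alpha>) = 1" if "\<alpha> \<in> words n A" for \<alpha>
    unfolding c_def using that by (intro cmod_phase_prod[OF A entryI[OF A i s]]) auto
  have "(\<lambda>\<alpha>. (norm (c \<alpha> *\<^sub>C coord f \<alpha>))\<^sup>2) summable_on words n A" for f :: "(nat \<Rightarrow> nat list, 'b) ell2"
    using summable_on_subset_banach[OF coord_summable[of f], of "words n A"]
    by (rule summable_on_cong[THEN iffD1, rotated]) (simp_all add: norm_scaleC c)
  from coord_infsum_tensor[OF inj this]
  have *: "coord (standard_tuple n lam A W i s f) \<beta> =
      (if \<beta> \<in> \<pi> ` words n A then c (inv_into (words n A) \<pi> \<beta>) *\<^sub>C coord f (inv_into (words n A) \<pi> \<beta>) else 0)"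
    for f \<beta>
    using i by (simp add: standard_tuple_def \<pi>_def c_def tensor_scaleC)
  show "\<exists>c \<gamma>. \<forall>f\<in>standard_space n A L. coord (standard_tuple n lam A W i s f) \<beta> = c *\<^sub>C coord f \<gamma>"
    unfolding * by (cases "\<beta> \<in> \<pi> ` words n A") (auto intro: exI[of _ "0::complex"])
  show "coord (standard_tuple n lam A W i s f) \<beta> = 0" if "\<beta> i = []"
    using that by (auto simp: * \<pi>_def)
qed

text \<open>Coordinates of \<open>f\<close> must lie in \<open>L\<close> because
  \<open>W i s\<close> is bounded only there; that bound makes the defining sum square
  summable.\<close>

lemma coord_standard_tuple_out:
  assumes A: "A \<subseteq> {1..k}" and i: "entry i s" "i \<notin> A" and W: "bounded_op L (W i s)"
    and f: "f \<in> standard_space n A L"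
  shows "coord (standard_tuple n lam A W i s f) \<beta> =
    (if \<beta> \<in> words n A then (\<Prod>j\<in>A. word_phase lam i j s (\<beta> j)) *\<^sub>C W i s (coord f \<beta>) else 0)"
proof -
  define c where "c \<alpha> = (\<Prod>j\<in>A. word_phase lam i j s (\<alpha> j))" for \<alpha>
  have c: "cmod (c \<alpha>) = 1" if "\<alpha> \<in> words n A" for \<alpha>
    unfolding c_def using that i by (intro cmod_phase_prod[OF A i(1)]) auto
  obtain b where b: "\<And>x. x \<in> L \<Longrightarrow> norm (W i s x) \<le> b * norm x"
    using W by (auto simp: bounded_op_def)
  have "(\<lambda>\<alpha>. (norm (c \<alpha> *\<^sub>C W i s (coord f \<alpha>)))\<^sup>2) summable_on words n A"
  proof (rule summable_on_comparison_test)
    show "(\<lambda>\<alpha>. b\<^sup>2 * (norm (coord f \<alpha>))\<^sup>2) summable_on words n A"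
      by (intro summable_on_cmult_right summable_on_subset_banach[OF coord_summable[of f]]) simp
    show "(norm (c \<alpha> *\<^sub>C W i s (coord f \<alpha>)))\<^sup>2 \<le> b\<^sup>2 * (norm (coord f \<alpha>))\<^sup>2" if "\<alpha> \<in> words n A" for \<alpha>
      using power_mono[OF b[OF standard_space_mem[OF f that]], of 2] that
      by (simp add: norm_scaleC c power_mult_distrib)
  qed simp
  from coord_infsum_tensor[OF inj_on_id this, unfolded id_def]
  show ?thesis
    using i f_inv_into_f[of \<beta> "\<lambda>x. x" "words n A"]
    by (auto simp: standard_tuple_def c_def tensor_scaleC)
qed

text \<open>The embedding is the inverse of the unitary applied to tensors at the empty words, where
  all phases are empty products.\<close>

lemma unitary_imp_embedding:
  assumes A: "A \<subseteq> {1..k}" and data: "wandering_data k n lam A L W"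
    and equiv: "unitarily_equivalent n {1..k} K V (standard_space n A L) (standard_tuple n lam A W)"
  shows "\<exists>e. wandering_embedding A L W e"
proof -
  obtain U where iso: "isometry_on K U" and range: "U ` K = standard_space n A L"
    and UV: "\<And>i s x. entry i s \<Longrightarrow> x \<in> K \<Longrightarrow> U (V i s x) = standard_tuple n lam A W i s (U x)"
    using equiv by (auto simp: unitarily_equivalent_def unitary_between_iff entry_def)
  define R where "R = inv_into K U"
  define e where "e l = R (tensor (empty_words A) l)" for l
  have L: "hilbert_space L" using data by (simp add: wandering_data_def)
  have W: "bounded_op L (W j t)" if "entry j t" "j \<notin> A" for j t
    using data that by (auto simp: wandering_data_def cuntz_def row_isometry_def entry_def)
  have R: "isometry_on (standard_space n A L) R"
    using isometry_on_inv[OF iso hilbert_K] by (simp add: R_def range)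
  have RK: "R f \<in> K" and UR: "U (R f) = f" if "f \<in> standard_space n A L" for f
    using that inv_into_into[of f U K] f_inv_into_f[of f U K] by (auto simp: range R_def)
  have RU: "R (U x) = x" if "x \<in> K" for x
    using that inv_into_f_f[OF isometry_on_inj[OF iso hilbert_K]] by (simp add: R_def)
  have t0: "tensor (empty_words A) l \<in> standard_space n A L" if "l \<in> L" for l
    using that by (intro tensor_mem_standard[OF L]) auto
  have eK: "e l \<in> K" and Ue: "U (e l) = tensor (empty_words A) l" if "l \<in> L" for l
    using t0[OF that] RK UR by (auto simp: e_def)
  have e: "isometry_on L e"
    unfolding e_def by (rule isometry_on_comp[OF isometry_on_tensor R]) (use t0 in auto)
  have "e l \<in> wand A" if l: "l \<in> L" for l
  proof -
    have "Va i s (e l) = 0" if i_s: "i \<in> A" "s \<in> {1..n i}" for i s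
    proof (rule cinner_eqI[OF hilbert_K])
      note i = entryI[OF A i_s]
      fix z assume z: "z \<in> K"
      have "cinner z (Va i s (e l)) = cinner (V i s z) (e l)" by (rule cinner_Va_right[OF i z])
      also have "\<dots> = cinner (U (V i s z)) (U (e l))"
        using z i l eK by (simp add: isometry_on_cinner[OF iso] V_mem)
      also have "\<dots> = 0"
        using i_s by (simp add: UV[OF i z] Ue[OF l] cinner_tensor_right coord_standard_tuple_in(2)[OF A i_s])
      finally show "cinner z (Va i s (e l)) = cinner z 0" by simp
    qed (simp_all add: Va_mem entryI[OF A i_s] hilbert_space_zero[OF hilbert_K])
    then show ?thesis using eK[OF l] by (simp add: wand_def)
  qed
  moreover have "V j t (e l) = e (W j t l)" if j: "entry j t" "j \<notin> A" and l: "l \<in> L" for j t l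
  proof -
    have "U (V j t (e l)) = tensor (empty_words A) (W j t l)"
      using clinear_on_zero[OF bounded_clinear_onD[OF bounded_op_bounded_clinear[OF W[OF j]]]
          hilbert_space_zero[OF L]] j
      by (simp add: UV eK l Ue standard_tuple_tensor)
    then show ?thesis using RU[of "V j t (e l)"] l by (simp add: e_def[of "W j t l"] V_mem j eK)
  qed
  moreover have "orbit A (e ` L) = K"
  proof
    have EK: "e ` L \<subseteq> K" using eK by auto
    note orb = hilbert_orbit[OF A EK] orbit_subset[OF A EK]
    show "orbit A (e ` L) \<subseteq> K" by (rule orb)
    \<comment> \<open>Induction on total word length puts all elementary tensors into
      \<open>N\<close>; these are total, so \<open>N\<close> is the whole model.\<close>
    define N where "N = {f\<in>standard_space n A L. R f \<in> orbit A (e ` L)}"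
    have hN: "hilbert_space N"
      unfolding N_def by (intro hilbert_space_vimage isometry_on_bounded R hilbert_space_standard_space L orb)
    have "tensor \<alpha> l \<in> N" if "\<alpha> \<in> words n A" and l: "l \<in> L" for \<alpha> l
      using that(1)
    proof (induction "\<Sum>i\<in>A. length (\<alpha> i)" arbitrary: \<alpha> rule: less_induct)
      case less
      have std: "tensor \<alpha> l \<in> standard_space n A L" using L l less.prems by (intro tensor_mem_standard)
      show ?case
      proof (cases "\<forall>i\<in>A. \<alpha> i = []")
        case True
        then have "\<alpha> = empty_words A" using less.prems by (intro words_eqI) auto
        then show ?thesis using l orbit_base[OF A EK] std by (auto simp: N_def e_def)
      next
        case False
        then obtain i s \<gamma> where i: "i \<in> A" "\<alpha> i = s # \<gamma>" by (metis neq_Nil_conv)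
        then have s: "s \<in> {1..n i}" using words_lists[OF less.prems i(1)] by auto
        define \<beta> where "\<beta> = \<alpha>(i := \<gamma>)"
        have \<beta>: "\<beta> \<in> words n A" and \<alpha>: "\<alpha> = \<beta>(i := s # \<beta> i)"
          using words_pop[OF less.prems i] i by (auto simp: \<beta>_def)
        have "(\<Sum>i\<in>A. length (\<beta> i)) < (\<Sum>i\<in>A. length (\<alpha> i))"
          using finite_subset[OF A] i by (intro sum_strict_mono_ex1) (auto simp: \<beta>_def)
        then have bN: "tensor \<beta> l \<in> N" using less.hyps \<beta> by blast
        define c where "c = (\<Prod>j\<in>{j\<in>A. j < i}. word_phase lam i j s (\<beta> j))"
        \<comment> \<open>A unimodular phase can be divided out, so the tensor lies in
          \<open>N\<close> once its multiple by \<open>c\<close> does.\<close>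
        have "cmod c = 1"
          unfolding c_def by (intro cmod_phase_prod[OF A entryI[OF A i(1) s] _ \<beta>]) auto
        then have c: "c \<noteq> 0" by auto
        have "V i s (R (tensor \<beta> l)) \<in> orbit A (e ` L)"
          using bN by (intro orbit_step[OF A EK i(1) s]) (simp add: N_def)
        moreover have "V i s (R (tensor \<beta> l)) = R (c *\<^sub>C tensor \<alpha> l)"
        proof -
          have b: "tensor \<beta> l \<in> standard_space n A L" using bN by (simp add: N_def)
          have "U (V i s (R (tensor \<beta> l))) = c *\<^sub>C tensor \<alpha> l"
            using i(1) standard_tuple_tensor[OF \<beta>, of i W s lam l] b
            unfolding \<alpha>[symmetric] c_def by (simp add: UV entryI[OF A i(1) s] RK UR)
          then show ?thesis using RU[of "V i s (R (tensor \<beta> l))"] b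
            by (simp add: V_mem entryI[OF A i(1) s] RK)
        qed
        ultimately have "c *\<^sub>C tensor \<alpha> l \<in> N"
          using std by (simp add: N_def hilbert_space_scaleC hilbert_space_standard_space L)
        then show ?thesis using hilbert_space_scaleC_iff[OF hN c] by simp
      qed
    qed
    then have "standard_space n A L \<subseteq> N" by (rule standard_space_subset[OF L hN])
    then show "K \<subseteq> orbit A (e ` L)" using range RU by (force simp: N_def)
  qed
  ultimately show ?thesis using e by (auto simp: wandering_embedding_def)
qed

end

section \<open>Words in a tuple\<close>

context lambda_tuple
begin

fun word_op :: "nat \<Rightarrow> nat list \<Rightarrow> 'a \<Rightarrow> 'a" where
  "word_op i [] x = x"
| "word_op i (s # \<beta>) x = V i s (word_op i \<beta> x)"

text \<open>The first row in the list acts outermost. For an increasing list an operator of row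
  \<open>i\<close> therefore crosses exactly the rows \<open>j < i\<close>, as in the definition of
  the standard tuple.\<close>

fun words_op :: "nat list \<Rightarrow> (nat \<Rightarrow> nat list) \<Rightarrow> 'a \<Rightarrow> 'a" where
  "words_op [] \<alpha> x = x"
| "words_op (i # js) \<alpha> x = word_op i (\<alpha> i) (words_op js \<alpha> x)"

definition is_word :: "nat \<Rightarrow> nat list \<Rightarrow> bool" where
  "is_word i \<beta> \<longleftrightarrow> i \<in> {1..k} \<and> \<beta> \<in> lists {1..n i}"

lemma is_word_Cons: "is_word i (s # \<beta>) \<longleftrightarrow> entry i s \<and> is_word i \<beta>"
  by (auto simp: is_word_def entry_def)

lemma word_op_bounded: "is_word i \<beta> \<Longrightarrow> bounded_op K (word_op i \<beta>)"
proof (induction \<beta>)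
  case Nil
  then show ?case by (simp add: bounded_op_iff bounded_clinear_on_id)
next
  case (Cons s \<beta>)
  then have "bounded_op K (word_op i \<beta>)" "entry i s" by (auto simp: is_word_Cons)
  then show ?case
    using bounded_clinear_on_comp[OF V_bdd[of i s], of K "word_op i \<beta>"] V_mem[of i s]
    by (auto simp: bounded_op_iff image_subset_iff)
qed

lemma words_op_bounded: "\<forall>i\<in>set js. is_word i (\<alpha> i) \<Longrightarrow> bounded_op K (words_op js \<alpha>)"
proof (induction js)
  case Nil
  then show ?case by (simp add: bounded_op_iff bounded_clinear_on_id)
next
  case (Cons i js)
  then have "bounded_op K (words_op js \<alpha>)" "bounded_op K (word_op i (\<alpha> i))"
    by (auto simp: word_op_bounded)
  then show ?case
    using bounded_clinear_on_comp[of K "word_op i (\<alpha> i)" K "words_op js \<alpha>"]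
    by (auto simp: bounded_op_iff image_subset_iff)
qed

lemmas word_op_mem = bounded_op_mem[OF word_op_bounded]
lemmas words_op_mem = bounded_op_mem[OF words_op_bounded]
lemmas word_op_scaleC = clinear_on_scaleC[OF bounded_clinear_onD[OF bounded_op_bounded_clinear[OF word_op_bounded]]]

lemma V_word_op:
  assumes i: "entry i s" and ij: "i \<noteq> j" and x: "x \<in> K"
  shows "is_word j \<beta> \<Longrightarrow> V i s (word_op j \<beta> x) = word_phase lam i j s \<beta> *\<^sub>C word_op j \<beta> (V i s x)"
proof (induction \<beta>)
  case (Cons t \<beta>)
  then have t: "entry j t" and \<beta>: "is_word j \<beta>" by (auto simp: is_word_Cons)
  have "V i s (word_op j (t # \<beta>) x) = lam i j s t *\<^sub>C V j t (V i s (word_op j \<beta> x))"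
    using V_comm[OF i t ij] word_op_mem[OF \<beta> x] by simp
  also have "\<dots> = lam i j s t *\<^sub>C word_phase lam i j s \<beta> *\<^sub>C V j t (word_op j \<beta> (V i s x))"
    using Cons.IH[OF \<beta>] V_scaleC[OF t word_op_mem[OF \<beta> V_mem[OF i x]]] by simp
  finally show ?case by (simp add: scaleC_scaleC)
qed simp

lemma Va_word_op_zero:
  assumes i: "entry i s" and ij: "i \<noteq> j" and x: "x \<in> K" "Va i s x = 0"
  shows "is_word j \<beta> \<Longrightarrow> Va i s (word_op j \<beta> x) = 0"
proof (induction \<beta>)
  case (Cons t \<beta>)
  then have "entry j t" and \<beta>: "is_word j \<beta>" by (auto simp: is_word_Cons)
  then show ?case
    using Cons.IH Va_V_comm[OF i _ ij word_op_mem[OF \<beta> x(1)], of t] by (simp add: V_zero)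
qed (use x in simp)

lemma Va_words_op_zero:
  assumes i: "entry i s" and x: "x \<in> K" "Va i s x = 0"
  shows "i \<notin> set js \<Longrightarrow> \<forall>j\<in>set js. is_word j (\<alpha> j) \<Longrightarrow> Va i s (words_op js \<alpha> x) = 0"
proof (induction js)
  case (Cons j js)
  then show ?case using Va_word_op_zero[OF i _ words_op_mem[OF _ x(1)]] by auto
qed (use x in simp)

lemma words_op_cong: "(\<And>i. i \<in> set js \<Longrightarrow> \<alpha> i = \<beta> i) \<Longrightarrow> words_op js \<alpha> x = words_op js \<beta> x"
  by (induction js) auto

lemma V_words_op_out:
  assumes i: "entry i s" and x: "x \<in> K"
  shows "i \<notin> set js \<Longrightarrow> distinct js \<Longrightarrow> \<forall>j\<in>set js. is_word j (\<alpha> j) \<Longrightarrow>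
    V i s (words_op js \<alpha> x) = (\<Prod>j\<in>set js. word_phase lam i j s (\<alpha> j)) *\<^sub>C words_op js \<alpha> (V i s x)"
proof (induction js)
  case (Cons j js)
  then have j: "is_word j (\<alpha> j)" "i \<noteq> j" and js: "\<forall>j\<in>set js. is_word j (\<alpha> j)" by auto
  have "V i s (words_op (j # js) \<alpha> x)
      = word_phase lam i j s (\<alpha> j) *\<^sub>C word_op j (\<alpha> j) (V i s (words_op js \<alpha> x))"
    using V_word_op[OF i j(2) words_op_mem[OF js x] j(1)] by simp
  also have "V i s (words_op js \<alpha> x)
      = (\<Prod>j\<in>set js. word_phase lam i j s (\<alpha> j)) *\<^sub>C words_op js \<alpha> (V i s x)"
    using Cons by simp
  finally show ?case
    using Cons.prems by (simp add: word_op_scaleC[OF j(1) words_op_mem[OF js V_mem[OF i x]]] scaleC_scaleC)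
qed simp

text \<open>\<open>V i s\<close> moves inward past the rows listed before \<open>i\<close>,
  collecting their phases, and stops at row \<open>i\<close>, where it becomes a new first letter.
  Sortedness turns "listed before" into \<open>j < i\<close>.\<close>

lemma V_words_op_in:
  assumes i: "entry i s" and x: "x \<in> K"
  shows "i \<in> set js \<Longrightarrow> sorted_wrt (<) js \<Longrightarrow> \<forall>j\<in>set js. is_word j (\<alpha> j) \<Longrightarrow>
    V i s (words_op js \<alpha> x) =
      (\<Prod>j\<in>{j\<in>set js. j < i}. word_phase lam i j s (\<alpha> j)) *\<^sub>C words_op js (\<alpha>(i := s # \<alpha> i)) x"
proof (induction js)
  case (Cons j js)
  then have j: "is_word j (\<alpha> j)" and js: "\<forall>j\<in>set js. is_word j (\<alpha> j)" by auto
  let ?\<alpha> = "\<alpha>(i := s # \<alpha> i)"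
  show ?case
  proof (cases "i = j")
    case True
    then have "{j'\<in>set (j # js). j' < i} = {}" using Cons.prems(2) by auto
    moreover have "words_op js ?\<alpha> x = words_op js \<alpha> x"
      using Cons.prems(2) True by (intro words_op_cong) auto
    then have "words_op (j # js) ?\<alpha> x = V i s (words_op (j # js) \<alpha> x)"
      using True by (simp del: fun_upd_apply add: fun_upd_same)
    ultimately show ?thesis by (simp only: prod.empty scaleC_one)
  next
    case False
    then have i_js: "i \<in> set js" and ji: "j < i" using Cons.prems by auto
    have js': "\<forall>j\<in>set js. is_word j (?\<alpha> j)" using js i by (auto simp: is_word_Cons)
    have "V i s (words_op (j # js) \<alpha> x)
        = word_phase lam i j s (\<alpha> j) *\<^sub>C word_op j (\<alpha> j) (V i s (words_op js \<alpha> x))"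
      using V_word_op[OF i False words_op_mem[OF js x] j] by simp
    also have "V i s (words_op js \<alpha> x)
        = (\<Prod>j\<in>{j\<in>set js. j < i}. word_phase lam i j s (\<alpha> j)) *\<^sub>C words_op js ?\<alpha> x"
      using Cons i_js by (simp add: fun_upd_def)
    also have "{j'\<in>set (j # js). j' < i} = insert j {j\<in>set js. j < i}" using ji by auto
    moreover have "j \<notin> set js" using Cons.prems(2) by auto
    ultimately show ?thesis
      using False by (simp add: word_op_scaleC[OF j words_op_mem[OF js' x]] scaleC_scaleC)
  qed
qed simp

text \<open>Leading letters are compared: equal ones cancel, distinct ones give 0, and if one word
  ends first an adjoint hits a vector that it kills.\<close>

lemma cinner_word_op:
  assumes x: "x \<in> K" "\<And>s. entry i s \<Longrightarrow> Va i s x = 0" and y: "y \<in> K" "\<And>s. entry i s \<Longrightarrow> Va i s y = 0"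
  shows "is_word i \<beta> \<Longrightarrow> is_word i \<gamma> \<Longrightarrow>
    cinner (word_op i \<beta> x) (word_op i \<gamma> y) = (if \<beta> = \<gamma> then cinner x y else 0)"
proof (induction \<beta> arbitrary: \<gamma>)
  case Nil
  then show ?case
  proof (cases \<gamma>)
    case (Cons t \<delta>)
    then have "entry i t" "is_word i \<delta>" using Nil by (auto simp: is_word_Cons)
    then show ?thesis using Cons cinner_Va_left[of i t "word_op i \<delta> y" x] x(2) y(1) by (simp add: word_op_mem)
  qed simp
next
  case (Cons s \<beta>)
  then have s: "entry i s" and \<beta>: "is_word i \<beta>" by (auto simp: is_word_Cons)
  note w = word_op_mem[OF \<beta> x(1)]
  show ?case
  proof (cases \<gamma>)
    case Nil
    then show ?thesis using cinner_Va_right[OF s w, of y] y(2)[OF s] by simp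
  next
    case (Cons t \<delta>)
    then have t: "entry i t" and \<delta>: "is_word i \<delta>" using Cons.prems by (auto simp: is_word_Cons)
    have "cinner (V i s (word_op i \<beta> x)) (V i t (word_op i \<delta> y))
        = cinner (word_op i \<beta> x) (if s = t then word_op i \<delta> y else 0)"
      using Va_V[OF s t word_op_mem[OF \<delta> y(1)]] by (simp flip: cinner_Va_right[OF s w])
    then show ?thesis using Cons Cons.IH[OF \<beta> \<delta>] by (cases "\<beta> = \<delta>") simp_all
  qed
qed

text \<open>Rows are peeled off one at a time. Since \<open>js\<close> does not contain
  \<open>j\<close>, the adjoints of row \<open>j\<close> pass through the inner operators and kill
  the wandering vector, so \<open>cinner_word_op\<close> applies.\<close>

lemma cinner_words_op:
  assumes A: "A \<subseteq> {1..k}" and x: "x \<in> wand A" and y: "y \<in> wand A"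
  shows "distinct js \<Longrightarrow> set js \<subseteq> A \<Longrightarrow> \<forall>i\<in>set js. is_word i (\<alpha> i) \<and> is_word i (\<beta> i) \<Longrightarrow>
    cinner (words_op js \<alpha> x) (words_op js \<beta> y) = (if \<forall>i\<in>set js. \<alpha> i = \<beta> i then cinner x y else 0)"
proof (induction js)
  case (Cons j js)
  then have js: "\<forall>i\<in>set js. is_word i (\<alpha> i)" "\<forall>i\<in>set js. is_word i (\<beta> i)" by auto
  have K: "x \<in> K" "y \<in> K" using x y wand_subset by auto
  have "Va j s (words_op js \<gamma> z) = 0"
    if "entry j s" "z \<in> wand A" "\<forall>i\<in>set js. is_word i (\<gamma> i)" for s \<gamma> z
    using that Cons.prems(1,2) by (intro Va_words_op_zero) (auto simp: wand_def entry_def)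
  then have "cinner (words_op (j # js) \<alpha> x) (words_op (j # js) \<beta> y) =
      (if \<alpha> j = \<beta> j then cinner (words_op js \<alpha> x) (words_op js \<beta> y) else 0)"
    using Cons.prems(3) x y
    by (simp add: cinner_word_op words_op_mem[OF js(1) K(1)] words_op_mem[OF js(2) K(2)] js)
  then show ?case using Cons by simp
qed simp

text \<open>The unitary is built from \<open>K\<close> to the model by taking coefficients against
  the translates \<open>T \<alpha> l\<close>. It is then defined on all of \<open>K\<close> at once,
  with no extension from a dense span.\<close>

lemma embedding_imp_unitary:
  fixes L :: "'b::chilbert_space set"
  assumes A: "A \<subseteq> {1..k}" and data: "wandering_data k n lam A L W"
    and emb: "wandering_embedding A L W e"
  shows "unitarily_equivalent n {1..k} K V (standard_space n A L) (standard_tuple n lam A W)"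
proof -
  define js where "js = sorted_list_of_set A"
  have "finite A" using A finite_subset by blast
  then have js: "set js = A" "sorted_wrt (<) js" "distinct js"
    by (simp_all add: js_def)
  note L = hilbert_L[OF A data emb] and W = W_op[OF A data emb]
    and eK = embedding_subset[OF A data emb] and eV = embedding_V[OF A data emb]
    and e = embedding_isometry[OF A data emb] and orb = embedding_orbit[OF A data emb]
  define T where "T \<alpha> l = words_op js \<alpha> (e l)" for \<alpha> l
  have word: "\<forall>i\<in>set js. is_word i (\<alpha> i)" if "\<alpha> \<in> words n A" for \<alpha>
    using that A words_lists[OF that] by (auto simp: is_word_def js)
  have e_mem: "e l \<in> wand A" "e l \<in> K" if "l \<in> L" for l
    using emb that eK by (auto simp: wandering_embedding_def)
  have T_mem: "T \<alpha> l \<in> K" if "\<alpha> \<in> words n A" "l \<in> L" for \<alpha> l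
    using that by (auto simp: T_def intro!: words_op_mem word e_mem)
  have T_bdd: "bounded_clinear_on L (T \<alpha>)" if "\<alpha> \<in> words n A" for \<alpha>
    unfolding T_def
    by (rule bounded_clinear_on_comp[OF bounded_op_bounded_clinear[OF words_op_bounded[OF word[OF that]]]
          isometry_on_bounded[OF e] eK])
  have T_gram: "cinner (T \<alpha> l) (T \<beta> m) = (if \<alpha> = \<beta> then cinner l m else 0)"
    if "\<alpha> \<in> words n A" "\<beta> \<in> words n A" "l \<in> L" "m \<in> L" for \<alpha> \<beta> l m
  proof -
    have "(\<forall>i\<in>A. \<alpha> i = \<beta> i) \<longleftrightarrow> \<alpha> = \<beta>" using words_eqI[OF that(1,2)] by blast
    then show ?thesis
      using cinner_words_op[OF A e_mem(1)[OF that(3)] e_mem(1)[OF that(4)] js(3), of \<alpha> \<beta>]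
        word that isometry_on_cinner[OF e that(3,4)] by (simp add: T_def js)
  qed
  have T_in: "V i s (T \<alpha> l) =
      (\<Prod>j\<in>{j\<in>A. j < i}. word_phase lam i j s (\<alpha> j)) *\<^sub>C T (\<alpha>(i := s # \<alpha> i)) l"
    if "i \<in> A" "s \<in> {1..n i}" "\<alpha> \<in> words n A" "l \<in> L" for i s \<alpha> l
    using V_words_op_in[OF entryI[OF A that(1,2)] e_mem(2)[OF that(4)] _ js(2) word[OF that(3)]] that(1)
    by (simp add: T_def js)
  have T_out: "V i s (T \<alpha> l) = (\<Prod>j\<in>A. word_phase lam i j s (\<alpha> j)) *\<^sub>C T \<alpha> (W i s l)"
    if "entry i s" "i \<notin> A" "\<alpha> \<in> words n A" "l \<in> L" for i s \<alpha> l
    using V_words_op_out[OF that(1) e_mem(2)[OF that(4)] _ js(3) word[OF that(3)]] that eV[of i s l]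
    by (simp add: T_def js)
  have total: "P x" if P: "hilbert_space {x\<in>K. P x}" and PT: "\<And>\<alpha> l. \<alpha> \<in> words n A \<Longrightarrow> l \<in> L \<Longrightarrow> P (T \<alpha> l)"
    and x: "x \<in> K" for P x
  proof -
    \<comment> \<open>The least closed subspace containing all translates is invariant under the
      rows in \<open>A\<close> by \<open>T_in\<close>, so it contains the orbit, which is
      \<open>K\<close>.\<close>
    define \<M> where "\<M> = {M. hilbert_space M \<and> M \<subseteq> K \<and> (\<forall>\<alpha>\<in>words n A. \<forall>l\<in>L. T \<alpha> l \<in> M)}"
    have KM: "K \<in> \<M>" using hilbert_K T_mem by (auto simp: \<M>_def)
    have hN: "hilbert_space (\<Inter>\<M>)" by (rule hilbert_space_Inter) (auto simp: \<M>_def)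
    have TN: "T \<alpha> l \<in> \<Inter>\<M>" if "\<alpha> \<in> words n A" "l \<in> L" for \<alpha> l using that by (auto simp: \<M>_def)
    have NK: "\<Inter>\<M> \<subseteq> K" using KM by blast
    have "V i s x \<in> \<Inter>\<M>" if i: "i \<in> A" "s \<in> {1..n i}" and x: "x \<in> \<Inter>\<M>" for i s x
    proof -
      have "{x\<in>\<Inter>\<M>. V i s x \<in> \<Inter>\<M>} \<in> \<M>"
      proof -
        have "hilbert_space {x\<in>\<Inter>\<M>. V i s x \<in> \<Inter>\<M>}"
          by (rule hilbert_space_vimage[OF bounded_clinear_on_subset[OF V_bdd[OF entryI[OF A i]] NK] hN hN])
        moreover have "V i s (T \<alpha> l) \<in> \<Inter>\<M>" if "\<alpha> \<in> words n A" "l \<in> L" for \<alpha> l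
          unfolding T_in[OF i that]
          by (intro hilbert_space_scaleC[OF hN] TN words_push that i)
        ultimately show ?thesis using TN NK unfolding \<M>_def by blast
      qed
      then show ?thesis using x by blast
    qed
    moreover have "e l \<in> \<Inter>\<M>" if l: "l \<in> L" for l
    proof -
      have "words_op is (empty_words A) x = x" if "set is \<subseteq> A" for "is" x
        using that by (induction "is") auto
      then show ?thesis using TN[OF empty_words(1) l] js by (simp add: T_def)
    qed
    ultimately have "orbit A (e ` L) \<subseteq> \<Inter>\<M>"
      using hN NK unfolding orbit_def by (intro Inter_lower) blast
    moreover have "{x\<in>K. P x} \<in> \<M>" using P PT T_mem by (auto simp: \<M>_def)
    ultimately show ?thesis using x orb by blast
  qed
  \<comment> \<open>The vector found here, later \<open>C \<alpha> x\<close>, is the adjoint of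
    \<open>T \<alpha>\<close>, a map from \<open>L\<close> to \<open>K\<close>, applied to
    \<open>x\<close>.\<close>
  have "\<exists>l\<in>L. \<forall>m\<in>L. cinner (T \<alpha> m) x = cinner m l" if "\<alpha> \<in> words n A" for \<alpha> x
    by (rule riesz_representation[OF L bounded_clinear_on_comp[OF bounded_clinear_on_cinner[of UNIV] T_bdd[OF that]]]) simp
  then obtain C where C_mem: "\<And>\<alpha> x. \<alpha> \<in> words n A \<Longrightarrow> C \<alpha> x \<in> L"
    and C: "\<And>\<alpha> x m. \<alpha> \<in> words n A \<Longrightarrow> m \<in> L \<Longrightarrow> cinner (T \<alpha> m) x = cinner m (C \<alpha> x)"
    by metis
  have C_eqI: "C \<alpha> x = l" if "\<alpha> \<in> words n A" "l \<in> L" "\<And>m. m \<in> L \<Longrightarrow> cinner (T \<alpha> m) x = cinner m l" for \<alpha> x l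
    using that by (intro cinner_eqI[OF L C_mem]) (simp_all flip: C)
  define c where "c x \<alpha> = (if \<alpha> \<in> words n A then C \<alpha> x else 0)" for x \<alpha>
  have bessel: "(\<Sum>\<alpha>\<in>F. (norm (c x \<alpha>))\<^sup>2) \<le> (norm x)\<^sup>2" if F: "finite F" for F x
  proof -
    let ?F = "F \<inter> words n A"
    \<comment> \<open>A finite partial expansion of \<open>x\<close>. The Gram relation makes its
      inner products with \<open>x\<close> and with itself both equal to \<open>S\<close>, and
      positivity of \<open>inner (x - y) (x - y)\<close> gives the Bessel bound.\<close>
    define y where "y = (\<Sum>\<alpha>\<in>?F. T \<alpha> (C \<alpha> x))"
    define S where "S = (\<Sum>\<alpha>\<in>?F. (norm (C \<alpha> x))\<^sup>2)"
    have S: "(\<Sum>\<alpha>\<in>F. (norm (c x \<alpha>))\<^sup>2) = S"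
      unfolding S_def using F by (intro sum.mono_neutral_cong_right) (auto simp: c_def)
    have "cinner y x = complex_of_real S"
      by (simp add: y_def S_def cinner_sum_left C C_mem cinner_self)
    then have yx: "inner y x = S" using Re_cinner[of y x] by simp
    have "cinner y y = (\<Sum>\<alpha>\<in>?F. \<Sum>\<beta>\<in>?F. cinner (T \<beta> (C \<beta> x)) (T \<alpha> (C \<alpha> x)))"
      by (simp add: y_def cinner_sum_left cinner_sum_right)
    also have "\<dots> = (\<Sum>\<alpha>\<in>?F. \<Sum>\<beta>\<in>?F. if \<alpha> = \<beta> then cinner (C \<alpha> x) (C \<alpha> x) else 0)"
      by (intro sum.cong refl) (auto simp: T_gram C_mem)
    also have "\<dots> = complex_of_real S"
      using F by (simp add: S_def cinner_self)
    finally have yy: "inner y y = S" using Re_cinner[of y y] by simp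
    have "0 \<le> inner (x - y) (x - y)" by simp
    also have "\<dots> = inner x x - S" using yx yy by (simp add: inner_diff inner_commute)
    finally have "S \<le> (norm x)\<^sup>2" by (simp add: power2_norm_eq_inner)
    then show ?thesis by (simp only: S)
  qed
  have summ: "(\<lambda>\<alpha>. (norm (c x \<alpha>))\<^sup>2) summable_on UNIV" for x
    using bessel[of _ x] by (intro nonneg_bdd_above_summable_on) (auto intro!: bdd_aboveI)
  define U where "U x = Abs_ell2 (c x)" for x
  have cU: "coord (U x) \<alpha> = c x \<alpha>" for x \<alpha> by (simp add: U_def Abs_ell2_inverse summ)
  have U_std: "U x \<in> standard_space n A L" for x
    by (simp add: standard_space_def cU c_def C_mem)
  have "norm (U x) \<le> norm x" for x
  proof -
    have "(norm (U x))\<^sup>2 \<le> (norm x)\<^sup>2"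
      unfolding norm_ell2_square cU by (rule infsum_le_finite_sums[OF summ bessel])
    then show ?thesis by (simp add: power2_le_iff_abs_le)
  qed
  moreover have "clinear_on K U"
    unfolding clinear_on_def
    by (intro conjI ballI allI ell2_eqI)
      (auto simp: cU c_def C C_mem cinner_add_right cinner_scaleC_right
        intro!: C_eqI hilbert_space_add[OF L] hilbert_space_scaleC[OF L])
  ultimately have U_bdd: "bounded_clinear_on K U"
    by (auto simp: bounded_clinear_on_def intro!: exI[of _ 1])
  have UT: "U (T \<alpha> l) = tensor \<alpha> l" if "\<alpha> \<in> words n A" "l \<in> L" for \<alpha> l
    by (rule ell2_eqI) (use that hilbert_space_zero[OF L] in \<open>auto simp: cU c_def T_gram intro!: C_eqI\<close>)
  \<comment> \<open>The identity is closed and linear in \<open>x\<close> for fixed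
    \<open>y\<close>, so it is checked at \<open>x = T \<alpha> l\<close>, where it is the defining
    property of \<open>C\<close>.\<close>
  have iso: "\<forall>y\<in>K. cinner (U x) (U y) = cinner x y" if "x \<in> K" for x
  proof (rule total[OF _ _ that])
    show "hilbert_space {x\<in>K. \<forall>y\<in>K. cinner (U x) (U y) = cinner x y}"
      by (intro hilbert_space_INT hilbert_space_equalizer hilbert_K bounded_clinear_on_cinner
          bounded_clinear_on_comp[OF bounded_clinear_on_cinner[of UNIV] U_bdd]) simp
    show "\<forall>y\<in>K. cinner (U (T \<alpha> l)) (U y) = cinner (T \<alpha> l) y" if "\<alpha> \<in> words n A" "l \<in> L" for \<alpha> l
      using that by (simp add: UT cinner_tensor_left cU c_def C)
  qed
  then have U_iso: "isometry_on K U"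
    using U_bdd by (auto simp: isometry_on_def bounded_clinear_on_def)
  have "standard_space n A L \<subseteq> U ` K"
    using UT T_mem by (intro standard_space_subset[OF L hilbert_space_isometry_image[OF U_iso hilbert_K]]) force
  then have "U ` K = standard_space n A L" using U_std by auto
  moreover have "U (V i s x) = standard_tuple n lam A W i s (U x)" if i: "i \<in> {1..k}" "s \<in> {1..n i}" and x: "x \<in> K" for i s x
  proof (rule ell2_eqI)
    fix \<beta>
    note ent = entryI[OF order_refl i]
    \<comment> \<open>Working in one coordinate makes both sides bounded and linear in
      \<open>x\<close>, so the intertwining relation holds on a closed subspace and needs checking
      on translates only.\<close>
    have bdd: "bounded_clinear_on K (\<lambda>x. coord (standard_tuple n lam A W i s (U x)) \<beta>)"
    proof (cases "i \<in> A")
      case True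
      then obtain d \<gamma> where "\<And>f. f \<in> standard_space n A L \<Longrightarrow>
          coord (standard_tuple n lam A W i s f) \<beta> = d *\<^sub>C coord f \<gamma>"
        using coord_standard_tuple_in(1)[OF A True i(2), of L W \<beta>] by blast
      then show ?thesis
        using bounded_clinear_on_scale[OF bounded_clinear_on_comp[OF bounded_clinear_on_coord[of UNIV] U_bdd]] U_std by simp
    next
      case False
      show ?thesis
      proof (cases "\<beta> \<in> words n A")
        case True
        have "bounded_clinear_on K (\<lambda>x. W i s (coord (U x) \<beta>))"
        proof (rule bounded_clinear_on_comp[OF bounded_op_bounded_clinear[OF W[OF ent False]]])
          show "bounded_clinear_on K (\<lambda>x. coord (U x) \<beta>)"
            by (rule bounded_clinear_on_comp[OF bounded_clinear_on_coord[of UNIV] U_bdd]) simp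
        qed (use standard_space_mem[OF U_std True] in auto)
        then show ?thesis
          using True by (simp add: coord_standard_tuple_out[where W = W and i = i and s = s, OF A ent False W[OF ent False] U_std] bounded_clinear_on_scale)
      next
        case False
        then show ?thesis
          using bounded_clinear_on_scale[OF bounded_clinear_on_id, of K 0] \<open>i \<notin> A\<close>
          by (auto simp: coord_standard_tuple_out[where W = W and i = i and s = s, OF A ent \<open>i \<notin> A\<close> W[OF ent \<open>i \<notin> A\<close>] U_std] bounded_clinear_on_def
              clinear_on_def intro!: exI[of _ 0])
      qed
    qed
    show "coord (U (V i s x)) \<beta> = coord (standard_tuple n lam A W i s (U x)) \<beta>"
    proof (rule total[OF _ _ x])
      have "bounded_clinear_on K (\<lambda>x. U (V i s x))"
        using V_mem[OF ent] by (intro bounded_clinear_on_comp[OF U_bdd V_bdd[OF ent]]) auto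
      then have "bounded_clinear_on K (\<lambda>x. coord (U (V i s x)) \<beta>)"
        using bounded_clinear_on_comp[OF bounded_clinear_on_coord[of UNIV]] by fastforce
      then show "hilbert_space {x\<in>K. coord (U (V i s x)) \<beta> = coord (standard_tuple n lam A W i s (U x)) \<beta>}"
        by (rule hilbert_space_equalizer[OF _ bdd hilbert_K])
      fix \<alpha> l assume \<alpha>: "\<alpha> \<in> words n A" and l: "l \<in> L"
      note U_scale = clinear_on_scaleC[OF bounded_clinear_onD[OF U_bdd]]
      have "U (V i s (T \<alpha> l)) = standard_tuple n lam A W i s (tensor \<alpha> l)"
      proof (cases "i \<in> A")
        case True
        then show ?thesis
          using words_push[OF \<alpha> True i(2)] standard_tuple_tensor[OF \<alpha>, of i W s lam l] \<alpha> l i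
          by (simp add: T_in U_scale T_mem UT)
      next
        case False
        have "W i s 0 = 0" "W i s l \<in> L"
          using clinear_on_zero[OF bounded_clinear_onD[OF bounded_op_bounded_clinear[OF W[OF ent False]]]
              hilbert_space_zero[OF L]] bounded_op_mem[OF W[OF ent False] l] by auto
        then show ?thesis
          using False \<alpha> l standard_tuple_tensor[OF \<alpha>, of i W s lam l]
          by (simp add: T_out ent U_scale T_mem UT)
      qed
      then show "coord (U (V i s (T \<alpha> l))) \<beta> = coord (standard_tuple n lam A W i s (U (T \<alpha> l))) \<beta>"
        by (simp add: UT \<alpha> l)
    qed
  qed
  ultimately show ?thesis
    using U_iso by (auto simp: unitarily_equivalent_def unitary_between_iff)
qed

end

section \<open>The classification\<close>

lemma unitarily_equivalent_sym:
  assumes K: "hilbert_space K" and V: "\<And>i s. i \<in> I \<Longrightarrow> s \<in> {1..n i} \<Longrightarrow> V i s ` K \<subseteq> K"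
    and eq: "unitarily_equivalent n I K V K' V'"
  shows "unitarily_equivalent n I K' V' K V"
proof -
  obtain U where U: "isometry_on K U" "U ` K = K'"
    and UV: "\<And>i s x. i \<in> I \<Longrightarrow> s \<in> {1..n i} \<Longrightarrow> x \<in> K \<Longrightarrow> U (V i s x) = V' i s (U x)"
    using eq by (auto simp: unitarily_equivalent_def unitary_between_iff)
  note inj = isometry_on_inj[OF U(1) K]
  have "inv_into K U ` K' = K" using inj U(2) by auto
  moreover have "inv_into K U (V' i s y) = V i s (inv_into K U y)"
    if "i \<in> I" "s \<in> {1..n i}" "y \<in> K'" for i s y
  proof -
    have "y \<in> U ` K" using that U(2) by simp
    then obtain x where x: "x \<in> K" "y = U x" by blast
    then show ?thesis
      using V[OF that(1,2)] inv_into_f_f[OF inj, of "V i s x"]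
      by (simp add: inv_into_f_f[OF inj] UV[OF that(1,2), symmetric] image_subset_iff)
  qed
  ultimately show ?thesis
    using isometry_on_inv[OF U(1) K] U(2)
    by (auto simp: unitarily_equivalent_def unitary_between_iff intro!: exI[of _ "inv_into K U"])
qed

lemma unitarily_equivalent_trans:
  assumes "unitarily_equivalent n I K V K' V'" "unitarily_equivalent n I K' V' K'' V''"
  shows "unitarily_equivalent n I K V K'' V''"
proof -
  obtain U where U: "isometry_on K U" "U ` K = K'"
      "\<forall>i\<in>I. \<forall>s\<in>{1..n i}. \<forall>x\<in>K. U (V i s x) = V' i s (U x)"
    using assms(1) unfolding unitarily_equivalent_def unitary_between_iff by blast
  moreover obtain U' where U': "isometry_on K' U'" "U' ` K' = K''"
      "\<forall>i\<in>I. \<forall>s\<in>{1..n i}. \<forall>x\<in>K'. U' (V' i s x) = V'' i s (U' x)"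
    using assms(2) unfolding unitarily_equivalent_def unitary_between_iff by blast
  ultimately have "isometry_on K (\<lambda>x. U' (U x)) \<and> (\<lambda>x. U' (U x)) ` K = K'' \<and>
      (\<forall>i\<in>I. \<forall>s\<in>{1..n i}. \<forall>x\<in>K. U' (U (V i s x)) = V'' i s (U' (U x)))"
    using isometry_on_comp[OF U(1) U'(1)] by (auto simp: image_image[symmetric])
  then show ?thesis unfolding unitarily_equivalent_def unitary_between_iff by blast
qed

text \<open>Surjectivity lets every test vector be pulled back, so the unitary intertwines the
  adjoints as well and carries their kernels to one another.\<close>

lemma wand_unitary_image:
  assumes 1: "lambda_tuple k n lam K V" and 2: "lambda_tuple k n lam K' V'"
    and U: "isometry_on K U" "U ` K = K'"
    and UV: "\<And>i s x. i \<in> {1..k} \<Longrightarrow> s \<in> {1..n i} \<Longrightarrow> x \<in> K \<Longrightarrow> U (V i s x) = V' i s (U x)"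
    and A: "A \<subseteq> {1..k}"
  shows "lambda_tuple.wand n K' V' A = U ` lambda_tuple.wand n K V A"
proof -
  interpret a: lambda_tuple k n lam K V by (rule 1)
  interpret b: lambda_tuple k n lam K' V' by (rule 2)
  have "b.Va i s (U x) = U (a.Va i s x)" if i: "i \<in> {1..k}" "s \<in> {1..n i}" and x: "x \<in> K" for i s x
  proof (rule adj_eqI[OF b.hilbert_K b.V_op])
    have e: "a.entry i s" using i by (simp add: a.entry_def)
    show "b.entry i s" using i by (simp add: b.entry_def)
    show "U (a.Va i s x) \<in> K'" using U(2) a.Va_mem[OF e] by blast
    fix y assume "y \<in> K'"
    then have "y \<in> U ` K" using U(2) by simp
    then obtain z where z: "z \<in> K" "y = U z" by blast
    have "cinner (V' i s y) (U x) = cinner (V i s z) x"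
      using z x by (simp add: UV[OF i, symmetric] isometry_on_cinner[OF U(1)] a.V_mem e)
    also have "\<dots> = cinner y (U (a.Va i s x))"
      using z by (simp add: isometry_on_cinner[OF U(1)] a.Va_mem e a.cinner_Va_right)
    finally show "cinner (V' i s y) (U x) = cinner y (U (a.Va i s x))" .
  qed
  moreover have "U y = 0 \<longleftrightarrow> y = 0" if "y \<in> K" for y
    using isometry_on_norm[OF U(1) that] by (metis norm_eq_zero)
  moreover have "a.Va i s x \<in> K" if "i \<in> A" "s \<in> {1..n i}" for i s x
    using a.Va_mem[OF a.entryI[OF A that]] .
  ultimately have "(\<forall>i\<in>A. \<forall>s\<in>{1..n i}. b.Va i s (U x) = 0) \<longleftrightarrow> (\<forall>i\<in>A. \<forall>s\<in>{1..n i}. a.Va i s x = 0)"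
    if "x \<in> K" for x
    using A that by (auto simp: subset_iff)
  moreover have "y \<in> K' \<longleftrightarrow> (\<exists>x\<in>K. y = U x)" for y using U(2) by auto
  ultimately show ?thesis unfolding a.wand_def b.wand_def by auto
qed

text \<open>Quantifiers cannot range over types, so existence is asserted for \<open>L\<close> in
  the type of \<open>K\<close>, where \<open>wand A\<close> lives, while the converse and uniqueness
  are stated for wandering spaces of other types.\<close>

theorem theorem3p3:
  fixes k :: nat and n :: "nat \<Rightarrow> nat" and lam :: "nat \<Rightarrow> nat \<Rightarrow> nat \<Rightarrow> nat \<Rightarrow> complex"
    and K :: "'a::chilbert_space set" and V :: "nat \<Rightarrow> nat \<Rightarrow> 'a \<Rightarrow> 'a"
  assumes "k \<ge> 1" and "\<And>i. i \<in> {1..k} \<Longrightarrow> n i \<ge> 1"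
    and "\<And>i j s t. i \<in> {1..k} \<Longrightarrow> j \<in> {1..k} \<Longrightarrow> i \<noteq> j \<Longrightarrow> s \<in> {1..n i} \<Longrightarrow> t \<in> {1..n j} \<Longrightarrow>
      cmod (lam i j s t) = 1 \<and> lam j i t s = cnj (lam i j s t)"
    and "doubly_commuting_row_isometries k n lam K V" and "K \<noteq> {0}"
  shows "(irreducible_on K (cstar K (tuple_ops n {1..k} V)) \<longleftrightarrow>
      (\<exists>A (L :: 'a set) W. irreducible_model k n lam K V A L W))
    \<and> ((\<exists>A (L :: 'c::chilbert_space set) W. irreducible_model k n lam K V A L W) \<longrightarrow>
      irreducible_on K (cstar K (tuple_ops n {1..k} V)))
    \<and> (irreducible_on K (cstar K (tuple_ops n {1..k} V)) \<longrightarrow>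
      (\<forall>(K' :: 'b::chilbert_space set) V'.
        doubly_commuting_row_isometries k n lam K' V' \<and> K' \<noteq> {0} \<and>
        irreducible_on K' (cstar K' (tuple_ops n {1..k} V')) \<longrightarrow>
        (\<forall>A (L :: 'c set) W A' (L' :: 'd::chilbert_space set) W'.
          irreducible_model k n lam K V A L W \<and> irreducible_model k n lam K' V' A' L' W' \<longrightarrow>
          (unitarily_equivalent n {1..k} K V K' V' \<longleftrightarrow>
            A = A' \<and> unitarily_equivalent n ({1..k} - A) L W L' W'))))"
proof -
  interpret a: lambda_tuple k n lam K V by (rule lambda_tuple.intro) (fact assms(3), fact assms(4))
  \<comment> \<open>The type of \<open>L\<close> is kept generic so that the fact serves both the
    equivalence and the second conjunct.\<close>
  have model_irr: "irreducible_on K (cstar K (tuple_ops n {1..k} V))"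
    if "irreducible_model k n lam K V A L W" for A and L :: "'e::chilbert_space set" and W
    using that a.unitary_imp_embedding[of A L W] a.embedding_irreducible[of A L W]
    by (auto simp: irreducible_model_def)
  have irr_model: "\<exists>A (L :: 'a set) W. irreducible_model k n lam K V A L W"
    if irr: "irreducible_on K (cstar K (tuple_ops n {1..k} V))"
  proof -
    note * = a.irreducible_imp_embedding[OF irr assms(5)]
    have "{i\<in>{1..k}. a.wand {i} \<noteq> {0}} \<subseteq> {1..k}" by auto
    from this a.embedding_imp_unitary[OF this *(1,2)] *(1,3)
    have "irreducible_model k n lam K V {i\<in>{1..k}. a.wand {i} \<noteq> {0}}
        (a.wand {i\<in>{1..k}. a.wand {i} \<noteq> {0}}) V"
      unfolding irreducible_model_def by blast
    then show ?thesis by blast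
  qed
  have uniqueness: "unitarily_equivalent n {1..k} K V K' V' \<longleftrightarrow>
      A = A' \<and> unitarily_equivalent n ({1..k} - A) L W L' W'"
    if K': "doubly_commuting_row_isometries k n lam K' V'" "K' \<noteq> {0}"
      and m: "irreducible_model k n lam K V A L W" and m': "irreducible_model k n lam K' V' A' L' W'"
    for K' :: "'b set" and V' A A' and L :: "'c set" and L' :: "'d set" and W W'
  proof -
    interpret b: lambda_tuple k n lam K' V' by (rule lambda_tuple.intro) (fact assms(3), fact K'(1))
    have A: "A \<subseteq> {1..k}" and data: "wandering_data k n lam A L W"
      and A': "A' \<subseteq> {1..k}" and data': "wandering_data k n lam A' L' W'"
      using m m' by (auto simp: irreducible_model_def)
    obtain e e' where emb: "a.wandering_embedding A L W e" and emb': "b.wandering_embedding A' L' W' e'"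
      using a.unitary_imp_embedding[OF A data] b.unitary_imp_embedding[OF A' data'] m m'
      by (auto simp: irreducible_model_def)
    note L = a.hilbert_L[OF A data emb] and L' = b.hilbert_L[OF A' data' emb']
    note e = a.embedding_isometry[OF A data emb] and e' = b.embedding_isometry[OF A' data' emb']
    have entry: "b.entry = a.entry" by (auto simp: a.entry_def b.entry_def fun_eq_iff)
    show ?thesis
    proof
      assume "unitarily_equivalent n {1..k} K V K' V'"
      then obtain U where U: "isometry_on K U" "U ` K = K'"
        and UV: "\<And>i s x. i \<in> {1..k} \<Longrightarrow> s \<in> {1..n i} \<Longrightarrow> x \<in> K \<Longrightarrow> U (V i s x) = V' i s (U x)"
        by (auto simp: unitarily_equivalent_def unitary_between_iff)
      have wand: "b.wand B = U ` a.wand B" if "B \<subseteq> {1..k}" for B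
        by (rule wand_unitary_image[OF a.lambda_tuple_axioms b.lambda_tuple_axioms])
          (fact U UV that)+
      have "U ` S = {0} \<longleftrightarrow> S = {0}" if "S \<subseteq> K" for S
        using inj_on_image_eq_iff[OF isometry_on_inj[OF U(1) a.hilbert_K] that, of "{0}"]
          hilbert_space_zero[OF a.hilbert_K] clinear_on_zero[OF isometry_on_clinear[OF U(1)]] by simp
      then have *: "b.wand {i} = {0} \<longleftrightarrow> a.wand {i} = {0}" if "i \<in> {1..k}" for i
        using wand[of "{i}"] that a.wand_subset[of "{i}"] by simp
      \<comment> \<open>Each set is read off from the kernels of single rows, and the unitary
        preserves which of them vanish.\<close>
      have "A = {i\<in>{1..k}. a.wand {i} \<noteq> {0}}" by (rule a.embedding_set[OF A data emb assms(5)])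
      also have "\<dots> = {i\<in>{1..k}. b.wand {i} \<noteq> {0}}" by (rule Collect_cong) (metis *)
      also have "\<dots> = A'" by (rule b.embedding_set[OF A' data' emb' K'(2), symmetric])
      finally have AA: "A = A'" .
      have "e' ` L' = b.wand A" unfolding AA by (rule b.embedding_range[OF A' data' emb'])
      also have "\<dots> = U ` e ` L" unfolding a.embedding_range[OF A data emb] by (rule wand[OF A])
      finally have range: "e' ` L' = U ` e ` L" .
      define R where "R = inv_into L' e'"
      \<comment> \<open>The given unitary restricted to the wandering spaces, with both embeddings
        undone.\<close>
      define u where "u l = R (U (e l))" for l
      have R: "isometry_on (e' ` L') R" unfolding R_def by (rule isometry_on_inv[OF e' L'])
      have Re': "R (e' l) = l" if "l \<in> L'" for l
        using that inv_into_f_f[OF isometry_on_inj[OF e' L']] by (simp add: R_def)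
      have eu: "e' (u l) = U (e l)" "u l \<in> L'" if "l \<in> L" for l
      proof -
        obtain l' where "l' \<in> L'" "U (e l) = e' l'" using \<open>l \<in> L\<close> range by blast
        then show "e' (u l) = U (e l)" "u l \<in> L'" by (simp_all add: u_def Re')
      qed
      have "isometry_on L (\<lambda>l. U (e l))"
        using isometry_on_comp[OF e U(1)] a.embedding_subset[OF A data emb] .
      then have "isometry_on L u"
        unfolding u_def by (rule isometry_on_comp[OF _ R]) (use range in auto)
      moreover have "u ` L = L'"
      proof
        show "L' \<subseteq> u ` L"
        proof
          fix l' assume l': "l' \<in> L'"
          then obtain l where "l \<in> L" "e' l' = U (e l)" using range by (metis (no_types, lifting) imageE imageI)
          then show "l' \<in> u ` L" using Re'[OF l'] by (auto simp: u_def)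
        qed
      qed (use eu in auto)
      moreover have "u (W j t l) = W' j t (u l)" if j: "j \<in> {1..k} - A" "t \<in> {1..n j}" and l: "l \<in> L" for j t l
      proof -
        have j': "a.entry j t" "j \<notin> A" "b.entry j t" "j \<notin> A'" using j AA by (auto simp: a.entry_def b.entry_def)
        have el: "e l \<in> K" using l a.embedding_subset[OF A data emb] by blast
        have "e' (W' j t (u l)) = V' j t (e' (u l))"
          using b.embedding_V[OF A' data' emb' j'(3,4) eu(2)[OF l]] by simp
        also have "\<dots> = U (V j t (e l))" using UV[of j t "e l"] j el by (simp add: eu[OF l])
        also have "\<dots> = U (e (W j t l))" by (simp add: a.embedding_V[OF A data emb j'(1,2) l])
        finally show ?thesis
          using Re'[of "W' j t (u l)"] bounded_op_mem[OF b.W_op[OF A' data' emb' j'(3,4)] eu(2)[OF l]]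
          by (simp add: u_def)
      qed
      ultimately show "A = A' \<and> unitarily_equivalent n ({1..k} - A) L W L' W'"
        using AA by (auto simp: unitarily_equivalent_def unitary_between_iff)
    next
      assume *: "A = A' \<and> unitarily_equivalent n ({1..k} - A) L W L' W'"
      then obtain u where u: "isometry_on L u" "u ` L = L'"
        and uW: "\<And>j t l. j \<in> {1..k} - A \<Longrightarrow> t \<in> {1..n j} \<Longrightarrow> l \<in> L \<Longrightarrow> u (W j t l) = W' j t (u l)"
        by (auto simp: unitarily_equivalent_def unitary_between_iff)
      \<comment> \<open>Composing with \<open>u\<close> makes \<open>(L, W)\<close> wandering data
        for \<open>V'\<close> too, so both tuples are equivalent to the same standard tuple.\<close>
      have "b.wandering_embedding A L W (\<lambda>l. e' (u l))"
        unfolding b.wandering_embedding_def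
      proof (intro conjI allI impI ballI)
        have image: "(\<lambda>l. e' (u l)) ` L = e' ` L'" using u(2) by auto
        show "isometry_on L (\<lambda>l. e' (u l))" using u by (intro isometry_on_comp[OF u(1) e']) auto
        show "(\<lambda>l. e' (u l)) ` L \<subseteq> b.wand A" "b.orbit A ((\<lambda>l. e' (u l)) ` L) = K'"
          unfolding image using emb' * by (simp_all add: b.wandering_embedding_def)
        fix j t l assume j: "b.entry j t \<and> j \<notin> A" and l: "l \<in> L"
        then have "u l \<in> L'" "u (W j t l) = W' j t (u l)" using u(2) uW by (auto simp: b.entry_def)
        then show "V' j t (e' (u l)) = e' (u (W j t l))"
          using b.embedding_V[OF A' data' emb'] j * by simp
      qed
      then have "unitarily_equivalent n {1..k} K' V' (standard_space n A L) (standard_tuple n lam A W)"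
        by (rule b.embedding_imp_unitary[OF A data])
      then have "unitarily_equivalent n {1..k} (standard_space n A L) (standard_tuple n lam A W) K' V'"
        by (rule unitarily_equivalent_sym[OF b.hilbert_K, rotated]) (auto simp: b.V_mem b.entry_def)
      moreover have "unitarily_equivalent n {1..k} K V (standard_space n A L) (standard_tuple n lam A W)"
        using m by (simp add: irreducible_model_def)
      ultimately show "unitarily_equivalent n {1..k} K V K' V'"
        using unitarily_equivalent_trans by blast
    qed
  qed
  show ?thesis
    by (intro conjI impI iffI[of "irreducible_on K _"] allI; (elim conjE exE)?;
        (erule irr_model | erule model_irr | (rule uniqueness; assumption)))
qed

end
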